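(* Let $n\ge 0$, let $C_0,\ldots,C_n\in\mathcal{P}(\mathbb{R}^d)$ be polyhedral cones, let $T_0,\ldots,T_n\in \mathrm{GL}_d$, and let $k>0$ (an integer, $k\le d$). Then for $Q_0,\ldots,Q_n\in O(d)$ independent and uniformly at random, $$\mathbb{E}\bigg[ u_k\bigg( \bigcap_{i=0}^n T_iQ_i C_i \bigg)\bigg] = u_{nd+k}(C_0\times\cdots\times C_n),$$ $$\mathbb{E}\bigg[ v_k\bigg( \bigcap_{i=0}^n T_iQ_i C_i \bigg)\bigg] = v_{nd+k}(C_0\times\cdots\times C_n).$$
   Context: A polyhedral cone in $\mathbb{R}^d$ is a set of the form $\{x\in\mathbb{R}^d : Ax\le 0\}$ for some real matrix $A$ with $d$ columns; $\mathcal{P}(\mathbb{R}^d)$ is the set of polyhedral cones in $\mathbb{R}^d$. A face of $C\in\mathcal{P}(\mathbb{R}^d)$ is a subset of the form $F=\{x\in C: \langle x,z\rangle=0\}$, where $z\in\mathbb{R}^d$ satisfies $\langle x,z\rangle\le 0$ for all $x\in C$ (in particular $C$ itself is a face). $\mathcal{L}_k(C)$ is the (finite) set of linear spans of faces of $C$ whose span has dimension $k$. The polar cone is $C^\circ=\{z: \langle x,z\rangle\le 0 \text{ for all } x\in C\}$. For a linear subspace $L$, $\gamma_L$ denotes the standard Gaussian measure on $L$ (the Dirac measure at the origin if $\dim L=0$). For $C\in\mathcal{P}(\mathbb{R}^d)$ and $0\le k\le d$, $$u_k(C)=\sum_{L\in\mathcal{L}_k(C)}\gamma_L(C\cap L),\qquad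 v_k(C)=\sum_{L\in\mathcal{L}_k(C)}\gamma_L(C\cap L)\,\gamma_{L^\perp}(C^\circ\cap L^\perp).$$ The product $C_0\times\cdots\times C_n$ is a polyhedral cone in $\mathbb{R}^{(n+1)d}$. "Uniformly at random" in the orthogonal group $O(d)$ means distributed according to the normalized Haar measure. *)

theory Defs
  imports "HOL-Probability.Probability"
begin

section \<open>Polyhedral cones\<close>

text \<open>The vectors \<open>a 0, \<dots>, a (m - 1)\<close> are the rows of the matrix; \<open>m = 0\<close> gives the whole space.\<close>

definition polyhedral_cone :: "'a::euclidean_space set \<Rightarrow> bool" where
  "polyhedral_cone C \<longleftrightarrow>
     (\<exists>(m::nat) (a :: nat \<Rightarrow> 'a). C = {x. \<forall>j<m. a j \<bullet> x \<le> 0})"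

definition polar_cone :: "'a::euclidean_space set \<Rightarrow> 'a set" where
  "polar_cone C = {z. \<forall>x\<in>C. x \<bullet> z \<le> 0}"

text \<open>Unlike the library's \<open>exposed_face_of\<close>, the supporting hyperplane passes through the
  origin, so that the empty set is not a face of a cone.\<close>

definition cone_face :: "'a::euclidean_space set \<Rightarrow> 'a set \<Rightarrow> bool" where
  "cone_face F C \<longleftrightarrow> (\<exists>z. (\<forall>x\<in>C. x \<bullet> z \<le> 0) \<and> F = {x\<in>C. x \<bullet> z = 0})"

definition face_spans :: "nat \<Rightarrow> 'a::euclidean_space set \<Rightarrow> 'a set set" where
  "face_spans k C = {span F | F. cone_face F C \<and> dim (span F) = k}"

text \<open>A sum over an infinite set would be \<open>0\<close>; sums over \<open>face_spans k C\<close> are finite sums.\<close>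

lemma finite_face_spans:
  assumes "polyhedral_cone C"
  shows "finite (face_spans k C)"
proof -
  obtain m :: nat and a where C: "C = {x. \<forall>j<m. a j \<bullet> x \<le> 0}"
    using assms unfolding polyhedral_cone_def by blast
  have "C = \<Inter> ((\<lambda>j. {x. a j \<bullet> x \<le> 0}) ` {..<m})"
    unfolding C by auto
  moreover have "polyhedron (\<Inter> ((\<lambda>j. {x. a j \<bullet> x \<le> 0}) ` {..<m}))"
    by (rule polyhedron_Inter) (auto simp: polyhedron_halfspace_le)
  ultimately have P: "polyhedron C"
    by simp
  have "F face_of C" if face: "cone_face F C" for F
  proof -
    obtain z where z: "\<forall>x\<in>C. x \<bullet> z \<le> 0" and F: "F = {x\<in>C. x \<bullet> z = 0}"
      using face unfolding cone_face_def by blast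
    have "(C \<inter> {x. z \<bullet> x = 0}) face_of C"
      by (rule face_of_Int_supporting_hyperplane_le)
         (use z P polyhedron_imp_convex in \<open>auto simp: inner_commute\<close>)
    moreover have "F = C \<inter> {x. z \<bullet> x = 0}"
      unfolding F by (auto simp: inner_commute)
    ultimately show ?thesis
      by simp
  qed
  then have "face_spans k C \<subseteq> span ` {F. F face_of C}"
    unfolding face_spans_def by blast
  then show ?thesis
    using finite_polyhedron_faces[OF P] finite_subset by blast
qed

text \<open>\<open>C\<^sub>0 \<times> \<dots> \<times> C\<^sub>n\<close> for a family indexed by a finite type with \<open>n + 1\<close> elements; the ambient
  Euclidean space has dimension \<open>(n + 1) * d\<close>, and its inner product is the sum of the inner
  products of the components.\<close>

definition product_cone :: "('i::finite \<Rightarrow> (real^'d) set) \<Rightarrow> (real^'d^'i) set" where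
  "product_cone C = {x. \<forall>i. x $ i \<in> C i}"

section \<open>Gaussian measures on linear subspaces\<close>

definition orthonormal_basis_of :: "'a::euclidean_space set \<Rightarrow> 'a set \<Rightarrow> bool" where
  "orthonormal_basis_of B L \<longleftrightarrow>
     pairwise orthogonal B \<and> (\<forall>b\<in>B. norm b = 1) \<and> span B = L"

text \<open>The standard Gaussian measure on the subspace \<open>L\<close>, as a Borel measure on the ambient space:
  the law of \<open>\<Sum>b\<in>B. X\<^sub>b b\<close> for independent standard normal \<open>X\<^sub>b\<close> and an orthonormal basis \<open>B\<close> of \<open>L\<close>.
  By rotation invariance the choice of \<open>B\<close> is immaterial. For \<open>L = {0}\<close> the basis is empty, and
  the measure is the Dirac measure at the origin.\<close>

definition gaussian_on :: "'a::euclidean_space set \<Rightarrow> 'a measure" where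
  "gaussian_on L =
     (let B = (SOME B. orthonormal_basis_of B L) in
        distr (\<Pi>\<^sub>M b\<in>B. density lborel (\<lambda>t. ennreal (std_normal_density t))) borel
              (\<lambda>c. \<Sum>b\<in>B. c b *\<^sub>R b))"

definition u_functional :: "nat \<Rightarrow> 'a::euclidean_space set \<Rightarrow> real" where
  "u_functional k C = (\<Sum>L\<in>face_spans k C. measure (gaussian_on L) (C \<inter> L))"

definition v_functional :: "nat \<Rightarrow> 'a::euclidean_space set \<Rightarrow> real" where
  "v_functional k C =
     (\<Sum>L\<in>face_spans k C.
        measure (gaussian_on L) (C \<inter> L) *
        measure (gaussian_on (orthogonal_comp L)) (polar_cone C \<inter> orthogonal_comp L))"

section \<open>The uniform distribution on the orthogonal group\<close>

definition orthogonal_group :: "(real^'d^'d) measure" where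
  "orthogonal_group = restrict_space borel {P. orthogonal_matrix P}"

text \<open>A left-invariant Borel probability measure on a compact group is the normalized
  Haar measure.\<close>

definition normalized_haar :: "(real^'d^'d) measure \<Rightarrow> bool" where
  "normalized_haar \<mu> \<longleftrightarrow>
     prob_space \<mu> \<and> sets \<mu> = sets orthogonal_group \<and>
     (\<forall>P. orthogonal_matrix P \<longrightarrow> distr \<mu> \<mu> (\<lambda>A. P ** A) = \<mu>)"

end

theory Submission
  imports Defs
begin

text \<open>The proof writes both sides as sums over the same index set and compares them term by term.

  Let a cone consist of the \<open>x\<close> with \<open>a s \<bullet> x \<le> 0\<close> for all \<open>s \<in> S\<close>.  For \<open>I \<subseteq> S\<close> the
  subspace \<open>flat I a\<close> is given by \<open>a s \<bullet> x = 0\<close> for \<open>s \<in> I\<close>, and \<open>open_face S a I\<close> consists of the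
  points of the cone at which exactly the inequalities in \<open>I\<close> are tight.  The non-empty open faces are the
  relative interiors of the faces, their flats are the spans of the faces, and the normal cone of the face is
  generated by the \<open>a s\<close> with \<open>s \<in> I\<close> (Farkas).  As the relative boundary of a face is a Gaussian null set,
  \<open>u\<^sub>k\<close> is the sum, over all \<open>I\<close> whose flat has dimension \<open>k\<close>, of the Gaussian measures of the open faces; for
  \<open>v\<^sub>k\<close> each summand gets as a second factor the Gaussian measure of the cone generated by the \<open>a s\<close> with
  \<open>s \<in> I\<close> (lemmas \<open>u_functional_ineq_cone\<close> and \<open>v_functional_ineq_cone\<close>).  The intersection of the
  cones \<open>T\<^sub>i Q\<^sub>i C\<^sub>i\<close> and the product of the \<open>C\<^sub>i\<close> are given by equally indexed inequalities: a normal
  vector \<open>a\<^sub>i\<^sub>j\<close> of \<open>C\<^sub>i\<close> turns into \<open>T\<^sub>i\<^sup>-\<^sup>T Q\<^sub>i a\<^sub>i\<^sub>j\<close> for the one and into \<open>axis i a\<^sub>i\<^sub>j\<close> for the other.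

  Fix \<open>I\<close>, let \<open>V\<^sub>i\<close> be the span of the \<open>a\<^sub>i\<^sub>j\<close> with \<open>(i, j) \<in> I\<close>, and \<open>L\<^sub>i\<close> its orthogonal complement.
  Almost surely the spaces \<open>T\<^sub>i\<^sup>-\<^sup>T Q\<^sub>i V\<^sub>i\<close> are in general position (\<open>AE_transversal\<close>).  Since \<open>k > 0\<close>, the flat of
  the intersection then has dimension \<open>k\<close> exactly if the flat of the product has dimension \<open>n d + k\<close>, and in this
  case a vector is uniquely a sum of a vector \<open>x\<close> of the flat and of \<open>T\<^sub>i\<^sup>-\<^sup>T Q\<^sub>i z\<^sub>i\<close> with
  \<open>z\<^sub>i \<in> V\<^sub>i\<close>.  The point \<open>x\<close> lies in the open face exactly if every \<open>u\<^sub>i = Q\<^sub>i\<^sup>T T\<^sub>i\<^sup>-\<^sup>1 x \<in> L\<^sub>i\<close> lies in the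
  corresponding open face of \<open>C\<^sub>i\<close>, and the remaining part lies in the normal cone exactly if every \<open>z\<^sub>i\<close> lies
  in that of \<open>C\<^sub>i\<close>.  Multiplying \<open>Q\<^sub>i\<close> on the right by the reflection along a vector of \<open>L\<^sub>i\<close> or of \<open>V\<^sub>i\<close>
  preserves its law and the flat, and it reflects \<open>u\<^sub>i\<close> or \<open>z\<^sub>i\<close> while fixing all the other \<open>u\<close> and \<open>z\<close>.
  So each of these vectors has a uniformly distributed direction, given the others, and
  the probability is the product of the Gaussian measures of the open faces and normal cones of the
  \<open>C\<^sub>i\<close>, whatever the \<open>T\<^sub>i\<close> are (\<open>expected_weight\<close>).  This product is the term of \<open>I\<close> for the product cone.
  That \<open>x\<close> has a direction at all is where \<open>k > 0\<close> enters again.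

  Two tools carry the measure theory.  By Christensen's theorem there is at most one probability measure on a set
  for which balls of equal radius centred in the set have equal mass (\<open>uniformly_distributed_unique\<close>); so invariance
  under reflections suffices to recognise the uniform distribution on a sphere.  And projections of countable unions of compact sets are again such unions, hence
  Borel (\<open>fsigma_project\<close>), which shows that everything depends measurably on the rotations.\<close>

section \<open>Projections of sigma-compact sets\<close>

lemma fsigma_closed: "closed S \<Longrightarrow> fsigma S"
  using fsigma.intros[of "\<lambda>_. S"] by simp

lemma fsigma_Union_nat:
  assumes "\<And>n::nat. fsigma (S n)"
  shows "fsigma (\<Union>n. S n)"
proof -
  have "\<exists>F. (\<forall>m::nat. closed (F m)) \<and> S n = (\<Union>m. F m)" for n
    using assms[of n] by (auto elim!: fsigma.cases)
  then obtain F where F: "\<And>n m::nat. closed (F n m)" "\<And>n. S n = (\<Union>m. F n m)"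
    by metis
  have "(\<Union>n. S n) = (\<Union>k. case prod_decode k of (n, m) \<Rightarrow> F n m)"
  proof (intro equalityI subsetI)
    fix x assume "x \<in> (\<Union>n. S n)"
    then obtain n m where "x \<in> F n m" by (auto simp: F)
    then show "x \<in> (\<Union>k. case prod_decode k of (n, m) \<Rightarrow> F n m)"
      by (intro UN_I[of "prod_encode (n, m)"]) auto
  next
    fix x assume "x \<in> (\<Union>k. case prod_decode k of (n, m) \<Rightarrow> F n m)"
    then obtain k where "x \<in> (case prod_decode k of (n, m) \<Rightarrow> F n m)" by (rule UN_E)
    then show "x \<in> (\<Union>n. S n)"
      by (cases "prod_decode k") (auto simp: F)
  qed
  moreover have "closed (case prod_decode k of (n, m) \<Rightarrow> F n m)" for k
    by (auto split: prod.splits simp: F)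
  ultimately show ?thesis
    by (metis fsigma.intros)
qed

lemma fsigma_Int:
  assumes "fsigma S" "fsigma T"
  shows "fsigma (S \<inter> T)"
proof -
  obtain F G where FG: "\<And>m::nat. closed (F m)" "S = (\<Union>m. F m)" "\<And>m::nat. closed (G m)" "T = (\<Union>m. G m)"
    using assms by (auto elim!: fsigma.cases)
  have "S \<inter> T = (\<Union>n. \<Union>m. F n \<inter> G m)"
    by (auto simp: FG)
  then show ?thesis
    by (simp only:) (intro fsigma_Union_nat fsigma_closed closed_Int FG(1,3))
qed

lemma fsigma_Collect_conj: "fsigma {x. P x} \<Longrightarrow> fsigma {x. Q x} \<Longrightarrow> fsigma {x. P x \<and> Q x}"
  using fsigma_Int[of "{x. P x}" "{x. Q x}"] by (simp add: Collect_conj_eq)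

lemma fsigma_Collect_ball:
  assumes "finite I" "\<And>i. i \<in> I \<Longrightarrow> fsigma {x::'a::real_inner. P i x}"
  shows "fsigma {x. \<forall>i\<in>I. P i x}"
  using assms by (induction I) (auto intro!: fsigma_Collect_conj)

lemma fsigma_open:
  fixes S :: "'a::euclidean_space set"
  assumes "open S"
  shows "fsigma S"
proof -
  obtain F where "\<And>n::nat. closed (F n)" "S = (\<Union>n. F n)"
    using open_Union_compact_subsets[OF assms] compact_imp_closed by metis
  then show ?thesis
    by (metis fsigma.intros)
qed

lemma fsigma_vimage:
  assumes "fsigma S" "continuous_on UNIV f"
  shows "fsigma (f -` S)"
proof -
  obtain F where F: "\<And>m::nat. closed (F m)" "S = (\<Union>m. F m)"
    using assms by (auto elim!: fsigma.cases)
  have "f -` S = (\<Union>m. f -` F m)"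
    by (auto simp: F)
  then show ?thesis
    using closed_vimage[OF F(1) assms(2)] by (metis fsigma.intros)
qed

lemma fsigma_Collect_comp:
  assumes "fsigma {y. P y}" "continuous_on UNIV f"
  shows "fsigma {x. P (f x)}"
  using fsigma_vimage[OF assms] by (simp add: vimage_def)

lemma fsigma_image:
  fixes f :: "'a::euclidean_space \<Rightarrow> 'b::euclidean_space"
  assumes "fsigma S" "continuous_on UNIV f"
  shows "fsigma (f ` S)"
proof -
  obtain F :: "nat \<Rightarrow> 'a set" where F: "range F \<subseteq> Collect compact" "S = (\<Union>m. F m)"
    using assms by (auto simp: fsigma_Union_compact)
  have "f ` S = (\<Union>m. f ` F m)"
    by (auto simp: F)
  moreover have "compact (f ` F m)" for m
    using F(1) by (intro compact_continuous_image continuous_on_subset[OF assms(2)]) auto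
  ultimately show ?thesis
    by (metis fsigma.intros compact_imp_closed)
qed

text \<open>A closed subset of a Euclidean space is a countable union of compact sets, and compactness
  survives projections.  The measurable dependence on the rotations reduces to this.\<close>

lemma fsigma_project:
  fixes P :: "'a::euclidean_space \<Rightarrow> 'b::euclidean_space \<Rightarrow> bool"
  assumes "fsigma {p. P (fst p) (snd p)}"
  shows "fsigma {x. \<exists>y. P x y}"
proof -
  have "{x. \<exists>y. P x y} = fst ` {p. P (fst p) (snd p)}"
    by (force simp: image_iff)
  then show ?thesis
    using fsigma_image[OF assms, of fst] by (simp add: continuous_on_fst)
qed

lemma fsigma_borel: "fsigma S \<Longrightarrow> S \<in> sets borel"
  by (auto elim!: fsigma.cases)

section \<open>Uniformly distributed measures\<close>

lemma compact_generates_borel: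
  "sets (borel :: 'a::euclidean_space measure) = sigma_sets UNIV (Collect compact)"
proof (intro equalityI)
  have closed: "S \<in> sigma_sets UNIV (Collect compact)" if S: "closed S" for S :: "'a set"
  proof -
    have "S = (\<Union>n. S \<inter> cball 0 (real n))"
      by (auto simp: real_arch_simple)
    moreover have "compact (S \<inter> cball 0 (real n))" for n
      by (simp add: closed_Int_compact that)
    then have "(\<Union>n. S \<inter> cball 0 (real n)) \<in> sigma_sets UNIV (Collect compact)"
      by (intro sigma_sets.Union sigma_sets.Basic) auto
    ultimately show ?thesis
      by simp
  qed
  show "sets borel \<subseteq> sigma_sets UNIV (Collect compact :: 'a set set)"
    unfolding borel_eq_closed using closed by (auto intro!: sigma_sets_mono)
  show "sigma_sets UNIV (Collect compact :: 'a set set) \<subseteq> sets borel"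
    by (metis borel_compact mem_Collect_eq sets.sigma_sets_subset space_borel subsetI)
qed

text \<open>Let \<open>m e\<close> be the common mass of the balls of radius \<open>e\<close>.  The measure, under the product of \<open>\<mu>\<close>
  and \<open>\<nu>\<close>, of the pairs at distance less than \<open>e\<close> with first component in \<open>K\<close> is \<open>m e\<close> times
  \<open>\<mu> K\<close>, and at most \<open>m e\<close> times the \<open>\<nu>\<close>-mass of the \<open>e\<close>-neighbourhood of \<open>K\<close>.  Let \<open>e\<close> tend to \<open>0\<close>.\<close>

lemma emeasure_compact_le_of_balls:
  fixes \<mu> \<nu> :: "'a::euclidean_space measure"
  assumes sets[measurable_cong]: "sets \<mu> = sets borel" "sets \<nu> = sets borel"
    and fin: "sigma_finite_measure \<mu>" "sigma_finite_measure \<nu>"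
    and S[measurable]: "S \<in> sets borel"
    and null: "emeasure \<mu> (- S) = 0" "emeasure \<nu> (- S) = 0"
    and bdd: "\<And>r. emeasure \<nu> (ball 0 r) < \<infinity>"
    and m: "\<And>e. 0 < e \<Longrightarrow> 0 < m e \<and> m e < \<infinity>"
    and balls: "\<And>e x. 0 < e \<Longrightarrow> x \<in> S \<Longrightarrow> emeasure \<mu> (ball x e) = m e \<and> emeasure \<nu> (ball x e) = m e"
    and K: "compact K"
  shows "emeasure \<mu> K \<le> emeasure \<nu> K"
proof -
  interpret M: sigma_finite_measure \<mu> by fact
  interpret N: sigma_finite_measure \<nu> by fact
  interpret pair_sigma_finite \<mu> \<nu> by unfold_locales
  have [measurable]: "K \<in> sets borel"
    using K by (simp add: borel_compact)
  have aeM: "AE x in \<mu>. x \<in> S"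
    by (rule AE_I[of _ _ "-S"]) (use null in \<open>auto simp: sets\<close>)
  have aeN: "AE x in \<nu>. x \<in> S"
    by (rule AE_I[of _ _ "-S"]) (use null in \<open>auto simp: sets\<close>)
  define U where "U e = (\<Union>x\<in>K. ball x e)" for e
  have oU: "open (U e)" for e
    unfolding U_def by auto
  then have [measurable]: "U e \<in> sets borel" for e
    by auto
  have key: "emeasure \<mu> K \<le> emeasure \<nu> (U e)" if "0 < e" for e
  proof -
    have "m e * emeasure \<mu> K = (\<integral>\<^sup>+x. m e * indicator K x \<partial>\<mu>)"
      by (simp add: nn_integral_cmult_indicator sets)
    also have "\<dots> = (\<integral>\<^sup>+x. (\<integral>\<^sup>+y. indicator K x * indicator (ball x e) y \<partial>\<nu>) \<partial>\<mu>)"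
    proof (rule nn_integral_cong_AE, use aeM in eventually_elim)
      fix x assume "x \<in> S"
      then show "m e * indicator K x = (\<integral>\<^sup>+y. indicator K x * indicator (ball x e) y \<partial>\<nu>)"
        using balls[of e x] that by (subst nn_integral_cmult) (auto simp: sets mult.commute intro!: borel_measurable_indicator)
    qed
    also have "\<dots> = (\<integral>\<^sup>+x. (\<integral>\<^sup>+y. indicator {p \<in> space (borel \<Otimes>\<^sub>M borel). fst p \<in> K \<and> dist (fst p) (snd p) < e} (x, y) \<partial>\<nu>) \<partial>\<mu>)"
      by (intro nn_integral_cong) (auto simp: indicator_def space_pair_measure)
    also have "\<dots> = (\<integral>\<^sup>+y. (\<integral>\<^sup>+x. indicator {p \<in> space (borel \<Otimes>\<^sub>M borel). fst p \<in> K \<and> dist (fst p) (snd p) < e} (x, y) \<partial>\<mu>) \<partial>\<nu>)"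
      by (rule Fubini'[symmetric]) measurable
    also have "\<dots> \<le> (\<integral>\<^sup>+y. (\<integral>\<^sup>+x. indicator (U e) y * indicator (ball y e) x \<partial>\<mu>) \<partial>\<nu>)"
      by (intro nn_integral_mono) (auto simp: indicator_def U_def dist_commute)
    also have "\<dots> = (\<integral>\<^sup>+y. m e * indicator (U e) y \<partial>\<nu>)"
    proof (rule nn_integral_cong_AE, use aeN in eventually_elim)
      fix y assume "y \<in> S"
      then show "(\<integral>\<^sup>+x. indicator (U e) y * indicator (ball y e) x \<partial>\<mu>) = m e * indicator (U e) y"
        using balls[of e y] that by (subst nn_integral_cmult) (auto simp: sets mult.commute intro!: borel_measurable_indicator)
    qed
    also have "\<dots> = m e * emeasure \<nu> (U e)"
      by (simp add: nn_integral_cmult_indicator sets)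
    finally have "m e * emeasure \<mu> K \<le> m e * emeasure \<nu> (U e)" .
    then show ?thesis
      using m[OF that] by (auto simp: ennreal_mult_le_mult_iff)
  qed
  define V where "V n = U (1 / Suc n)" for n
  have V1: "U 1 \<subseteq> ball 0 (B + 2)" if "K \<subseteq> cball 0 B" for B
  proof
    fix y assume "y \<in> U 1"
    then obtain x where "x \<in> K" "dist x y < 1"
      by (auto simp: U_def)
    moreover have "norm y \<le> norm x + dist x y"
      by (metis dist_norm norm_triangle_sub norm_minus_commute)
    moreover have "norm x \<le> B"
      using \<open>x \<in> K\<close> that by auto
    ultimately show "y \<in> ball 0 (B + 2)"
      by auto
  qed
  obtain B where B: "K \<subseteq> cball 0 B"
    using bounded_subset_ballD[OF compact_imp_bounded[OF K], of 0] ball_subset_cball[of 0] by blast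
  have decV: "decseq V"
    unfolding V_def U_def decseq_def
    by (fastforce simp: frac_le intro: less_le_trans)
  have finV: "emeasure \<nu> (V n) \<noteq> \<infinity>" for n
  proof -
    have "V n \<subseteq> U 1"
      using decseqD[OF decV, of 0 n] by (simp add: V_def)
    then have "emeasure \<nu> (V n) \<le> emeasure \<nu> (ball 0 (B + 2))"
      using V1[OF B] by (intro emeasure_mono) (auto simp: sets)
    also have "\<dots> < \<infinity>"
      by (rule bdd)
    finally show ?thesis
      by simp
  qed
  have INTV: "(\<Inter>n. V n) = K"
  proof (intro equalityI subsetI)
    fix y assume y: "y \<in> (\<Inter>n. V n)"
    have "\<exists>x\<in>K. dist x y < e" if "e > 0" for e
    proof -
      obtain n where "1 / Suc n < e"
        using \<open>e > 0\<close> by (metis inverse_eq_divide reals_Archimedean)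
      moreover have "y \<in> V n" using y by auto
      ultimately show ?thesis
        unfolding V_def U_def by (force intro: less_trans)
    qed
    then have "y \<in> closure K"
      by (simp add: closure_approachable)
    then show "y \<in> K"
      using K compact_imp_closed by (metis closure_closed)
  qed (force simp: V_def U_def)
  have "emeasure \<mu> K \<le> (INF n. emeasure \<nu> (V n))"
    unfolding V_def by (intro INF_greatest key) auto
  also have "\<dots> = emeasure \<nu> (\<Inter>n. V n)"
    using oU by (intro INF_emeasure_decseq decV finV) (auto simp: V_def sets)
  finally show ?thesis
    by (simp add: INTV)
qed

lemma measure_eqI_balls:
  fixes \<mu> \<nu> :: "'a::euclidean_space measure"
  assumes sets: "sets \<mu> = sets borel" "sets \<nu> = sets borel"
    and fin: "sigma_finite_measure \<mu>" "sigma_finite_measure \<nu>"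
    and S: "S \<in> sets borel"
    and null: "emeasure \<mu> (- S) = 0" "emeasure \<nu> (- S) = 0"
    and bdd: "\<And>r. emeasure \<mu> (ball 0 r) < \<infinity>" "\<And>r. emeasure \<nu> (ball 0 r) < \<infinity>"
    and m: "\<And>e. 0 < e \<Longrightarrow> 0 < m e \<and> m e < \<infinity>"
    and balls: "\<And>e x. 0 < e \<Longrightarrow> x \<in> S \<Longrightarrow> emeasure \<mu> (ball x e) = m e \<and> emeasure \<nu> (ball x e) = m e"
  shows "\<mu> = \<nu>"
proof (rule measure_eqI_generator_eq)
  have le: "emeasure \<mu> K \<le> emeasure \<nu> K" if "compact K" for K
    by (rule emeasure_compact_le_of_balls[of \<mu> \<nu> S m]) (use assms that in auto)
  have ge: "emeasure \<nu> K \<le> emeasure \<mu> K" if "compact K" for K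
    by (rule emeasure_compact_le_of_balls[of \<nu> \<mu> S m]) (use assms that in auto)
  show "emeasure \<mu> K = emeasure \<nu> K" if "K \<in> Collect compact" for K
    using le[of K] ge[of K] that by auto
  show "Int_stable (Collect compact :: 'a set set)"
    by (auto simp: Int_stable_def)
  show "sets \<mu> = sigma_sets UNIV (Collect compact)" "sets \<nu> = sigma_sets UNIV (Collect compact)"
    by (simp_all add: sets compact_generates_borel)
  show "(\<Union>n. cball 0 (real n)) = (UNIV :: 'a set)"
    by (auto simp: real_arch_simple)
  show "emeasure \<mu> (cball 0 (real n)) \<noteq> \<infinity>" for n
  proof -
    have "emeasure \<mu> (cball 0 (real n)) \<le> emeasure \<mu> (ball 0 (real n + 1))"
      by (intro emeasure_mono) (auto simp: sets)
    also have "\<dots> < \<infinity>" by (rule bdd)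
    finally show ?thesis by simp
  qed
qed auto

text \<open>Christensen's theorem for probability measures: integrating the common mass of
  \<open>\<epsilon>\<close>-balls of one measure against the other shows that the masses agree.\<close>

lemma uniformly_distributed_unique:
  fixes \<mu> \<nu> :: "'a::euclidean_space measure"
  assumes sets[measurable_cong]: "sets \<mu> = sets borel" "sets \<nu> = sets borel"
    and prob: "prob_space \<mu>" "prob_space \<nu>"
    and S[measurable]: "S \<in> sets borel"
    and null: "emeasure \<mu> (- S) = 0" "emeasure \<nu> (- S) = 0"
    and balls: "\<And>e x y. 0 < e \<Longrightarrow> x \<in> S \<Longrightarrow> y \<in> S \<Longrightarrow> emeasure \<mu> (ball x e) = emeasure \<mu> (ball y e)"
      "\<And>e x y. 0 < e \<Longrightarrow> x \<in> S \<Longrightarrow> y \<in> S \<Longrightarrow> emeasure \<nu> (ball x e) = emeasure \<nu> (ball y e)"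
  shows "\<mu> = \<nu>"
proof -
  interpret M: prob_space \<mu> by fact
  interpret N: prob_space \<nu> by fact
  interpret pair_sigma_finite \<mu> \<nu> by unfold_locales
  have sp: "space \<mu> = UNIV" "space \<nu> = UNIV"
    using sets_eq_imp_space_eq[OF sets(1)] sets_eq_imp_space_eq[OF sets(2)] by auto
  have aeM: "AE x in \<mu>. x \<in> S"
    by (rule AE_I[of _ _ "-S"]) (use null in \<open>auto simp: sets\<close>)
  have aeN: "AE x in \<nu>. x \<in> S"
    by (rule AE_I[of _ _ "-S"]) (use null in \<open>auto simp: sets\<close>)
  have "S \<noteq> {}"
    using null(1) M.emeasure_space_1 sp by auto
  then obtain s where s: "s \<in> S" by auto
  define m where "m e = emeasure \<nu> (ball s e)" for e
  have eq: "emeasure \<mu> (ball s e) = m e" if "0 < e" for e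
  proof -
    have "m e = (\<integral>\<^sup>+x. m e \<partial>\<mu>)"
      using M.emeasure_space_1 by simp
    also have "\<dots> = (\<integral>\<^sup>+x. (\<integral>\<^sup>+y. indicator {p \<in> space (borel \<Otimes>\<^sub>M borel). dist (fst p) (snd p) < e} (x, y) \<partial>\<nu>) \<partial>\<mu>)"
    proof (rule nn_integral_cong_AE, use aeM in eventually_elim)
      fix x assume x: "x \<in> S"
      have "m e = (\<integral>\<^sup>+y. indicator (ball x e) y \<partial>\<nu>)"
        using balls(2)[OF \<open>0 < e\<close> s x] by (simp add: m_def sets)
      then show "m e = (\<integral>\<^sup>+y. indicator {p \<in> space (borel \<Otimes>\<^sub>M borel). dist (fst p) (snd p) < e} (x, y) \<partial>\<nu>)"
        by (simp add: indicator_def space_pair_measure)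
    qed
    also have "\<dots> = (\<integral>\<^sup>+y. (\<integral>\<^sup>+x. indicator {p \<in> space (borel \<Otimes>\<^sub>M borel). dist (fst p) (snd p) < e} (x, y) \<partial>\<mu>) \<partial>\<nu>)"
      by (rule Fubini'[symmetric]) measurable
    also have "\<dots> = (\<integral>\<^sup>+y. emeasure \<mu> (ball s e) \<partial>\<nu>)"
    proof (rule nn_integral_cong_AE, use aeN in eventually_elim)
      fix x assume x: "x \<in> S"
      have "emeasure \<mu> (ball s e) = (\<integral>\<^sup>+y. indicator (ball x e) y \<partial>\<mu>)"
        using balls(1)[OF \<open>0 < e\<close> s x] by (simp add: sets)
      then show "(\<integral>\<^sup>+y. indicator {p \<in> space (borel \<Otimes>\<^sub>M borel). dist (fst p) (snd p) < e} (y, x) \<partial>\<mu>) = emeasure \<mu> (ball s e)"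
        by (simp add: indicator_def space_pair_measure dist_commute)
    qed
    also have "\<dots> = emeasure \<mu> (ball s e)"
      using N.emeasure_space_1 by simp
    finally show ?thesis ..
  qed
  \<comment> \<open>Countably many balls of radius \<open>e\<close> centred in \<open>S\<close> cover \<open>S\<close>.\<close>
  have pos: "0 < m e" if "0 < e" for e
  proof (rule ccontr)
    assume "\<not> 0 < m e"
    then have 0: "emeasure \<nu> (ball x e) = 0" if "x \<in> S" for x
      using balls(2)[OF \<open>0 < e\<close> s that] by (simp add: m_def)
    obtain F where F: "F \<subseteq> (\<lambda>x. ball x e) ` S" "countable F" "\<Union>F = (\<Union>x\<in>S. ball x e)"
      using Lindelof[of "(\<lambda>x. ball x e) ` S"] by auto
    then have "S \<subseteq> \<Union>F"
      using \<open>0 < e\<close> by auto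
    moreover have "(\<Union>X\<in>F. X) \<in> null_sets \<nu>"
      using F 0 by (intro null_sets_UN' null_setsI) (auto simp: sets)
    ultimately have "S \<in> null_sets \<nu>"
      by (auto intro: null_sets_subset simp: sets)
    moreover have "- S \<in> null_sets \<nu>"
      using null by (auto simp: null_sets_def sets)
    ultimately have "S \<union> - S \<in> null_sets \<nu>"
      by (rule null_sets.Un)
    then have "emeasure \<nu> (space \<nu>) = 0"
      by (auto simp: sp Compl_partition)
    then show False
      using N.emeasure_space_1 by simp
  qed
  show ?thesis
  proof (rule measure_eqI_balls[of \<mu> \<nu> S m])
    show "0 < m e \<and> m e < \<infinity>" if "0 < e" for e
      using pos[OF that] N.emeasure_finite[of "ball s e"] unfolding m_def by (simp add: less_top[symmetric])
    show "emeasure \<mu> (ball x e) = m e \<and> emeasure \<nu> (ball x e) = m e" if "0 < e" "x \<in> S" for e x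
      using balls(1)[OF that(1) s that(2)] balls(2)[OF that(1) s that(2)] eq[OF that(1)] by (simp add: m_def)
  qed (use sets S null M.emeasure_finite N.emeasure_finite M.sigma_finite_measure_axioms
        N.sigma_finite_measure_axioms in \<open>auto simp: less_top[symmetric]\<close>)
qed

section \<open>Gaussian measures as projections\<close>

abbreviation normal_law :: "real measure" where
  "normal_law \<equiv> density lborel (\<lambda>t. ennreal (std_normal_density t))"

definition gaussian_density :: "'a::euclidean_space \<Rightarrow> real" where
  "gaussian_density x = (1 / sqrt (2 * pi)) ^ DIM('a) * exp (- (norm x)\<^sup>2 / 2)"

definition std_gauss :: "'a::euclidean_space measure" where
  "std_gauss = density lborel (\<lambda>x. ennreal (gaussian_density x))"

lemma sets_std_gauss[simp, measurable_cong]: "sets std_gauss = sets borel"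
  by (simp add: std_gauss_def)

lemma space_std_gauss[simp]: "space std_gauss = UNIV"
  by (simp add: std_gauss_def)

lemma gaussian_density_measurable[measurable]: "gaussian_density \<in> borel_measurable borel"
  unfolding gaussian_density_def by measurable

lemma norm_sum_onb:
  assumes "finite B" "pairwise orthogonal B" "\<And>b. b \<in> B \<Longrightarrow> norm b = 1"
  shows "(norm (\<Sum>b\<in>B. c b *\<^sub>R b))\<^sup>2 = (\<Sum>b\<in>B. (c b)\<^sup>2)"
proof -
  have "(norm (\<Sum>b\<in>B. c b *\<^sub>R b))\<^sup>2 = (\<Sum>b\<in>B. (norm (c b *\<^sub>R b))\<^sup>2)"
    using assms by (intro norm_sum_Pythagorean) (auto simp: pairwise_def orthogonal_clauses)
  then show ?thesis
    using assms by (simp add: power_mult_distrib)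
qed

lemma gaussian_density_prod:
  fixes c :: "'a::euclidean_space \<Rightarrow> real"
  shows "(\<Prod>b\<in>Basis. std_normal_density (c b)) = gaussian_density (\<Sum>b\<in>Basis. c b *\<^sub>R b :: 'a)"
proof -
  have "(norm (\<Sum>b\<in>Basis. c b *\<^sub>R b :: 'a))\<^sup>2 = (\<Sum>b\<in>Basis. (c b)\<^sup>2)"
    by (rule norm_sum_onb) (auto simp: pairwise_def orthogonal_def inner_Basis)
  then show ?thesis
    by (simp add: gaussian_density_def std_normal_density_def prod.distrib exp_sum
        sum_divide_distrib sum_negf prod_dividef power_one_over flip: exp_sum)
qed

text \<open>Both sides agree on boxes, by Fubini for products of functions of one coordinate each.\<close>

lemma PiM_density:
  assumes I: "finite I" and M: "sigma_finite_measure M" and \<phi>[measurable]: "\<phi> \<in> borel_measurable M"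
    and D: "sigma_finite_measure (density M \<phi>)"
  shows "(\<Pi>\<^sub>M i\<in>I. density M \<phi>) = density (\<Pi>\<^sub>M i\<in>I. M) (\<lambda>x. \<Prod>i\<in>I. \<phi> (x i))"
proof -
  interpret product_sigma_finite "\<lambda>_. M" by (simp add: product_sigma_finite_def M)
  interpret D: product_sigma_finite "\<lambda>_. density M \<phi>" by (simp add: product_sigma_finite_def D)
  have "density (\<Pi>\<^sub>M i\<in>I. M) (\<lambda>x. \<Prod>i\<in>I. \<phi> (x i)) = (\<Pi>\<^sub>M i\<in>I. density M \<phi>)"
  proof (rule D.PiM_eqI[OF I])
    show "sets (density (\<Pi>\<^sub>M i\<in>I. M) (\<lambda>x. \<Prod>i\<in>I. \<phi> (x i))) = sets (\<Pi>\<^sub>M i\<in>I. density M \<phi>)"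
      by (simp cong: sets_PiM_cong)
    fix A assume A: "\<And>i. i \<in> I \<Longrightarrow> A i \<in> sets (density M \<phi>)"
    then have A'[measurable]: "i \<in> I \<Longrightarrow> A i \<in> sets M" for i by simp
    have [measurable]: "Pi\<^sub>E I A \<in> sets (\<Pi>\<^sub>M i\<in>I. M)"
      using A' I by (intro sets_PiM_I_finite) auto
    have "emeasure (density (\<Pi>\<^sub>M i\<in>I. M) (\<lambda>x. \<Prod>i\<in>I. \<phi> (x i))) (Pi\<^sub>E I A)
        = (\<integral>\<^sup>+x. (\<Prod>i\<in>I. \<phi> (x i)) * indicator (Pi\<^sub>E I A) x \<partial>(\<Pi>\<^sub>M i\<in>I. M))"
      by (rule emeasure_density) (measurable)
    also have "\<dots> = (\<integral>\<^sup>+x. (\<Prod>i\<in>I. \<phi> (x i) * indicator (A i) (x i)) \<partial>(\<Pi>\<^sub>M i\<in>I. M))"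
    proof (rule nn_integral_cong)
      fix x assume x: "x \<in> space (\<Pi>\<^sub>M i\<in>I. M)"
      have "indicator (Pi\<^sub>E I A) x = (\<Prod>i\<in>I. indicator (A i) (x i) :: ennreal)"
        using x I by (auto simp: indicator_def space_PiM PiE_iff prod_zero_iff)
      then show "(\<Prod>i\<in>I. \<phi> (x i)) * indicator (Pi\<^sub>E I A) x = (\<Prod>i\<in>I. \<phi> (x i) * indicator (A i) (x i))"
        by (simp add: prod.distrib)
    qed
    also have "\<dots> = (\<Prod>i\<in>I. (\<integral>\<^sup>+x. \<phi> x * indicator (A i) x \<partial>M))"
      by (rule product_nn_integral_prod[OF I]) measurable
    also have "\<dots> = (\<Prod>i\<in>I. emeasure (density M \<phi>) (A i))"
      using A' by (intro prod.cong) (auto simp: emeasure_density)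
    finally show "emeasure (density (\<Pi>\<^sub>M i\<in>I. M) (\<lambda>x. \<Prod>i\<in>I. \<phi> (x i))) (Pi\<^sub>E I A)
      = (\<Prod>i\<in>I. emeasure (density M \<phi>) (A i))" .
  qed
  then show ?thesis ..
qed

lemma prob_normal_law: "prob_space normal_law"
  by (rule prob_space_normal_density) simp

lemma std_gauss_coordinates:
  "distr (\<Pi>\<^sub>M b\<in>Basis. normal_law) borel (\<lambda>c. \<Sum>b\<in>Basis. c b *\<^sub>R b) = (std_gauss :: 'a::euclidean_space measure)"
proof -
  have "(\<Pi>\<^sub>M b\<in>(Basis::'a set). normal_law)
      = density (\<Pi>\<^sub>M b\<in>(Basis::'a set). lborel) (\<lambda>c. \<Prod>b\<in>Basis. ennreal (std_normal_density (c b)))"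
    using prob_normal_law
    by (intro PiM_density) (auto intro: prob_space_imp_sigma_finite sigma_finite_lborel)
  also have "(\<lambda>c. \<Prod>b\<in>Basis. ennreal (std_normal_density (c b)))
      = (\<lambda>c. ennreal (gaussian_density (\<Sum>b\<in>Basis. c b *\<^sub>R b :: 'a)))"
    by (simp add: prod_ennreal normal_density_nonneg gaussian_density_prod)
  finally show ?thesis
    unfolding std_gauss_def by (subst lborel_eq, subst density_distr) auto
qed

lemma prob_std_gauss: "prob_space (std_gauss :: 'a::euclidean_space measure)"
  unfolding std_gauss_coordinates[symmetric]
  by (intro prob_space.prob_space_distr prob_space_PiM prob_normal_law) measurable

lemma linear_borel_measurable:
  "linear (f :: 'a::euclidean_space \<Rightarrow> 'b::euclidean_space) \<Longrightarrow> f \<in> borel_measurable borel"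
  by (intro borel_measurable_continuous_onI linear_continuous_on linear_conv_bounded_linear[THEN iffD1])

text \<open>Lebesgue measure and its image under an isometry give the same mass to every ball of a given radius.\<close>

lemma lborel_orthogonal:
  fixes f :: "'a::euclidean_space \<Rightarrow> 'a"
  assumes f: "orthogonal_transformation f"
  shows "distr lborel borel f = lborel"
proof (rule measure_eqI_balls[of _ _ UNIV "\<lambda>e. emeasure lborel (ball (0::'a) e)"])
  have lin: "linear f" and surj: "surj f"
    using f orthogonal_transformation_linear orthogonal_transformation_surj by auto
  have [measurable]: "f \<in> borel_measurable borel"
    by (rule linear_borel_measurable[OF lin])
  have b: "emeasure (distr lborel borel f) (ball x e) = emeasure lborel (ball (0::'a) e)" for x e
  proof -
    obtain y where y: "f y = x"
      using surj by (metis surjD)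
    have "f -` ball x e = ball y e"
    proof -
      have "dist (f y) (f z) = dist y z" for z
        using orthogonal_transformation_norm[OF f, of "y - z"] lin by (simp add: dist_norm linear_diff)
      then show ?thesis by (auto simp: y[symmetric])
    qed
    then show ?thesis
      by (cases "e \<ge> 0") (simp_all add: emeasure_distr emeasure_ball ball_empty)
  qed
  show "emeasure (distr lborel borel f) (ball x e) = emeasure lborel (ball (0::'a) e)
      \<and> emeasure lborel (ball x e) = emeasure lborel (ball (0::'a) e)" if "0 < e" for e x
    using that by (simp add: b emeasure_ball)
  show "0 < emeasure lborel (ball (0::'a) e) \<and> emeasure lborel (ball (0::'a) e) < \<infinity>" if "0 < e" for e
    using that by (simp add: emeasure_ball)
  show "emeasure (distr lborel borel f) (ball 0 r) < \<infinity>" for r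
    by (cases "r \<ge> 0") (auto simp: b emeasure_ball ball_empty)
  show "emeasure lborel (ball (0::'a) r) < \<infinity>" for r
    by (cases "r \<ge> 0") (auto simp: emeasure_ball ball_empty)
  show "sigma_finite_measure (distr lborel borel f)"
  proof (rule sigma_finite_measure.intro, intro exI conjI)
    show "countable (range (\<lambda>n. ball (0::'a) (real n)))" by simp
    show "\<Union>(range (\<lambda>n. ball (0::'a) (real n))) = space (distr lborel borel f)"
      by (auto intro: reals_Archimedean2)
    show "\<forall>A\<in>range (\<lambda>n. ball 0 (real n)). emeasure (distr lborel borel f) A \<noteq> \<infinity>"
      by (auto simp: b emeasure_ball)
  qed auto
qed (auto intro: sigma_finite_lborel)

lemma std_gauss_orthogonal:
  fixes f :: "'a::euclidean_space \<Rightarrow> 'a"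
  assumes f: "orthogonal_transformation f"
  shows "distr std_gauss borel f = std_gauss"
proof -
  have lin: "linear f"
    using f orthogonal_transformation_linear by auto
  have [measurable]: "f \<in> borel_measurable borel"
    by (rule linear_borel_measurable[OF lin])
  have "gaussian_density (f x) = gaussian_density x" for x
    by (simp add: gaussian_density_def orthogonal_transformation_norm[OF f])
  then have "distr std_gauss borel f = density (distr lborel borel f) (\<lambda>x. ennreal (gaussian_density x))"
    unfolding std_gauss_def by (subst density_distr) auto
  then show ?thesis
    by (simp add: lborel_orthogonal[OF f] std_gauss_def)
qed

lemma onb_finite:
  assumes "orthonormal_basis_of B L"
  shows "finite B" "independent B" "card B = dim L" "span B = L"
proof -
  have "independent B"
    using assms pairwise_orthogonal_independent[of B] unfolding orthonormal_basis_of_def by force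
  then show "finite B" "independent B" "card B = dim L" "span B = L"
    using assms independent_imp_finite dim_eq_card unfolding orthonormal_basis_of_def
    by (metis dim_span dim_eq_card_independent)+
qed

lemma onb_exists:
  fixes L :: "'a::euclidean_space set"
  assumes "subspace L"
  obtains B where "orthonormal_basis_of B L"
  using orthonormal_basis_subspace[OF assms] unfolding orthonormal_basis_of_def by metis

lemma onb_inner:
  assumes "orthonormal_basis_of B L" "b \<in> B" "c \<in> B"
  shows "b \<bullet> c = (if b = c then 1 else 0)"
  using assms unfolding orthonormal_basis_of_def pairwise_def orthogonal_def by (auto simp: norm_eq_1)

text \<open>An isometry carries the standard basis to the given one, and it preserves the density and the Lebesgue measure.\<close>

lemma std_gauss_onb:
  fixes B :: "'a::euclidean_space set"
  assumes B: "orthonormal_basis_of B UNIV"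
  shows "distr (\<Pi>\<^sub>M b\<in>B. normal_law) borel (\<lambda>c. \<Sum>b\<in>B. c b *\<^sub>R b) = std_gauss"
proof -
  note fin = onb_finite[OF B]
  obtain s where s: "bij_betw s (Basis :: 'a set) B"
    using finite_same_card_bij[of "Basis :: 'a set" B] fin by auto
  define f where "f x = (\<Sum>b\<in>Basis. (x \<bullet> b) *\<^sub>R s b)" for x :: 'a
  have lin: "linear f"
    unfolding f_def by (intro linearI) (simp_all add: inner_simps scaleR_add_left sum.distrib scaleR_sum_right)
  have sB: "s b \<in> B" if "b \<in> Basis" for b
    using s that by (auto simp: bij_betw_def)
  have s_inner: "s b \<bullet> s c = (if b = c then 1 else 0)" if "b \<in> Basis" "c \<in> Basis" for b c
    using onb_inner[OF B sB sB] that s by (auto simp: bij_betw_def inj_on_eq_iff)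
  have "f x \<bullet> f y = x \<bullet> y" for x y
  proof -
    have "f x \<bullet> f y = (\<Sum>b\<in>Basis. \<Sum>c\<in>Basis. (x \<bullet> b) * ((y \<bullet> c) * (s b \<bullet> s c)))"
      by (subst sum.swap) (simp add: f_def inner_sum_left inner_sum_right sum_distrib_left mult.assoc mult.left_commute)
    also have "\<dots> = (\<Sum>b\<in>Basis. \<Sum>c\<in>Basis. if b = c then (x \<bullet> b) * (y \<bullet> c) else 0)"
      by (intro sum.cong) (auto simp: s_inner)
    also have "\<dots> = x \<bullet> y"
      by (simp add: euclidean_inner[of x y])
    finally show ?thesis .
  qed
  then have ot: "orthogonal_transformation f"
    using lin by (simp add: orthogonal_transformation_def)
  have [measurable]: "f \<in> borel_measurable borel"
    by (rule linear_borel_measurable[OF lin])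
  have fb: "f b = s b" if "b \<in> Basis" for b
    using that by (simp add: f_def inner_Basis if_distrib[of "\<lambda>x. x *\<^sub>R _"] cong: if_cong)
  have re: "(\<Pi>\<^sub>M b\<in>Basis. normal_law) = distr (\<Pi>\<^sub>M b\<in>B. normal_law) (\<Pi>\<^sub>M b\<in>Basis. normal_law) (\<lambda>c. \<lambda>b\<in>Basis. c (s b))"
    using distr_PiM_reindex[of B "\<lambda>_. normal_law" s Basis] prob_normal_law s by (auto simp: bij_betw_def)
  have "std_gauss = distr (distr (\<Pi>\<^sub>M b\<in>Basis. normal_law) borel (\<lambda>c. \<Sum>b\<in>Basis. c b *\<^sub>R b)) borel f"
    by (simp add: std_gauss_coordinates std_gauss_orthogonal[OF ot])
  also have "\<dots> = distr (\<Pi>\<^sub>M b\<in>Basis. normal_law) borel (\<lambda>c. \<Sum>b\<in>Basis. c b *\<^sub>R s b)"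
    by (subst distr_distr) (auto simp: comp_def linear_sum[OF lin] linear_cmul[OF lin] fb)
  also have "\<dots> = distr (\<Pi>\<^sub>M b\<in>B. normal_law) borel (\<lambda>c. \<Sum>b\<in>Basis. c (s b) *\<^sub>R s b)"
  proof -
    have [measurable]: "(\<lambda>c. \<lambda>b\<in>Basis. c (s b)) \<in> measurable (\<Pi>\<^sub>M b\<in>B. normal_law) (\<Pi>\<^sub>M b\<in>(Basis::'a set). normal_law)"
      using sB by (intro measurable_restrict measurable_component_singleton) auto
    show ?thesis
      by (subst re, subst distr_distr) (auto simp: comp_def)
  qed
  also have "\<dots> = distr (\<Pi>\<^sub>M b\<in>B. normal_law) borel (\<lambda>c. \<Sum>b\<in>B. c b *\<^sub>R b)"
    by (simp add: sum.reindex_bij_betw[OF s, of "\<lambda>b. _ b *\<^sub>R b"])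
  finally show ?thesis ..
qed

subsection \<open>Orthogonal projections\<close>

definition orth_proj :: "'a::euclidean_space set \<Rightarrow> 'a \<Rightarrow> 'a" where
  "orth_proj L x = (THE y. y \<in> L \<and> x - y \<in> L\<^sup>\<bottom>)"

lemma orth_proj_eqI:
  assumes L: "subspace L" and y: "y \<in> L" "x - y \<in> L\<^sup>\<bottom>"
  shows "orth_proj L x = y"
  unfolding orth_proj_def
proof (rule the_equality)
  fix z assume z: "z \<in> L \<and> x - z \<in> L\<^sup>\<bottom>"
  have "z - y \<in> L"
    using z y L by (simp add: subspace_diff)
  moreover have "(x - y) - (x - z) \<in> L\<^sup>\<bottom>"
    using z y by (metis subspace_diff subspace_orthogonal_comp)
  ultimately have "z - y \<in> L \<inter> L\<^sup>\<bottom>"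
    by simp
  then show "z = y"
    using orthogonal_Int_0[OF L] by simp
qed (use y in simp)

lemma onb_expansion:
  assumes B: "orthonormal_basis_of B L"
  shows "(\<Sum>b\<in>B. (x \<bullet> b) *\<^sub>R b) \<in> L" "x - (\<Sum>b\<in>B. (x \<bullet> b) *\<^sub>R b) \<in> L\<^sup>\<bottom>"
proof -
  note fin = onb_finite[OF B]
  show "(\<Sum>b\<in>B. (x \<bullet> b) *\<^sub>R b) \<in> L"
    unfolding fin(4)[symmetric] by (intro span_sum span_scale span_base)
  have *: "b \<bullet> (x - (\<Sum>b\<in>B. (x \<bullet> b) *\<^sub>R b)) = 0" if "b \<in> B" for b
  proof -
    have "b \<bullet> (\<Sum>b\<in>B. (x \<bullet> b) *\<^sub>R b) = (\<Sum>c\<in>B. (x \<bullet> c) * (b \<bullet> c))"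
      by (simp add: inner_sum_right)
    also have "\<dots> = (\<Sum>c\<in>B. if b = c then x \<bullet> c else 0)"
      using onb_inner[OF B \<open>b \<in> B\<close>] by (intro sum.cong) auto
    also have "\<dots> = b \<bullet> x"
      using that fin(1) by (simp add: inner_commute)
    finally show ?thesis by (simp add: inner_diff_right)
  qed
  have "y \<bullet> (x - (\<Sum>b\<in>B. (x \<bullet> b) *\<^sub>R b)) = 0" if "y \<in> span B" for y
    using that by (induction rule: span_induct_alt) (auto simp: inner_add_left *)
  then show "x - (\<Sum>b\<in>B. (x \<bullet> b) *\<^sub>R b) \<in> L\<^sup>\<bottom>"
    by (simp add: orthogonal_comp_def orthogonal_def fin(4))
qed

lemma orth_proj_onb:
  assumes B: "orthonormal_basis_of B L"
  shows "orth_proj L x = (\<Sum>b\<in>B. (x \<bullet> b) *\<^sub>R b)"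
  using onb_expansion[OF B, of x] onb_finite(4)[OF B] by (intro orth_proj_eqI) auto

lemma orth_proj_in:
  assumes "subspace L"
  shows "orth_proj L x \<in> L" "x - orth_proj L x \<in> L\<^sup>\<bottom>"
  using onb_exists[OF assms] onb_expansion[of _ L x] by (metis orth_proj_onb)+

lemma orth_proj_linear:
  assumes "subspace L"
  shows "linear (orth_proj L)"
proof -
  obtain B where B: "orthonormal_basis_of B L"
    using onb_exists[OF assms] .
  show ?thesis
    unfolding orth_proj_onb[OF B, abs_def]
    by (intro linearI) (simp_all add: inner_simps scaleR_add_left sum.distrib scaleR_sum_right)
qed

lemma orth_proj_measurable[measurable (raw)]:
  "subspace L \<Longrightarrow> orth_proj L \<in> borel_measurable borel"
  by (rule linear_borel_measurable[OF orth_proj_linear])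

lemma orth_proj_compl:
  assumes "subspace L"
  shows "orth_proj (L\<^sup>\<bottom>) x = x - orth_proj L x"
  using orth_proj_in[OF assms, of x] orthogonal_comp_self[OF assms]
  by (intro orth_proj_eqI subspace_orthogonal_comp) auto

text \<open>The standard Gaussian measure on a subspace is the image of the one on the whole space under
  the orthogonal projection.  This removes the choice of a basis, and lets a single Gaussian vector
  serve for all subspaces at once.\<close>

theorem gaussian_on_eq_proj:
  fixes L :: "'a::euclidean_space set"
  assumes L: "subspace L"
  shows "gaussian_on L = distr std_gauss borel (orth_proj L)"
proof -
  define B where "B = (SOME B. orthonormal_basis_of B L)"
  have B: "orthonormal_basis_of B L"
    unfolding B_def using onb_exists[OF L] by (metis someI_ex)
  obtain B' where B': "orthonormal_basis_of B' (L\<^sup>\<bottom>)"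
    using onb_exists[OF subspace_orthogonal_comp] .
  note fin = onb_finite[OF B] and fin' = onb_finite[OF B']
  have BL: "B \<subseteq> L" "B' \<subseteq> L\<^sup>\<bottom>"
    using fin(4) fin'(4) span_superset by auto
  have orth: "b \<bullet> c = 0" if "b \<in> B" "c \<in> B'" for b c
    using that BL by (auto simp: orthogonal_comp_def orthogonal_def)
  have disj: "B \<inter> B' = {}"
    using orth B unfolding orthonormal_basis_of_def by (force simp: norm_eq_1)
  have "x \<in> span (B \<union> B')" for x
  proof -
    have "x = orth_proj L x + (x - orth_proj L x)"
      by simp
    moreover have "orth_proj L x \<in> span (B \<union> B')" "x - orth_proj L x \<in> span (B \<union> B')"
      using orth_proj_in[OF L, of x] fin(4) fin'(4) by (auto intro: span_mono[THEN subsetD, rotated])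
    ultimately show ?thesis
      by (metis span_add)
  qed
  then have U: "orthonormal_basis_of (B \<union> B') UNIV"
    using B B' orth orth[THEN trans[OF inner_commute]] unfolding orthonormal_basis_of_def pairwise_def orthogonal_def
    by auto
  interpret product_prob_space "\<lambda>_. normal_law"
    by (rule product_prob_spaceI) (rule prob_normal_law)
  have "gaussian_on L = distr (\<Pi>\<^sub>M b\<in>B. normal_law) borel (\<lambda>c. \<Sum>b\<in>B. c b *\<^sub>R b)"
    by (simp add: gaussian_on_def B_def Let_def)
  also have "\<dots> = distr (\<Pi>\<^sub>M b\<in>B \<union> B'. normal_law) borel (\<lambda>c. \<Sum>b\<in>B. c b *\<^sub>R b)"
  proof -
    have [measurable]: "(\<lambda>f. restrict f B) \<in> measurable (\<Pi>\<^sub>M b\<in>B \<union> B'. normal_law) (\<Pi>\<^sub>M b\<in>B. normal_law)"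
      by (rule measurable_restrict_subset) auto
    show ?thesis
      using fin(1) fin'(1)
      by (subst distr_restrict[of B "B \<union> B'"], simp, simp, subst distr_distr) (auto simp: comp_def)
  qed
  also have "\<dots> = distr (distr (\<Pi>\<^sub>M b\<in>B \<union> B'. normal_law) borel (\<lambda>c. \<Sum>b\<in>B \<union> B'. c b *\<^sub>R b)) borel (orth_proj L)"
  proof -
    have "orth_proj L (\<Sum>b\<in>B \<union> B'. c b *\<^sub>R b) = (\<Sum>b\<in>B. c b *\<^sub>R b)" for c
    proof (rule orth_proj_eqI[OF L])
      show "(\<Sum>b\<in>B. c b *\<^sub>R b) \<in> L"
        using BL by (intro subspace_sum L subspace_scale) auto
      have "(\<Sum>b\<in>B \<union> B'. c b *\<^sub>R b) - (\<Sum>b\<in>B. c b *\<^sub>R b) = (\<Sum>b\<in>B'. c b *\<^sub>R b)"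
        using fin(1) fin'(1) disj by (simp add: sum.union_disjoint)
      also have "\<dots> \<in> L\<^sup>\<bottom>"
        using BL by (intro subspace_sum subspace_orthogonal_comp subspace_scale) auto
      finally show "(\<Sum>b\<in>B \<union> B'. c b *\<^sub>R b) - (\<Sum>b\<in>B. c b *\<^sub>R b) \<in> L\<^sup>\<bottom>" .
    qed
    then show ?thesis
      using L by (subst distr_distr) (auto simp: comp_def)
  qed
  also have "\<dots> = distr std_gauss borel (orth_proj L)"
    by (simp add: std_gauss_onb[OF U])
  finally show ?thesis .
qed

lemma measure_gaussian_on:
  assumes "subspace L" "A \<in> sets borel"
  shows "measure (gaussian_on L) A = measure std_gauss {g. orth_proj L g \<in> A}"
  using assms by (simp add: gaussian_on_eq_proj measure_distr vimage_def)

lemma std_gauss_negligible: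
  assumes "negligible S" "S \<in> sets borel"
  shows "S \<in> null_sets (std_gauss :: 'a::euclidean_space measure)"
proof -
  have "S \<in> null_sets lborel"
    using assms by (simp add: negligible_iff_null_sets null_sets_completion_iff)
  then have "AE x in lborel. x \<notin> S"
    by (rule AE_not_in)
  then have "AE x in std_gauss. x \<notin> S"
    unfolding std_gauss_def by (subst AE_density) auto
  then show ?thesis
    using assms by (subst AE_iff_null_sets) auto
qed

lemma std_gauss_subspace_null:
  fixes S :: "'a::euclidean_space set"
  assumes "subspace S" "S \<noteq> UNIV"
  shows "S \<in> null_sets std_gauss"
proof (rule std_gauss_negligible)
  have "dim S < DIM('a)"
    using assms by (metis dim_eq_full dim_subset_UNIV le_neq_implies_less span_eq_iff)
  then show "negligible S"
    by (rule negligible_lowdim)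
  show "S \<in> sets borel"
    using closed_subspace[OF assms(1)] by (rule borel_closed)
qed

text \<open>The preimage of a proper subspace is a proper subspace, of Lebesgue measure \<open>0\<close>.\<close>

lemma AE_std_gauss_linear_notin:
  fixes f :: "'a::euclidean_space \<Rightarrow> 'b::euclidean_space"
  assumes "linear f" "subspace S" "\<exists>x. f x \<notin> S"
  shows "AE g in std_gauss. f g \<notin> S"
proof -
  have "subspace (f -` S)"
    using assms by (simp add: linear_subspace_vimage)
  moreover have "f -` S \<noteq> UNIV"
    using assms by auto
  ultimately have "f -` S \<in> null_sets std_gauss"
    by (rule std_gauss_subspace_null)
  from AE_not_in[OF this] show ?thesis
    by simp
qed

subsection \<open>Products\<close>

lemma vec_lambda_measurable:
  "(\<lambda>c. \<chi> i. c i) \<in> measurable (\<Pi>\<^sub>M i\<in>(UNIV::'i::finite set). (borel :: 'a::euclidean_space measure)) borel"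
proof (subst borel_measurable_euclidean_space, intro ballI)
  fix b :: "'a^'i" assume "b \<in> Basis"
  then obtain i u where b: "b = axis i u" "u \<in> Basis"
    by (auto simp: Basis_vec_def)
  show "(\<lambda>c. (\<chi> i. c i) \<bullet> b) \<in> borel_measurable (\<Pi>\<^sub>M i\<in>(UNIV::'i::finite set). borel)"
    unfolding b by (simp add: inner_axis)
qed

lemma lborel_vec:
  "distr (\<Pi>\<^sub>M i\<in>(UNIV::'i::finite set). lborel) borel (\<lambda>c. \<chi> i. c i) = (lborel :: ('a::euclidean_space^'i) measure)"
proof (rule lborel_eqI[symmetric])
  interpret product_sigma_finite "\<lambda>_::'i. lborel :: 'a measure"
    by (simp add: product_sigma_finite_def sigma_finite_lborel)
  interpret finite_product_sigma_finite "\<lambda>_::'i. lborel :: 'a measure" UNIV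
    by standard simp
  have [measurable]: "(\<lambda>c. \<chi> i. c i) \<in> measurable (\<Pi>\<^sub>M i\<in>(UNIV::'i::finite set). (lborel :: 'a measure)) borel"
    using vec_lambda_measurable by (simp cong: measurable_cong_sets sets_PiM_cong)
  fix l u :: "'a^'i"
  assume lu: "\<And>b. b \<in> Basis \<Longrightarrow> l \<bullet> b \<le> u \<bullet> b"
  have lu': "l $ i \<bullet> b \<le> u $ i \<bullet> b" if "b \<in> Basis" for i b
    using lu[of "axis i b"] that by (auto simp: inner_axis Basis_vec_def)
  have "(\<lambda>c. \<chi> i. c i) -` box l u \<inter> space (\<Pi>\<^sub>M i\<in>(UNIV::'i set). (lborel :: 'a measure))
      = Pi\<^sub>E UNIV (\<lambda>i. box (l $ i) (u $ i))"
    by (auto simp: space_PiM mem_box Basis_vec_def inner_axis PiE_iff)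
  then have "emeasure (distr (\<Pi>\<^sub>M i\<in>(UNIV::'i set). (lborel :: 'a measure)) borel (\<lambda>c. \<chi> i. c i)) (box l u)
      = emeasure (\<Pi>\<^sub>M i\<in>(UNIV::'i set). (lborel :: 'a measure)) (Pi\<^sub>E UNIV (\<lambda>i. box (l $ i) (u $ i)))"
    by (simp add: emeasure_distr)
  also have "\<dots> = (\<Prod>i\<in>UNIV. emeasure lborel (box (l $ i) (u $ i)))"
    by (rule measure_times) auto
  also have "\<dots> = (\<Prod>i\<in>UNIV. ennreal (\<Prod>b\<in>Basis. (u $ i - l $ i) \<bullet> b))"
    using lu' by (intro prod.cong refl emeasure_lborel_box) auto
  also have "\<dots> = ennreal (\<Prod>i\<in>UNIV. \<Prod>b\<in>Basis. (u $ i - l $ i) \<bullet> b)"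
    using lu' by (intro prod_ennreal prod_nonneg) (auto simp: inner_diff_left)
  also have "(\<Prod>i\<in>UNIV. \<Prod>b\<in>Basis. (u $ i - l $ i) \<bullet> b) = (\<Prod>b\<in>Basis. (u - l) \<bullet> b)"
  proof -
    have "(\<Prod>b\<in>Basis. (u - l) \<bullet> b) = (\<Prod>p\<in>UNIV \<times> Basis. (u - l) \<bullet> axis (fst p) (snd p))"
    proof (rule prod.reindex_cong[of "\<lambda>p. axis (fst p) (snd p)"])
      show "inj_on (\<lambda>p. axis (fst p) (snd p)) (UNIV \<times> (Basis :: 'a set))"
        by (auto simp: inj_on_def axis_eq_axis)
      show "Basis = (\<lambda>p. axis (fst p) (snd p)) ` (UNIV \<times> (Basis :: 'a set))"
        by (force simp: Basis_vec_def)
    qed simp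
    also have "\<dots> = (\<Prod>i\<in>UNIV. \<Prod>b\<in>Basis. (u - l) \<bullet> axis i b)"
      by (subst prod.cartesian_product) (simp add: split_def)
    finally show ?thesis
      by (simp add: inner_axis)
  qed
  finally show "emeasure (distr (\<Pi>\<^sub>M i\<in>(UNIV::'i set). (lborel :: 'a measure)) borel (\<lambda>c. \<chi> i. c i)) (box l u)
     = ennreal (\<Prod>b\<in>Basis. (u - l) \<bullet> b)" .
qed simp

lemma std_gauss_vec:
  "distr (\<Pi>\<^sub>M i\<in>(UNIV::'i::finite set). std_gauss) borel (\<lambda>c. \<chi> i. c i) = (std_gauss :: ('a::euclidean_space^'i) measure)"
proof -
  have [measurable]: "(\<lambda>c. \<chi> i. c i) \<in> measurable (\<Pi>\<^sub>M i\<in>(UNIV::'i::finite set). (lborel :: 'a measure)) borel"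
    using vec_lambda_measurable by (simp cong: measurable_cong_sets sets_PiM_cong)
  have "(\<Prod>i\<in>UNIV. gaussian_density (c i)) = gaussian_density (\<chi> i. c i)" for c :: "'i \<Rightarrow> 'a"
  proof -
    have "(norm (\<chi> i. c i))\<^sup>2 = (\<Sum>i\<in>UNIV. (norm (c i))\<^sup>2)"
      by (simp add: power2_norm_eq_inner inner_vec_def)
    then show ?thesis
      by (simp add: gaussian_density_def prod.distrib power_mult sum_divide_distrib sum_negf
          power_one_over prod_dividef mult.commute flip: exp_sum)
  qed
  then have *: "(\<Prod>i\<in>UNIV. ennreal (gaussian_density (c i))) = ennreal (gaussian_density (\<chi> i. c i))" for c :: "'i \<Rightarrow> 'a"
    by (subst prod_ennreal) (auto simp: gaussian_density_def)
  have "(\<Pi>\<^sub>M i\<in>(UNIV::'i set). (std_gauss :: 'a measure))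
      = density (\<Pi>\<^sub>M i\<in>(UNIV::'i set). lborel) (\<lambda>c. \<Prod>i\<in>UNIV. ennreal (gaussian_density (c i)))"
    using prob_std_gauss[where 'a='a] unfolding std_gauss_def
    by (intro PiM_density) (auto intro: prob_space_imp_sigma_finite sigma_finite_lborel)
  then show ?thesis
    unfolding * by (subst (2) std_gauss_def, subst lborel_vec[symmetric], subst density_distr) auto
qed

text \<open>The projection onto a product of subspaces acts componentwise, and the components of a
  standard Gaussian vector are independent.\<close>

lemma gaussian_on_product:
  fixes L E :: "'i::finite \<Rightarrow> 'a::euclidean_space set"
  assumes L: "\<And>i. subspace (L i)" and E: "\<And>i. E i \<in> sets borel"
  shows "measure (gaussian_on {x::'a^'i. \<forall>i. x $ i \<in> L i}) {x. \<forall>i. x $ i \<in> E i}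
    = (\<Prod>i\<in>UNIV. measure (gaussian_on (L i)) (E i))"
proof -
  define P where "P = {x::'a^'i. \<forall>i. x $ i \<in> L i}"
  have P: "subspace P"
    using L unfolding P_def subspace_def by simp
  have [measurable]: "(\<lambda>x::'a^'i. x $ i) \<in> borel_measurable borel" for i
    by (intro borel_measurable_continuous_onI continuous_intros)
  note E[measurable]
  have "{x::'a^'i. \<forall>i. x $ i \<in> E i} = (\<Inter>i. (\<lambda>x. x $ i) -` E i \<inter> space borel)"
    by auto
  then have Eb[measurable]: "{x::'a^'i. \<forall>i. x $ i \<in> E i} \<in> sets borel"
    using E measurable_sets[of "\<lambda>x::'a^'i. x $ i" borel borel for i] by (auto intro!: sets.finite_INT simp del: vimage_Int)
  have proj: "orth_proj P x = (\<chi> i. orth_proj (L i) (x $ i))" for x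
  proof (rule orth_proj_eqI[OF P])
    show "(\<chi> i. orth_proj (L i) (x $ i)) \<in> P"
      using orth_proj_in(1)[OF L] by (simp add: P_def)
    show "x - (\<chi> i. orth_proj (L i) (x $ i)) \<in> P\<^sup>\<bottom>"
      using orth_proj_in(2)[OF L]
      by (auto simp: orthogonal_comp_def orthogonal_def P_def inner_vec_def intro!: sum.neutral)
  qed
  have gp: "{x. orth_proj (L i) x \<in> E i} \<in> sets borel" for i
    using measurable_sets_borel[OF orth_proj_measurable[OF L[of i]] E[of i]] by (simp add: vimage_def)
  interpret G: product_prob_space "\<lambda>_::'i. std_gauss :: 'a measure"
    by (rule product_prob_spaceI) (rule prob_std_gauss)
  interpret GF: finite_product_prob_space "\<lambda>_::'i. std_gauss :: 'a measure" UNIV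
    by standard simp
  have vm: "(\<lambda>c. \<chi> i. c i) \<in> measurable (\<Pi>\<^sub>M i\<in>(UNIV::'i::finite set). (std_gauss :: 'a measure)) borel"
    using vec_lambda_measurable by (simp cong: measurable_cong_sets sets_PiM_cong)
  have mP: "{x. orth_proj P x \<in> {x. \<forall>i. x $ i \<in> E i}} \<in> sets borel"
    using measurable_sets_borel[OF orth_proj_measurable[OF P] Eb] by (simp add: vimage_def)
  have "measure (gaussian_on P) {x. \<forall>i. x $ i \<in> E i}
      = measure std_gauss {x. orth_proj P x \<in> {x. \<forall>i. x $ i \<in> E i}}"
    by (rule measure_gaussian_on[OF P Eb])
  also have "\<dots> = measure (\<Pi>\<^sub>M i\<in>(UNIV::'i set). std_gauss)
      ((\<lambda>c. \<chi> i. c i) -` {x. orth_proj P x \<in> {x. \<forall>i. x $ i \<in> E i}} \<inter> space (\<Pi>\<^sub>M i\<in>(UNIV::'i set). (std_gauss :: 'a measure)))"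
    unfolding std_gauss_vec[symmetric] by (rule measure_distr[OF vm mP])
  also have "\<dots> = measure (\<Pi>\<^sub>M i\<in>(UNIV::'i set). std_gauss) (Pi\<^sub>E UNIV (\<lambda>i. {x. orth_proj (L i) x \<in> E i}))"
    by (rule arg_cong[where f="measure _"]) (auto simp: proj space_PiM PiE_iff)
  also have "\<dots> = (\<Prod>i\<in>UNIV. measure std_gauss {x. orth_proj (L i) x \<in> E i})"
    using gp by (intro GF.prob_times) simp
  also have "\<dots> = (\<Prod>i\<in>UNIV. measure (gaussian_on (L i)) (E i))"
    by (simp add: measure_gaussian_on L E)
  finally show ?thesis
    by (simp add: P_def)
qed

section \<open>Faces of a cone given by finitely many inequalities\<close>

definition ineq_cone :: "'s set \<Rightarrow> ('s \<Rightarrow> 'a::euclidean_space) \<Rightarrow> 'a set" where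
  "ineq_cone S a = {x. \<forall>s\<in>S. a s \<bullet> x \<le> 0}"

definition flat :: "'s set \<Rightarrow> ('s \<Rightarrow> 'a::euclidean_space) \<Rightarrow> 'a set" where
  "flat I a = {x. \<forall>s\<in>I. a s \<bullet> x = 0}"

definition open_face :: "'s set \<Rightarrow> ('s \<Rightarrow> 'a::euclidean_space) \<Rightarrow> 's set \<Rightarrow> 'a set" where
  "open_face S a I = {x. (\<forall>s\<in>I. a s \<bullet> x = 0) \<and> (\<forall>s\<in>S - I. a s \<bullet> x < 0)}"

lemma subspace_flat: "subspace (flat I a)"
  by (auto simp: flat_def subspace_def inner_add_right)

lemma flat_orthogonal: "flat I a = (span (a ` I))\<^sup>\<bottom>"
proof
  show "(span (a ` I))\<^sup>\<bottom> \<subseteq> flat I a"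
    by (auto simp: flat_def orthogonal_comp_def orthogonal_def intro: span_base)
  show "flat I a \<subseteq> (span (a ` I))\<^sup>\<bottom>"
  proof
    fix x assume x: "x \<in> flat I a"
    have "y \<bullet> x = 0" if "y \<in> span (a ` I)" for y
      using that x by (induction rule: span_induct_alt) (auto simp: flat_def inner_add_left)
    then show "x \<in> (span (a ` I))\<^sup>\<bottom>"
      by (simp add: orthogonal_comp_def orthogonal_def)
  qed
qed

lemma flat_orthogonal_comp: "(flat I a)\<^sup>\<bottom> = span (a ` I)"
  by (simp add: flat_orthogonal orthogonal_comp_self)

lemma dim_flat: "dim (flat I a) + dim (span (a ` I)) = DIM('a)"
  for a :: "'s \<Rightarrow> 'a::euclidean_space"
  using dim_subspace_orthogonal_to_vectors[of "span (a ` I)" UNIV]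
  by (simp add: flat_orthogonal orthogonal_comp_def del: dim_span)

lemma open_face_subset: "I \<subseteq> S \<Longrightarrow> open_face S a I \<subseteq> ineq_cone S a \<inter> flat I a"
  unfolding open_face_def ineq_cone_def flat_def by (auto, metis DiffI less_eq_real_def)

lemma closed_ineq_cone: "closed (ineq_cone S a)"
proof -
  have "ineq_cone S a = (\<Inter>s\<in>S. {x. a s \<bullet> x \<le> 0})"
    by (auto simp: ineq_cone_def)
  then show ?thesis
    by (auto intro!: closed_INT closed_halfspace_le)
qed

lemma open_face_borel: "finite S \<Longrightarrow> open_face S a I \<in> sets borel"
proof -
  assume S: "finite S"
  have "open_face S a I = (\<Inter>s\<in>I. {x. a s \<bullet> x = 0}) \<inter> (\<Inter>s\<in>S - I. {x. a s \<bullet> x < 0})"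
    by (auto simp: open_face_def)
  moreover have "closed (\<Inter>s\<in>I. {x. a s \<bullet> x = 0})"
    by (intro closed_INT ballI closed_hyperplane)
  moreover have "open (\<Inter>s\<in>S - I. {x. a s \<bullet> x < 0})"
    using S by (intro open_INT ballI open_halfspace_lt) auto
  ultimately show ?thesis
    by (metis borel_closed borel_open sets.Int)
qed

text \<open>From a point of the open face one can move a little in every direction of its flat
  without leaving the cone.\<close>

lemma open_face_perturb:
  assumes "finite S" "I \<subseteq> S" "x \<in> open_face S a I" "y \<in> flat I a"
  obtains t where "0 < t" "x + t *\<^sub>R y \<in> ineq_cone S a \<inter> flat I a"
proof -
  have "\<forall>\<^sub>F t in at_right 0. \<forall>s\<in>S - I. a s \<bullet> (x + t *\<^sub>R y) < 0"
  proof (rule eventually_ball_finite)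
    show "\<forall>s\<in>S - I. \<forall>\<^sub>F t in at_right 0. a s \<bullet> (x + t *\<^sub>R y) < 0"
    proof
      fix s assume s: "s \<in> S - I"
      have "((\<lambda>t::real. a s \<bullet> (x + t *\<^sub>R y)) \<longlongrightarrow> a s \<bullet> (x + 0 *\<^sub>R y)) (at_right 0)"
        by (intro tendsto_intros)
      moreover have "a s \<bullet> (x + 0 *\<^sub>R y) < 0"
        using assms s by (auto simp: open_face_def)
      ultimately show "\<forall>\<^sub>F t in at_right 0. a s \<bullet> (x + t *\<^sub>R y) < 0"
        by (rule order_tendstoD(2))
    qed
  qed (use assms in auto)
  moreover have "\<forall>\<^sub>F t::real in at_right 0. 0 < t"
    by (simp add: eventually_at_right_less)
  ultimately have "\<forall>\<^sub>F t in at_right (0::real). 0 < t \<and> (\<forall>s\<in>S - I. a s \<bullet> (x + t *\<^sub>R y) < 0)"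
    by (rule eventually_conj[rotated])
  then obtain t where t: "0 < t" "\<forall>s\<in>S - I. a s \<bullet> (x + t *\<^sub>R y) < 0"
    using eventually_happens[of _ "at_right (0::real)"] by (auto simp: trivial_limit_at_right_real)
  have eq: "\<forall>s\<in>I. a s \<bullet> (x + t *\<^sub>R y) = 0"
    using assms by (auto simp: open_face_def flat_def inner_add_right)
  have "x + t *\<^sub>R y \<in> ineq_cone S a \<inter> flat I a"
    using t eq unfolding ineq_cone_def flat_def by (auto simp: less_imp_le) (metis DiffI eq_iff less_imp_le)
  then show ?thesis
    using t that by blast
qed

lemma span_face:
  assumes "finite S" "I \<subseteq> S" "x \<in> open_face S a I"
  shows "span (ineq_cone S a \<inter> flat I a) = flat I a"
proof
  show "span (ineq_cone S a \<inter> flat I a) \<subseteq> flat I a"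
    by (metis inf_le2 span_minimal subspace_flat)
  show "flat I a \<subseteq> span (ineq_cone S a \<inter> flat I a)"
  proof
    fix y assume y: "y \<in> flat I a"
    obtain t where t: "0 < t" "x + t *\<^sub>R y \<in> ineq_cone S a \<inter> flat I a"
      using open_face_perturb[OF assms y] .
    have "x \<in> ineq_cone S a \<inter> flat I a"
      using open_face_subset assms by blast
    then have "(1 / t) *\<^sub>R ((x + t *\<^sub>R y) - x) \<in> span (ineq_cone S a \<inter> flat I a)"
      using t by (intro span_scale span_diff span_base)
    then show "y \<in> span (ineq_cone S a \<inter> flat I a)"
      using t by simp
  qed
qed

text \<open>The set \<open>I\<close> consists of the inequalities that are tight on all of \<open>F\<close>.  For every other inequality some point
  of \<open>F\<close> makes it strict, and the sum of these points lies in the open face.  Moving from there away from a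
  point \<open>y\<close> of the flat shows that \<open>y\<close> is also orthogonal to the normal vector \<open>z\<close> of \<open>F\<close>.\<close>

lemma cone_face_ineq_cone:
  assumes S: "finite S" and F: "cone_face F (ineq_cone S a)"
  obtains I where "I \<subseteq> S" "open_face S a I \<noteq> {}" "F = ineq_cone S a \<inter> flat I a"
proof -
  obtain z where z: "\<And>x. x \<in> ineq_cone S a \<Longrightarrow> x \<bullet> z \<le> 0" and Fz: "F = {x \<in> ineq_cone S a. x \<bullet> z = 0}"
    using F unfolding cone_face_def by auto
  define I where "I = {s \<in> S. \<forall>x\<in>F. a s \<bullet> x = 0}"
  have "\<forall>s\<in>S - I. \<exists>x\<in>F. a s \<bullet> x < 0"
    unfolding I_def using Fz by (auto simp: ineq_cone_def) (metis less_eq_real_def)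
  then obtain w where w: "\<And>s. s \<in> S - I \<Longrightarrow> w s \<in> F \<and> a s \<bullet> w s < 0"
    by metis
  \<comment> \<open>If \<open>I = S\<close>, this is \<open>0\<close>, which then lies in the open face.\<close>
  define x where "x = (\<Sum>s\<in>S - I. w s)"
  have fin: "finite (S - I)"
    using S by simp
  have "x \<in> open_face S a I"
    unfolding open_face_def
  proof (intro CollectI conjI ballI)
    fix s assume s: "s \<in> I"
    show "a s \<bullet> x = 0"
      unfolding x_def inner_sum_right using s w by (intro sum.neutral) (auto simp: I_def)
  next
    fix s assume s: "s \<in> S - I"
    have "a s \<bullet> x = a s \<bullet> w s + (\<Sum>r\<in>S - I - {s}. a s \<bullet> w r)"
      unfolding x_def inner_sum_right using s fin by (simp add: sum.remove)
    also have "(\<Sum>r\<in>S - I - {s}. a s \<bullet> w r) \<le> 0"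
      using w s Fz by (intro sum_nonpos) (auto simp: ineq_cone_def)
    finally show "a s \<bullet> x < 0"
      using w[OF s] by linarith
  qed
  have xF: "x \<bullet> z = 0"
    unfolding x_def inner_sum_left using w Fz by (intro sum.neutral) auto
  have IS: "I \<subseteq> S"
    by (auto simp: I_def)
  have "F = ineq_cone S a \<inter> flat I a"
  proof
    show "F \<subseteq> ineq_cone S a \<inter> flat I a"
      using Fz by (auto simp: I_def flat_def)
    show "ineq_cone S a \<inter> flat I a \<subseteq> F"
    proof
      fix y assume y: "y \<in> ineq_cone S a \<inter> flat I a"
      then have "- y \<in> flat I a"
        using subspace_flat subspace_neg by blast
      then obtain t where t: "0 < t" "x + t *\<^sub>R - y \<in> ineq_cone S a \<inter> flat I a"
        using open_face_perturb[OF S IS \<open>x \<in> open_face S a I\<close>] by metis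
      then have "(x + t *\<^sub>R - y) \<bullet> z \<le> 0"
        using z by blast
      then have "0 \<le> t * (y \<bullet> z)"
        by (simp add: inner_diff_left xF)
      then have "0 \<le> y \<bullet> z"
        using t by (simp add: zero_le_mult_iff)
      then show "y \<in> F"
        using y z[of y] Fz by auto
    qed
  qed
  then show ?thesis
    using that IS \<open>x \<in> open_face S a I\<close> by blast
qed

text \<open>The sum of the normal vectors in \<open>I\<close> exposes the face.\<close>

lemma cone_face_flat:
  assumes S: "finite S" "I \<subseteq> S"
  shows "cone_face (ineq_cone S a \<inter> flat I a) (ineq_cone S a)"
  unfolding cone_face_def
proof (intro exI conjI)
  have fin: "finite I"
    using S finite_subset by blast
  show "\<forall>x\<in>ineq_cone S a. x \<bullet> (\<Sum>s\<in>I. a s) \<le> 0"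
    using S by (auto simp: ineq_cone_def inner_sum_right inner_commute intro!: sum_nonpos)
  show "ineq_cone S a \<inter> flat I a = {x \<in> ineq_cone S a. x \<bullet> (\<Sum>s\<in>I. a s) = 0}"
  proof (intro equalityI subsetI)
    fix x assume x: "x \<in> {x \<in> ineq_cone S a. x \<bullet> (\<Sum>s\<in>I. a s) = 0}"
    then have "(\<Sum>s\<in>I. - (a s \<bullet> x)) = 0"
      by (simp add: inner_sum_right inner_commute sum_negf)
    moreover have "0 \<le> - (a s \<bullet> x)" if "s \<in> I" for s
      using x that S by (auto simp: ineq_cone_def)
    ultimately have "\<forall>s\<in>I. - (a s \<bullet> x) = 0"
      using fin sum_nonneg_eq_0_iff[of I "\<lambda>s. - (a s \<bullet> x)"] by blast
    then show "x \<in> ineq_cone S a \<inter> flat I a"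
      using x by (auto simp: flat_def)
  qed (auto simp: flat_def inner_sum_right inner_commute)
qed

lemma face_spans_ineq_cone:
  assumes S: "finite S"
  shows "face_spans k (ineq_cone S a)
    = (\<lambda>I. flat I a) ` {I \<in> Pow S. open_face S a I \<noteq> {} \<and> dim (flat I a) = k}"
proof (intro equalityI subsetI)
  fix L assume "L \<in> face_spans k (ineq_cone S a)"
  then obtain F where F: "cone_face F (ineq_cone S a)" "L = span F" "dim (span F) = k"
    unfolding face_spans_def by auto
  obtain I where I: "I \<subseteq> S" "open_face S a I \<noteq> {}" "F = ineq_cone S a \<inter> flat I a"
    using cone_face_ineq_cone[OF S F(1)] .
  then have "span F = flat I a"
    using span_face[OF S] by blast
  then show "L \<in> (\<lambda>I. flat I a) ` {I \<in> Pow S. open_face S a I \<noteq> {} \<and> dim (flat I a) = k}"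
    using I F by (intro image_eqI[of _ _ I]) auto
next
  fix L assume "L \<in> (\<lambda>I. flat I a) ` {I \<in> Pow S. open_face S a I \<noteq> {} \<and> dim (flat I a) = k}"
  then obtain I where I: "I \<subseteq> S" "open_face S a I \<noteq> {}" "dim (flat I a) = k" "L = flat I a"
    by auto
  then have "span (ineq_cone S a \<inter> flat I a) = flat I a"
    using span_face[OF S] by blast
  then show "L \<in> face_spans k (ineq_cone S a)"
    unfolding face_spans_def using cone_face_flat[OF S I(1)] I by (metis (mono_tags, lifting) mem_Collect_eq)
qed

text \<open>A point of the open face recovers \<open>I\<close> as its set of tight inequalities, so different index sets never yield
  the same span.\<close>

lemma inj_on_flat:
  "inj_on (\<lambda>I. flat I a) {I \<in> Pow S. open_face S a I \<noteq> {} \<and> P I}"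
proof (rule inj_onI)
  have sub: "J \<subseteq> I" if "J \<subseteq> S" "open_face S a I \<noteq> {}" "flat I a = flat J a" for I J
  proof -
    from that(2) obtain x where x: "x \<in> open_face S a I"
      by auto
    then have "x \<in> flat J a"
      using that(3) by (auto simp: open_face_def flat_def)
    then show ?thesis
      using x that(1) unfolding open_face_def flat_def by (force simp: less_le)
  qed
  fix I J assume "I \<in> {I \<in> Pow S. open_face S a I \<noteq> {} \<and> P I}" "J \<in> {I \<in> Pow S. open_face S a I \<noteq> {} \<and> P I}"
    "flat I a = flat J a"
  then show "I = J"
    using sub[of I J] sub[of J I] by auto
qed

subsection \<open>Normal cones\<close>

text \<open>Farkas: a functional that separates a point from the closed cone generated by the normal vectors is,
  up to sign, a point of the cone that violates polarity.\<close>

lemma polar_ineq_cone: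
  assumes S: "finite S"
  shows "polar_cone (ineq_cone S a) = convex_cone hull (a ` S)"
proof
  have "convex_cone (polar_cone (ineq_cone S a))"
    by (auto simp: polar_cone_def convex_cone_iff inner_add_right add_nonpos_nonpos mult_nonneg_nonpos)
  then show "convex_cone hull (a ` S) \<subseteq> polar_cone (ineq_cone S a)"
    by (intro hull_minimal) (auto simp: polar_cone_def ineq_cone_def inner_commute)
  show "polar_cone (ineq_cone S a) \<subseteq> convex_cone hull (a ` S)"
  proof
    fix z assume z: "z \<in> polar_cone (ineq_cone S a)"
    show "z \<in> convex_cone hull (a ` S)"
    proof (rule ccontr)
      assume "z \<notin> convex_cone hull (a ` S)"
      then obtain c b where cb: "c \<bullet> z < b" "\<And>x. x \<in> convex_cone hull (a ` S) \<Longrightarrow> b < c \<bullet> x"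
        using separating_hyperplane_closed_point[OF convex_convex_cone_hull closed_convex_cone_hull, of "a ` S" z] S
        by auto
      have b0: "b < 0"
        using cb(2)[OF convex_cone_hull_contains_0] by simp
      have "0 \<le> c \<bullet> x" if x: "x \<in> convex_cone hull (a ` S)" for x
      proof (rule ccontr)
        assume "\<not> 0 \<le> c \<bullet> x"
        then have "0 \<le> b / (c \<bullet> x)" "c \<bullet> x \<noteq> 0"
          using b0 by (auto simp: divide_nonpos_neg)
        then have "b < c \<bullet> ((b / (c \<bullet> x)) *\<^sub>R x)"
          by (intro cb(2) convex_cone_hull_mul x)
        then show False
          using \<open>c \<bullet> x \<noteq> 0\<close> by simp
      qed
      then have "- c \<in> ineq_cone S a"
        unfolding ineq_cone_def by (auto simp: hull_inc inner_commute[of c])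
      then have "(- c) \<bullet> z \<le> 0"
        using z by (auto simp: polar_cone_def)
      then show False
        using cb(1) b0 by simp
    qed
  qed
qed

text \<open>A polar vector is a non-negative combination of all normal vectors.  Orthogonality to the point \<open>x\<close>, at which the
  inequalities outside \<open>I\<close> are strict, forces the coefficients outside \<open>I\<close> to vanish.\<close>

lemma normal_cone_open_face:
  assumes S: "finite S" "I \<subseteq> S" and x: "x \<in> open_face S a I"
  shows "polar_cone (ineq_cone S a) \<inter> span (a ` I) = convex_cone hull (a ` I)"
proof
  show "convex_cone hull (a ` I) \<subseteq> polar_cone (ineq_cone S a) \<inter> span (a ` I)"
    unfolding polar_ineq_cone[OF S(1)] using S(2)
    by (intro Int_greatest hull_mono image_mono hull_minimal convex_cone_span span_superset)
  show "polar_cone (ineq_cone S a) \<inter> span (a ` I) \<subseteq> convex_cone hull (a ` I)"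
  proof
    fix z assume z: "z \<in> polar_cone (ineq_cone S a) \<inter> span (a ` I)"
    have "a ` S = a ` I \<union> a ` (S - I)"
      using S by auto
    then have "z \<in> convex_cone hull (a ` I \<union> a ` (S - I))"
      using z polar_ineq_cone[OF S(1), of a] by simp
    then obtain p q where pq: "p \<in> convex_cone hull (a ` I)" "q \<in> convex_cone hull (a ` (S - I))" "z = p + q"
      unfolding convex_cone_hull_Un by auto
    have x0: "y \<bullet> x = 0" if "y \<in> span (a ` I)" for y
      using that x by (induction rule: span_induct_alt) (auto simp: open_face_def inner_add_left)
    have "p \<in> span (a ` I)"
      using pq(1) hull_minimal[of "a ` I" "span (a ` I)" convex_cone] convex_cone_span span_superset by blast
    then have "q \<bullet> x = 0"
      using x0[of z] x0[of p] z pq(3) by (simp add: inner_add_left)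
    have "convex_cone {q. q \<bullet> x < 0 \<or> q = 0}"
      unfolding convex_cone_iff
      by (auto simp: inner_add_left mult_pos_neg less_eq_real_def intro: add_neg_neg)
    then have "convex_cone hull (a ` (S - I)) \<subseteq> {q. q \<bullet> x < 0 \<or> q = 0}"
      using x by (intro hull_minimal) (auto simp: open_face_def)
    then have "q = 0"
      using pq(2) \<open>q \<bullet> x = 0\<close> by auto
    then show "z \<in> convex_cone hull (a ` I)"
      using pq by simp
  qed
qed

subsection \<open>The functionals as sums over all sets of tight inequalities\<close>

text \<open>The rest of the closed face lies in finitely many hyperplanes \<open>a s \<bullet> y = 0\<close> that do not contain the flat.\<close>

lemma gaussian_open_face:
  assumes S: "finite S" "I \<subseteq> S" and x: "x \<in> open_face S a I"
  shows "measure (gaussian_on (flat I a)) (ineq_cone S a \<inter> flat I a)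
    = measure (gaussian_on (flat I a)) (open_face S a I)"
proof -
  interpret prob_space "std_gauss :: 'b measure" by (rule prob_std_gauss)
  have cl: "closed (ineq_cone S a \<inter> flat I a)"
    by (intro closed_Int closed_ineq_cone closed_subspace subspace_flat)
  note proj = orth_proj_in(1)[OF subspace_flat[of I a]]
  have "AE g in std_gauss. \<forall>s\<in>S - I. orth_proj (flat I a) g \<notin> {y. a s \<bullet> y = 0}"
  proof (rule AE_finite_allI)
    fix s assume s: "s \<in> S - I"
    show "AE g in std_gauss. orth_proj (flat I a) g \<notin> {y. a s \<bullet> y = 0}"
    proof (rule AE_std_gauss_linear_notin)
      show "linear (orth_proj (flat I a))"
        by (rule orth_proj_linear[OF subspace_flat])
      show "subspace {y. a s \<bullet> y = 0}"
        by (rule subspace_hyperplane)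
      have "orth_proj (flat I a) x = x"
        using x by (intro orth_proj_eqI subspace_flat) (auto simp: open_face_def flat_def orthogonal_comp_def orthogonal_def)
      then show "\<exists>x. orth_proj (flat I a) x \<notin> {y. a s \<bullet> y = 0}"
        using x s unfolding open_face_def by (intro exI[of _ x]) force
    qed
  qed (use S in auto)
  then have ae: "AE g in std_gauss. orth_proj (flat I a) g \<in> ineq_cone S a \<inter> flat I a
      \<longleftrightarrow> orth_proj (flat I a) g \<in> open_face S a I"
  proof eventually_elim
    fix g assume g: "\<forall>s\<in>S - I. orth_proj (flat I a) g \<notin> {y. a s \<bullet> y = 0}"
    show "orth_proj (flat I a) g \<in> ineq_cone S a \<inter> flat I a \<longleftrightarrow> orth_proj (flat I a) g \<in> open_face S a I"
      using g proj[of g] open_face_subset[OF S(2), of a]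
      by (auto simp: open_face_def ineq_cone_def flat_def less_le)
  qed
  have [measurable]: "{g. orth_proj (flat I a) g \<in> ineq_cone S a \<inter> flat I a} \<in> sets borel"
    using measurable_sets_borel[OF orth_proj_measurable[OF subspace_flat[of I a]] borel_closed[OF cl]] by (simp add: vimage_def)
  have [measurable]: "{g. orth_proj (flat I a) g \<in> open_face S a I} \<in> sets borel"
    using measurable_sets_borel[OF orth_proj_measurable[OF subspace_flat[of I a]] open_face_borel[OF S(1), of a I]]
    by (simp add: vimage_def)
  have "measure std_gauss {g. orth_proj (flat I a) g \<in> ineq_cone S a \<inter> flat I a}
      = measure std_gauss {g. orth_proj (flat I a) g \<in> open_face S a I}"
    by (rule finite_measure_eq_AE) (use ae in \<open>auto simp del: Int_iff\<close>)
  then show ?thesis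
    using cl S by (simp add: measure_gaussian_on subspace_flat open_face_borel borel_closed)
qed

definition face_weight :: "'s set \<Rightarrow> ('s \<Rightarrow> 'a::euclidean_space) \<Rightarrow> 's set \<Rightarrow> real" where
  "face_weight S a I = measure (gaussian_on (flat I a)) (open_face S a I)"

definition normal_weight :: "('s \<Rightarrow> 'a::euclidean_space) \<Rightarrow> 's set \<Rightarrow> real" where
  "normal_weight a I = measure (gaussian_on (span (a ` I))) (convex_cone hull (a ` I))"

lemma face_weight_empty: "open_face S a I = {} \<Longrightarrow> face_weight S a I = 0"
  by (simp add: face_weight_def)

text \<open>A set of inequalities that is not the set of tight ones of any point of the cone contributes
  nothing, so the sum may run over all sets.\<close>

lemma u_functional_ineq_cone:
  assumes S: "finite S"
  shows "u_functional k (ineq_cone S a) = (\<Sum>I | I \<in> Pow S \<and> dim (flat I a) = k. face_weight S a I)"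
proof -
  have "u_functional k (ineq_cone S a)
      = (\<Sum>I | I \<in> Pow S \<and> open_face S a I \<noteq> {} \<and> dim (flat I a) = k.
            measure (gaussian_on (flat I a)) (ineq_cone S a \<inter> flat I a))"
    unfolding u_functional_def face_spans_ineq_cone[OF S]
    by (subst sum.reindex[OF inj_on_flat]) (simp add: comp_def)
  also have "\<dots> = (\<Sum>I | I \<in> Pow S \<and> open_face S a I \<noteq> {} \<and> dim (flat I a) = k. face_weight S a I)"
    using gaussian_open_face[OF S] by (intro sum.cong) (auto simp: face_weight_def)
  also have "\<dots> = (\<Sum>I | I \<in> Pow S \<and> dim (flat I a) = k. face_weight S a I)"
    using S by (intro sum.mono_neutral_left) (auto simp: face_weight_empty)
  finally show ?thesis .
qed

lemma v_functional_ineq_cone: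
  assumes S: "finite S"
  shows "v_functional k (ineq_cone S a)
    = (\<Sum>I | I \<in> Pow S \<and> dim (flat I a) = k. face_weight S a I * normal_weight a I)"
proof -
  have "v_functional k (ineq_cone S a)
      = (\<Sum>I | I \<in> Pow S \<and> open_face S a I \<noteq> {} \<and> dim (flat I a) = k.
            measure (gaussian_on (flat I a)) (ineq_cone S a \<inter> flat I a) *
            measure (gaussian_on (span (a ` I))) (polar_cone (ineq_cone S a) \<inter> span (a ` I)))"
    unfolding v_functional_def face_spans_ineq_cone[OF S]
    by (subst sum.reindex[OF inj_on_flat]) (simp add: comp_def flat_orthogonal_comp)
  also have "\<dots> = (\<Sum>I | I \<in> Pow S \<and> open_face S a I \<noteq> {} \<and> dim (flat I a) = k. face_weight S a I * normal_weight a I)"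
  proof (rule sum.cong[OF refl])
    fix I assume "I \<in> {I. I \<in> Pow S \<and> open_face S a I \<noteq> {} \<and> dim (flat I a) = k}"
    then obtain x where x: "I \<subseteq> S" "x \<in> open_face S a I"
      by auto
    show "measure (gaussian_on (flat I a)) (ineq_cone S a \<inter> flat I a) *
            measure (gaussian_on (span (a ` I))) (polar_cone (ineq_cone S a) \<inter> span (a ` I))
        = face_weight S a I * normal_weight a I"
      by (simp only: face_weight_def normal_weight_def gaussian_open_face[OF S x] normal_cone_open_face[OF S x])
  qed
  also have "\<dots> = (\<Sum>I | I \<in> Pow S \<and> dim (flat I a) = k. face_weight S a I * normal_weight a I)"
    using S by (intro sum.mono_neutral_left) (auto simp: face_weight_empty)
  finally show ?thesis .
qed

subsection \<open>Product cones\<close>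

definition section_at :: "('i \<times> 'j) set \<Rightarrow> 'i \<Rightarrow> 'j set" where
  "section_at I i = {j. (i, j) \<in> I}"

definition axis_family :: "('i::finite \<Rightarrow> 'j \<Rightarrow> 'a::euclidean_space) \<Rightarrow> 'i \<times> 'j \<Rightarrow> 'a^'i" where
  "axis_family a = (\<lambda>(i, j). axis i (a i j))"

lemma inner_axis_family: "axis_family a (i, j) \<bullet> x = a i j \<bullet> (x $ i)"
  by (simp add: axis_family_def inner_axis')

lemma ineq_cone_axis_family:
  "ineq_cone S (axis_family a) = {x. \<forall>i. x $ i \<in> ineq_cone (section_at S i) (a i)}"
  by (auto simp: ineq_cone_def section_at_def inner_axis_family)

lemma flat_axis_family:
  "flat I (axis_family a) = {x. \<forall>i. x $ i \<in> flat (section_at I i) (a i)}"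
  by (auto simp: flat_def section_at_def inner_axis_family)

lemma open_face_axis_family:
  "open_face S (axis_family a) I = {x. \<forall>i. x $ i \<in> open_face (section_at S i) (a i) (section_at I i)}"
  by (auto simp: open_face_def section_at_def inner_axis_family[symmetric])

lemma linear_axis: "linear (axis i :: 'a::real_vector \<Rightarrow> 'a^'i)"
  by (intro linearI) (auto simp: vec_eq_iff axis_def)

lemma vec_eq_sum_axis: "x = (\<Sum>i\<in>UNIV. axis i (x $ i))" for x :: "'a::real_vector^'i::finite"
  by (simp add: vec_eq_iff axis_def if_distrib sum.delta' cong: if_cong)

lemma span_axis_family:
  "span (axis_family a ` I) = {x. \<forall>i. x $ i \<in> span (a i ` section_at I i)}"
proof
  show "span (axis_family a ` I) \<subseteq> {x. \<forall>i. x $ i \<in> span (a i ` section_at I i)}"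
  proof (rule span_minimal)
    have "axis k (a k j) $ i \<in> span (a i ` section_at I i)" if "(k, j) \<in> I" for k j i
      using that by (cases "i = k") (auto simp: axis_def section_at_def span_zero intro!: span_base)
    then show "axis_family a ` I \<subseteq> {x. \<forall>i. x $ i \<in> span (a i ` section_at I i)}"
      by (auto simp: axis_family_def)
    show "subspace {x. \<forall>i. x $ i \<in> span (a i ` section_at I i)}"
      by (auto simp: subspace_def span_zero span_add span_scale)
  qed
  show "{x. \<forall>i. x $ i \<in> span (a i ` section_at I i)} \<subseteq> span (axis_family a ` I)"
  proof
    fix x assume x: "x \<in> {x. \<forall>i. x $ i \<in> span (a i ` section_at I i)}"
    have "axis i y \<in> span (axis_family a ` I)" if "y \<in> span (a i ` section_at I i)" for i y
    proof -
      have "axis i y \<in> span (axis i ` a i ` section_at I i)"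
        using that by (simp add: linear_span_image[OF linear_axis])
      moreover have "axis i ` a i ` section_at I i \<subseteq> axis_family a ` I"
        by (force simp: axis_family_def section_at_def)
      ultimately show ?thesis
        using span_mono by blast
    qed
    then have "(\<Sum>i\<in>UNIV. axis i (x $ i)) \<in> span (axis_family a ` I)"
      using x by (intro span_sum) auto
    then show "x \<in> span (axis_family a ` I)"
      by (simp flip: vec_eq_sum_axis)
  qed
qed

lemma convex_cone_sum:
  assumes "convex_cone S" "finite A" "\<And>i. i \<in> A \<Longrightarrow> f i \<in> S"
  shows "(\<Sum>i\<in>A. f i) \<in> S"
  using assms(2,3) by (induction A) (auto simp: convex_cone_contains_0[OF assms(1)] convex_cone_add[OF assms(1)])

lemma cone_hull_axis_family:
  "convex_cone hull (axis_family a ` I) = {x. \<forall>i. x $ i \<in> convex_cone hull (a i ` section_at I i)}"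
proof
  show "convex_cone hull (axis_family a ` I) \<subseteq> {x. \<forall>i. x $ i \<in> convex_cone hull (a i ` section_at I i)}"
  proof (rule hull_minimal)
    have "axis k (a k j) $ i \<in> convex_cone hull (a i ` section_at I i)" if "(k, j) \<in> I" for k j i
      using that by (cases "i = k") (auto simp: axis_def section_at_def convex_cone_hull_contains_0 intro!: hull_inc)
    then show "axis_family a ` I \<subseteq> {x. \<forall>i. x $ i \<in> convex_cone hull (a i ` section_at I i)}"
      by (auto simp: axis_family_def)
    show "convex_cone {x. \<forall>i. x $ i \<in> convex_cone hull (a i ` section_at I i)}"
      by (auto simp: convex_cone_iff convex_cone_hull_contains_0 convex_cone_hull_add convex_cone_hull_mul)
  qed
  show "{x. \<forall>i. x $ i \<in> convex_cone hull (a i ` section_at I i)} \<subseteq> convex_cone hull (axis_family a ` I)"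
  proof
    fix x assume x: "x \<in> {x. \<forall>i. x $ i \<in> convex_cone hull (a i ` section_at I i)}"
    have "axis i y \<in> convex_cone hull (axis_family a ` I)" if "y \<in> convex_cone hull (a i ` section_at I i)" for i y
    proof -
      have "axis i y \<in> convex_cone hull (axis i ` a i ` section_at I i)"
        using that by (simp add: convex_cone_hull_linear_image[OF linear_axis])
      moreover have "axis i ` a i ` section_at I i \<subseteq> axis_family a ` I"
        by (force simp: axis_family_def section_at_def)
      ultimately show ?thesis
        using hull_mono by blast
    qed
    then have "(\<Sum>i\<in>UNIV. axis i (x $ i)) \<in> convex_cone hull (axis_family a ` I)"
      using x by (intro convex_cone_sum convex_cone_convex_cone_hull) auto
    then show "x \<in> convex_cone hull (axis_family a ` I)"
      by (simp flip: vec_eq_sum_axis)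
  qed
qed

text \<open>The union of the bases, placed along the different axes, is an orthonormal basis of the product.\<close>

lemma product_onb:
  fixes V :: "'i::finite \<Rightarrow> 'a::euclidean_space set"
  assumes B: "\<And>i. orthonormal_basis_of (B i) (V i)"
  shows "orthonormal_basis_of ((\<lambda>p. axis (fst p) (snd p)) ` Sigma UNIV B) {x::'a^'i. \<forall>i. x $ i \<in> V i}"
    and "inj_on (\<lambda>p. axis (fst p) (snd p) :: 'a^'i) (Sigma UNIV B)"
proof -
  note fin = onb_finite[OF B]
  define h where "h = (\<lambda>p. axis (fst p) (snd p) :: 'a^'i)"
  have img: "h ` Sigma UNIV B = axis_family (\<lambda>i b. b) ` Sigma UNIV B"
    by (simp add: h_def axis_family_def split_def)
  have "section_at (Sigma UNIV B) i = B i" for i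
    by (auto simp: section_at_def)
  then have span: "span (h ` Sigma UNIV B) = {x. \<forall>i. x $ i \<in> V i}"
    unfolding img span_axis_family by (simp add: fin(4))
  have ne: "b \<noteq> 0" if "b \<in> B i" for i b
    using B[of i] that unfolding orthonormal_basis_of_def by force
  have "orthonormal_basis_of (h ` Sigma UNIV B) {x. \<forall>i. x $ i \<in> V i}"
    unfolding orthonormal_basis_of_def
  proof (intro conjI span)
    show "\<forall>b\<in>h ` Sigma UNIV B. norm b = 1"
      using B by (auto simp: h_def norm_eq_1 inner_axis_axis orthonormal_basis_of_def)
    show "pairwise orthogonal (h ` Sigma UNIV B)"
      using onb_inner[OF B]
      by (auto simp: pairwise_def h_def orthogonal_def inner_axis_axis)
  qed
  then show "orthonormal_basis_of ((\<lambda>p. axis (fst p) (snd p)) ` Sigma UNIV B) {x::'a^'i. \<forall>i. x $ i \<in> V i}"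
    by (simp add: h_def)
  show "inj_on (\<lambda>p. axis (fst p) (snd p) :: 'a^'i) (Sigma UNIV B)"
    using ne by (auto simp: inj_on_def axis_eq_axis)
qed

lemma face_weight_axis_family:
  assumes "\<And>i. finite (section_at S i)" "I \<subseteq> S"
  shows "face_weight S (axis_family a) I
    = (\<Prod>i\<in>UNIV. face_weight (section_at S i) (a i) (section_at I i))"
proof -
  have "section_at I i \<subseteq> section_at S i" for i
    using assms(2) by (auto simp: section_at_def)
  then show ?thesis
    unfolding face_weight_def flat_axis_family open_face_axis_family
    using assms(1) by (intro gaussian_on_product subspace_flat open_face_borel)
qed

lemma normal_weight_axis_family:
  assumes "\<And>i. finite (section_at I i)"
  shows "normal_weight (axis_family a) I = (\<Prod>i\<in>UNIV. normal_weight (a i) (section_at I i))"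
  unfolding normal_weight_def span_axis_family cone_hull_axis_family
  using assms by (intro gaussian_on_product subspace_span borel_closed closed_convex_cone_hull) auto

section \<open>Measurable dependence on the cone\<close>

lemma continuous_on_matrix_vector_mult:
  fixes f :: "'x::topological_space \<Rightarrow> real^'n^'m"
  assumes "continuous_on S f" "continuous_on S g"
  shows "continuous_on S (\<lambda>x. f x *v g x)"
  unfolding matrix_vector_mult_def using assms by (intro continuous_intros)

lemma continuous_on_matrix_mult:
  fixes f :: "'x::topological_space \<Rightarrow> real^'n^'m" and g :: "'x \<Rightarrow> real^'k^'n"
  assumes "continuous_on S f" "continuous_on S g"
  shows "continuous_on S (\<lambda>x. f x ** g x)"
  unfolding matrix_matrix_mult_def using assms by (intro continuous_intros)

lemma continuous_on_transpose:
  fixes f :: "'x::topological_space \<Rightarrow> real^'n^'m"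
  assumes "continuous_on S f"
  shows "continuous_on S (\<lambda>x. transpose (f x))"
  unfolding transpose_def using assms by (intro continuous_intros)

lemma borel_pair: "sets (borel \<Otimes>\<^sub>M borel) = sets (borel :: ('a::euclidean_space \<times> 'b::euclidean_space) measure)"
  by (simp only: borel_prod)

text \<open>One summand at a time: each step projects along its coefficient.\<close>

lemma fsigma_span:
  fixes f :: "'s \<Rightarrow> 'x::euclidean_space \<Rightarrow> 'a::euclidean_space"
  assumes "finite I" "\<And>s. s \<in> I \<Longrightarrow> continuous_on UNIV (f s)"
  shows "fsigma {p. snd p \<in> span ((\<lambda>s. f s (fst p)) ` I)}"
  using assms
proof (induction I)
  case empty
  have "closed {p::'x \<times> 'a. snd p = 0}"
    by (intro closed_Collect_eq continuous_intros)
  then show ?case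
    by (auto intro: fsigma_closed)
next
  case (insert s I)
  have IH: "fsigma {p. snd p \<in> span ((\<lambda>s. f s (fst p)) ` I)}"
    using insert by auto
  have c: "continuous_on UNIV (\<lambda>r::('x \<times> 'a) \<times> real. (fst (fst r), snd (fst r) - snd r *\<^sub>R f s (fst (fst r))))"
    by (intro continuous_intros continuous_on_compose2[OF insert.prems[of s]]) auto
  have "fsigma {p. \<exists>k. snd p - k *\<^sub>R f s (fst p) \<in> span ((\<lambda>s. f s (fst p)) ` I)}"
    using fsigma_Collect_comp[OF IH c] by (intro fsigma_project) simp
  then show ?case
    by (simp add: span_breakdown_eq)
qed

lemma convex_cone_hull_singleton: "convex_cone hull {a} = {c *\<^sub>R a | c. 0 \<le> c}"
proof
  show "convex_cone hull {a} \<subseteq> {c *\<^sub>R a | c. 0 \<le> c}"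
  proof (rule hull_minimal)
    show "{a} \<subseteq> {c *\<^sub>R a | c. 0 \<le> c}"
      by (auto intro: exI[of _ 1])
    show "convex_cone {c *\<^sub>R a | c. 0 \<le> c}"
      unfolding convex_cone_iff by (auto simp flip: scaleR_add_left) (metis mult_nonneg_nonneg, metis order_refl scaleR_zero_left)?
  qed
  show "{c *\<^sub>R a | c. 0 \<le> c} \<subseteq> convex_cone hull {a}"
    using convex_cone_hull_mul[OF hull_inc[of a "{a}"]] by auto
qed

lemma convex_cone_hull_breakdown:
  "y \<in> convex_cone hull (insert a A) \<longleftrightarrow> (\<exists>c. 0 \<le> c \<and> y - c *\<^sub>R a \<in> convex_cone hull A)"
proof -
  have "convex_cone hull (insert a A) = convex_cone hull ({a} \<union> A)"
    by simp
  then show ?thesis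
    unfolding convex_cone_hull_Un convex_cone_hull_singleton
    by (auto simp: algebra_simps) (metis add.commute diff_add_cancel)
qed

lemma fsigma_convex_cone_hull:
  fixes f :: "'s \<Rightarrow> 'x::euclidean_space \<Rightarrow> 'a::euclidean_space"
  assumes "finite I" "\<And>s. s \<in> I \<Longrightarrow> continuous_on UNIV (f s)"
  shows "fsigma {p. snd p \<in> convex_cone hull ((\<lambda>s. f s (fst p)) ` I)}"
  using assms
proof (induction I)
  case empty
  have "closed {p::'x \<times> 'a. snd p = 0}"
    by (intro closed_Collect_eq continuous_intros)
  then show ?case
    by (auto intro: fsigma_closed)
next
  case (insert s I)
  have IH: "fsigma {p. snd p \<in> convex_cone hull ((\<lambda>s. f s (fst p)) ` I)}"
    using insert by auto
  have c: "continuous_on UNIV (\<lambda>r::('x \<times> 'a) \<times> real. (fst (fst r), snd (fst r) - snd r *\<^sub>R f s (fst (fst r))))"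
    by (intro continuous_intros continuous_on_compose2[OF insert.prems[of s]]) auto
  have "closed {r::('x \<times> 'a) \<times> real. 0 \<le> snd r}"
    by (intro closed_Collect_le continuous_intros)
  then have "fsigma {r::('x \<times> 'a) \<times> real. 0 \<le> snd r}"
    by (rule fsigma_closed)
  then have "fsigma {p. \<exists>k\<ge>0. snd p - k *\<^sub>R f s (fst p) \<in> convex_cone hull ((\<lambda>s. f s (fst p)) ` I)}"
    using fsigma_Collect_comp[OF IH c] by (intro fsigma_project fsigma_Collect_conj) simp_all
  then show ?case
    by (simp add: convex_cone_hull_breakdown)
qed

lemma fsigma_open_face:
  fixes f :: "'s \<Rightarrow> 'x::euclidean_space \<Rightarrow> 'a::euclidean_space"
  assumes "finite S" "I \<subseteq> S" "\<And>s. s \<in> S \<Longrightarrow> continuous_on UNIV (f s)"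
  shows "fsigma {p. snd p \<in> open_face S (\<lambda>s. f s (fst p)) I}"
proof -
  have fin: "finite I" "finite (S - I)"
    using assms finite_subset by auto
  have c: "continuous_on UNIV (\<lambda>p::'x \<times> 'a. f s (fst p) \<bullet> snd p)" if "s \<in> S" for s
    by (intro continuous_intros continuous_on_compose2[OF assms(3)[OF that]]) auto
  show ?thesis
    unfolding open_face_def mem_Collect_eq
    using assms(2) fin
    by (intro fsigma_Collect_conj fsigma_Collect_ball fsigma_closed[OF closed_Collect_eq] fsigma_open[OF open_Collect_less] c
        continuous_on_const) auto
qed

lemma fsigma_section_measure:
  fixes P :: "'x::euclidean_space \<Rightarrow> 'a::euclidean_space \<Rightarrow> bool"
  assumes "fsigma {p. P (fst p) (snd p)}"
  shows "(\<lambda>q. measure std_gauss {g. P q g}) \<in> borel_measurable borel"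
proof -
  interpret prob_space "std_gauss :: 'a measure" by (rule prob_std_gauss)
  have "{p. P (fst p) (snd p)} \<in> sets (borel \<Otimes>\<^sub>M (std_gauss :: 'a measure))"
    using fsigma_borel[OF assms] unfolding sets_pair_measure_cong[OF refl sets_std_gauss] borel_pair .
  then have "(\<lambda>q. emeasure std_gauss (Pair q -` {p. P (fst p) (snd p)})) \<in> borel_measurable borel"
    by (rule measurable_emeasure_Pair)
  then show ?thesis
    by (simp add: measure_def vimage_def)
qed

lemma orth_proj_mem_iff:
  assumes "subspace L" "A \<subseteq> L"
  shows "orth_proj L g \<in> A \<longleftrightarrow> (\<exists>x. x \<in> A \<and> g - x \<in> L\<^sup>\<bottom>)"
proof
  assume "orth_proj L g \<in> A"
  then show "\<exists>x. x \<in> A \<and> g - x \<in> L\<^sup>\<bottom>"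
    using orth_proj_in(2)[OF assms(1)] by auto
next
  assume "\<exists>x. x \<in> A \<and> g - x \<in> L\<^sup>\<bottom>"
  then obtain x where "x \<in> A" "g - x \<in> L\<^sup>\<bottom>" by auto
  then show "orth_proj L g \<in> A"
    using orth_proj_eqI[OF assms(1)] assms(2) by auto
qed

text \<open>Replacing the projection by the existence of a decomposition turns the event into a projection of a
  sigma-compact set.\<close>

lemma face_weight_eq:
  assumes "finite S" "I \<subseteq> S"
  shows "face_weight S a I
    = measure std_gauss {g. \<exists>x. x \<in> open_face S a I \<and> g - x \<in> span (a ` I)}"
proof -
  have "open_face S a I \<subseteq> flat I a"
    using open_face_subset[OF assms(2)] by auto
  from orth_proj_mem_iff[OF subspace_flat this] show ?thesis
    using assms by (simp add: face_weight_def measure_gaussian_on subspace_flat open_face_borel flat_orthogonal_comp)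
qed

lemma normal_weight_eq:
  assumes "finite I"
  shows "normal_weight a I
    = measure std_gauss {g. \<exists>y. y \<in> convex_cone hull (a ` I) \<and> g - y \<in> flat I a}"
proof -
  have "convex_cone hull (a ` I) \<subseteq> span (a ` I)"
    by (intro hull_minimal span_superset convex_cone_span)
  from orth_proj_mem_iff[OF subspace_span this] show ?thesis
    using assms by (simp add: normal_weight_def measure_gaussian_on closed_convex_cone_hull borel_closed flat_orthogonal)
qed

lemma face_weight_measurable:
  fixes f :: "'s \<Rightarrow> 'x::euclidean_space \<Rightarrow> 'a::euclidean_space"
  assumes "finite S" "I \<subseteq> S" "\<And>s. s \<in> S \<Longrightarrow> continuous_on UNIV (f s)"
  shows "(\<lambda>q. face_weight S (\<lambda>s. f s q) I) \<in> borel_measurable borel"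
  unfolding face_weight_eq[OF assms(1,2)]
proof (rule fsigma_section_measure, rule fsigma_project, rule fsigma_Collect_conj)
  have fin: "finite I" "\<And>s. s \<in> I \<Longrightarrow> continuous_on UNIV (f s)"
    using assms finite_subset by auto
  have c: "continuous_on UNIV (\<lambda>r::('x \<times> 'a) \<times> 'a. (fst (fst r), snd r))"
    "continuous_on UNIV (\<lambda>r::('x \<times> 'a) \<times> 'a. (fst (fst r), snd (fst r) - snd r))"
    by (intro continuous_intros)+
  show "fsigma {p::('x \<times> 'a) \<times> 'a. snd p \<in> open_face S (\<lambda>s. f s (fst (fst p))) I}"
    using fsigma_Collect_comp[OF fsigma_open_face[of S I f] c(1)] assms by simp
  show "fsigma {p. snd (fst p) - snd p \<in> span ((\<lambda>s. f s (fst (fst p))) ` I)}"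
    using fsigma_Collect_comp[OF fsigma_span[of I f] c(2)] fin by simp
qed

lemma normal_weight_measurable:
  fixes f :: "'s \<Rightarrow> 'x::euclidean_space \<Rightarrow> 'a::euclidean_space"
  assumes "finite I" "\<And>s. s \<in> I \<Longrightarrow> continuous_on UNIV (f s)"
  shows "(\<lambda>q. normal_weight (\<lambda>s. f s q) I) \<in> borel_measurable borel"
  unfolding normal_weight_eq[OF assms(1)]
proof (rule fsigma_section_measure, rule fsigma_project, rule fsigma_Collect_conj)
  have c: "continuous_on UNIV (\<lambda>r::('x \<times> 'a) \<times> 'a. (fst (fst r), snd r))"
    by (intro continuous_intros)
  show "fsigma {p::('x \<times> 'a) \<times> 'a. snd p \<in> convex_cone hull ((\<lambda>s. f s (fst (fst p))) ` I)}"
    using fsigma_Collect_comp[OF fsigma_convex_cone_hull[of I f] c] assms by simp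
  show "fsigma {p. snd (fst p) - snd p \<in> flat I (\<lambda>s. f s (fst (fst p)))}"
    unfolding flat_def mem_Collect_eq using assms
    by (intro fsigma_Collect_ball fsigma_closed[OF closed_Collect_eq] continuous_intros
        continuous_on_compose2[OF assms(2)]) auto
qed

lemma borel_independent:
  fixes f :: "'s \<Rightarrow> 'x::euclidean_space \<Rightarrow> 'a::euclidean_space"
  assumes "finite I" "\<And>s. s \<in> I \<Longrightarrow> continuous_on UNIV (f s)"
  shows "{q. inj_on (\<lambda>s. f s q) I \<and> independent ((\<lambda>s. f s q) ` I)} \<in> sets borel"
  using assms
proof (induction I)
  case (insert s I)
  have "continuous_on UNIV (\<lambda>q. (q, f s q))"
    using insert.prems by (intro continuous_intros) auto
  then have "fsigma {q. f s q \<in> span ((\<lambda>s. f s q) ` I)}"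
    using fsigma_Collect_comp[OF fsigma_span[of I f]] insert by fastforce
  then have "- {q. f s q \<in> span ((\<lambda>s. f s q) ` I)} \<in> sets borel"
    by (intro borel_comp fsigma_borel)
  moreover have "{q. inj_on (\<lambda>s. f s q) I \<and> independent ((\<lambda>s. f s q) ` I)} \<in> sets borel"
    using insert by auto
  moreover have "{q. inj_on (\<lambda>s. f s q) (insert s I) \<and> independent ((\<lambda>s. f s q) ` insert s I)}
      = {q. inj_on (\<lambda>s. f s q) I \<and> independent ((\<lambda>s. f s q) ` I)} \<inter> - {q. f s q \<in> span ((\<lambda>s. f s q) ` I)}"
    using insert(2) by (auto simp: independent_insert intro: span_base)
  ultimately show ?case
    by (simp only: sets.Int)
qed simp

lemma dim_span_ge_iff:
  fixes f :: "'s \<Rightarrow> 'a::euclidean_space"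
  shows "m \<le> dim (span (f ` I)) \<longleftrightarrow> (\<exists>J\<subseteq>I. card J = m \<and> finite J \<and> inj_on f J \<and> independent (f ` J))"
proof
  assume "m \<le> dim (span (f ` I))"
  then have m: "m \<le> dim (f ` I)" by simp
  obtain B where B: "B \<subseteq> f ` I" "independent B" "card B = dim (f ` I)"
    using basis_exists[of "f ` I"] by metis
  obtain B' where B': "B' \<subseteq> B" "card B' = m" "finite B'"
    using obtain_subset_with_card_n[of m B] m B by metis
  obtain J where J: "J \<subseteq> I" "inj_on f J" "f ` J = B'"
    using B' B by (metis subset_image_inj subset_trans)
  moreover have "independent B'"
    using B(2) B'(1) by (rule independent_mono)
  moreover have "card J = m" "finite J"
    using J B' by (auto simp: card_image dest: finite_imageD)
  ultimately show "\<exists>J\<subseteq>I. card J = m \<and> finite J \<and> inj_on f J \<and> independent (f ` J)"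
    by auto
next
  assume "\<exists>J\<subseteq>I. card J = m \<and> finite J \<and> inj_on f J \<and> independent (f ` J)"
  then obtain J where J: "J \<subseteq> I" "card J = m" "inj_on f J" "independent (f ` J)"
    by auto
  have "m = dim (f ` J)"
    using J by (simp add: dim_eq_card_independent card_image)
  also have "\<dots> \<le> dim (span (f ` I))"
    using J by (intro dim_subset) (auto intro: span_base)
  finally show "m \<le> dim (span (f ` I))" .
qed

text \<open>The dimension of the span is at least \<open>m\<close> exactly if some \<open>m\<close> of the vectors are independent, and there are
  finitely many choices of \<open>m\<close> vectors.\<close>

lemma borel_dim_flat:
  fixes f :: "'s \<Rightarrow> 'x::euclidean_space \<Rightarrow> 'a::euclidean_space"
  assumes I: "finite I" and f: "\<And>s. s \<in> I \<Longrightarrow> continuous_on UNIV (f s)"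
  shows "{q. dim (flat I (\<lambda>s. f s q)) = k} \<in> sets borel"
proof -
  have ge: "{q. m \<le> dim (span ((\<lambda>s. f s q) ` I))} \<in> sets borel" for m
  proof -
    have "{q. m \<le> dim (span ((\<lambda>s. f s q) ` I))}
        = (\<Union>J\<in>{J. J \<subseteq> I \<and> card J = m \<and> finite J}. {q. inj_on (\<lambda>s. f s q) J \<and> independent ((\<lambda>s. f s q) ` J)})"
      unfolding dim_span_ge_iff by blast
    also have "\<dots> \<in> sets borel"
      using I f by (intro sets.finite_UN) (auto intro!: borel_independent)
    finally show ?thesis .
  qed
  show ?thesis
  proof (cases "k \<le> DIM('a)")
    case True
    have "dim (flat I (\<lambda>s. f s q)) = k \<longleftrightarrow> (DIM('a) - k \<le> dim (span ((\<lambda>s. f s q) ` I)) \<and>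
        \<not> Suc (DIM('a) - k) \<le> dim (span ((\<lambda>s. f s q) ` I)))" for q
      using dim_flat[of I "\<lambda>s. f s q"] True by linarith
    then have "{q. dim (flat I (\<lambda>s. f s q)) = k}
        = {q. DIM('a) - k \<le> dim (span ((\<lambda>s. f s q) ` I))} - {q. Suc (DIM('a) - k) \<le> dim (span ((\<lambda>s. f s q) ` I))}"
      by blast
    then show ?thesis
      using ge by (simp only: sets.Diff)
  next
    case False
    then have "dim (flat I (\<lambda>s. f s q)) \<noteq> k" for q
      using dim_flat[of I "\<lambda>s. f s q"] by linarith
    then show ?thesis
      by simp
  qed
qed

section \<open>Reflections and the Haar measure\<close>

definition reflection :: "'a::euclidean_space \<Rightarrow> 'a \<Rightarrow> 'a" where
  "reflection a z = z - (2 * (a \<bullet> z) / (a \<bullet> a)) *\<^sub>R a"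

lemma linear_reflection: "linear (reflection a)"
  by (intro linearI) (simp_all add: reflection_def inner_add_right algebra_simps add_divide_distrib)

lemma reflection_symmetric: "reflection a x \<bullet> y = x \<bullet> reflection a y"
  by (simp add: reflection_def inner_diff_left inner_diff_right inner_commute)

lemma reflection_involution [simp]: "reflection a (reflection a x) = x"
proof (cases "a = 0")
  case False
  then have "a \<bullet> reflection a x = - (a \<bullet> x)"
    by (simp add: reflection_def inner_diff_right)
  then have "reflection a (reflection a x) = reflection a x + (2 * (a \<bullet> x) / (a \<bullet> a)) *\<^sub>R a"
    by (simp add: reflection_def[of a "reflection a x"])
  then show ?thesis
    by (simp add: reflection_def)
qed (simp add: reflection_def)

lemma orthogonal_transformation_reflection: "orthogonal_transformation (reflection a)"
  by (simp add: orthogonal_transformation_def linear_reflection reflection_symmetric)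

lemma reflection_orthogonal: "a \<bullet> z = 0 \<Longrightarrow> reflection a z = z"
  by (simp add: reflection_def)

lemma reflection_in: "subspace V \<Longrightarrow> a \<in> V \<Longrightarrow> z \<in> V \<Longrightarrow> reflection a z \<in> V"
  by (simp add: reflection_def subspace_diff subspace_scale)

text \<open>A single reflection moves a vector to any other vector of the same norm; if both lie in a subspace, it
  is a reflection along a vector of that subspace.\<close>

lemma reflection_swap:
  assumes "norm x = norm y"
  shows "reflection (x - y) x = y"
proof (cases "x = y")
  case False
  have "x \<bullet> x = y \<bullet> y"
    using assms by (simp add: norm_eq)
  then have "2 * ((x - y) \<bullet> x) = (x - y) \<bullet> (x - y)"
    by (simp add: inner_diff_left inner_diff_right inner_commute)
  then show ?thesis
    using False by (simp add: reflection_def)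
qed (simp add: reflection_def)

lemma orth_proj_reflection:
  assumes "subspace L" "a \<in> L"
  shows "orth_proj L (reflection a x) = reflection a (orth_proj L x)"
proof (rule orth_proj_eqI[OF assms(1)])
  show "reflection a (orth_proj L x) \<in> L"
    by (intro reflection_in assms orth_proj_in)
  have "reflection a x - reflection a (orth_proj L x) = reflection a (x - orth_proj L x)"
    by (simp add: linear_diff[OF linear_reflection])
  also have "\<dots> = x - orth_proj L x"
    using orth_proj_in(2)[OF assms(1), of x] assms(2)
    by (intro reflection_orthogonal) (auto simp: orthogonal_comp_def orthogonal_def)
  finally show "reflection a x - reflection a (orth_proj L x) \<in> L\<^sup>\<bottom>"
    using orth_proj_in(2)[OF assms(1), of x] by simp
qed

definition reflection_matrix :: "real^'d \<Rightarrow> real^'d^'d" where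
  "reflection_matrix a = matrix (reflection a)"

lemma reflection_matrix_mult [simp]: "reflection_matrix a *v z = reflection a z"
  by (simp add: reflection_matrix_def matrix_works linear_reflection)

lemma reflection_matrix_orthogonal: "orthogonal_matrix (reflection_matrix a)"
  using orthogonal_transformation_matrix orthogonal_transformation_reflection
  unfolding reflection_matrix_def by blast

lemma reflection_matrix_transpose: "transpose (reflection_matrix a) = reflection_matrix a"
proof -
  have "transpose (reflection_matrix a) *v x = reflection_matrix a *v x" for x
  proof (rule vector_eq_ldot[THEN iffD1], rule allI)
    fix y
    show "y \<bullet> (transpose (reflection_matrix a) *v x) = y \<bullet> (reflection_matrix a *v x)"
      using dot_lmul_matrix[of y "transpose (reflection_matrix a)" x]
      by (simp add: vector_transpose_matrix reflection_symmetric)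
  qed
  then show ?thesis
    by (simp add: matrix_eq)
qed

text \<open>A compact group is unimodular: for a left-invariant probability measure, integrating
  \<open>f (X\<^sup>T Y)\<close> in both orders shows that the measure is invariant under inversion.\<close>

lemma haar_right_invariant:
  fixes \<mu> :: "(real^'d^'d) measure"
  assumes haar: "normalized_haar \<mu>" and S: "orthogonal_matrix S"
  shows "distr \<mu> \<mu> (\<lambda>A. A ** S) = \<mu>"
proof -
  interpret prob_space \<mu>
    using haar by (simp add: normalized_haar_def)
  interpret pair_sigma_finite \<mu> \<mu> by unfold_locales
  have sets[measurable_cong]: "sets \<mu> = sets (restrict_space borel {P::real^'d^'d. orthogonal_matrix P})"
    using haar by (simp add: normalized_haar_def orthogonal_group_def)
  have sp: "space \<mu> = {P. orthogonal_matrix P}"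
    using sets_eq_imp_space_eq[OF sets] by (simp add: space_restrict_space)
  have id: "(\<lambda>x. x) \<in> measurable \<mu> borel"
    by (simp add: measurable_cong_sets[OF sets refl] measurable_restrict_space1)
  have toI: "f \<in> measurable N \<mu>" if "f \<in> measurable N borel" "\<And>x. x \<in> space N \<Longrightarrow> orthogonal_matrix (f x)" for f and N :: "'n measure"
    using that by (simp add: measurable_cong_sets[OF refl sets] measurable_restrict_space2_iff)
  have comp: "(\<lambda>x. f x) \<in> measurable \<mu> \<mu>"
    if "continuous_on UNIV f" "\<And>x. orthogonal_matrix x \<Longrightarrow> orthogonal_matrix (f x)" for f
    using measurable_compose[OF id borel_measurable_continuous_onI[OF that(1)]] that(2) by (intro toI) (auto simp: sp)
  have idp: "(\<lambda>p. p) \<in> measurable (\<mu> \<Otimes>\<^sub>M \<mu>) (borel :: ((real^'d^'d) \<times> (real^'d^'d)) measure)"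
    unfolding borel_prod[symmetric]
    by (rule measurable_pair) (auto simp: comp_def intro: measurable_compose[OF measurable_fst id] measurable_compose[OF measurable_snd id])
  have m_pair[measurable]: "(\<lambda>p. transpose (fst p) ** snd p) \<in> measurable (\<mu> \<Otimes>\<^sub>M \<mu>) \<mu>"
  proof (rule toI)
    show "(\<lambda>p. transpose (fst p) ** snd p) \<in> measurable (\<mu> \<Otimes>\<^sub>M \<mu>) borel"
      by (rule measurable_compose[OF idp borel_measurable_continuous_onI])
         (intro continuous_on_matrix_mult continuous_on_transpose continuous_intros)
  qed (auto simp: space_pair_measure sp orthogonal_matrix_mul)
  have m_tr[measurable]: "transpose \<in> measurable \<mu> \<mu>"
    by (rule comp) (auto intro!: continuous_on_transpose continuous_intros)
  have m_l[measurable]: "(\<lambda>A. P ** A) \<in> measurable \<mu> \<mu>" if "orthogonal_matrix P" for P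
    using that by (intro comp) (auto intro!: continuous_on_matrix_mult continuous_intros simp: orthogonal_matrix_mul)
  have m_r[measurable]: "(\<lambda>A. A ** P) \<in> measurable \<mu> \<mu>" if "orthogonal_matrix P" for P
    using that by (intro comp) (auto intro!: continuous_on_matrix_mult continuous_intros simp: orthogonal_matrix_mul)
  have left: "(\<integral>\<^sup>+A. f (P ** A) \<partial>\<mu>) = (\<integral>\<^sup>+A. f A \<partial>\<mu>)"
    if "f \<in> borel_measurable \<mu>" "orthogonal_matrix P" for f P
  proof -
    have "distr \<mu> \<mu> (\<lambda>A. P ** A) = \<mu>"
      using haar that by (simp add: normalized_haar_def)
    then show ?thesis
      using that nn_integral_distr[OF m_l[OF that(2)], of f] by simp
  qed
  have inv: "(\<integral>\<^sup>+A. f A \<partial>\<mu>) = (\<integral>\<^sup>+A. f (transpose A) \<partial>\<mu>)" if that[measurable]: "f \<in> borel_measurable \<mu>" for f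
  proof -
    have "(\<integral>\<^sup>+A. f A \<partial>\<mu>) = (\<integral>\<^sup>+X. (\<integral>\<^sup>+A. f A \<partial>\<mu>) \<partial>\<mu>)"
      using emeasure_space_1 by simp
    also have "\<dots> = (\<integral>\<^sup>+X. (\<integral>\<^sup>+Y. f (transpose (fst (X, Y)) ** snd (X, Y)) \<partial>\<mu>) \<partial>\<mu>)"
    proof (rule nn_integral_cong)
      fix X assume "X \<in> space \<mu>"
      then have "orthogonal_matrix (transpose X)" by (simp add: sp)
      from left[OF that this] show "(\<integral>\<^sup>+A. f A \<partial>\<mu>) = (\<integral>\<^sup>+Y. f (transpose (fst (X, Y)) ** snd (X, Y)) \<partial>\<mu>)"
        by simp
    qed
    also have "\<dots> = (\<integral>\<^sup>+Y. (\<integral>\<^sup>+X. f (transpose (fst (X, Y)) ** snd (X, Y)) \<partial>\<mu>) \<partial>\<mu>)"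
      by (rule Fubini'[symmetric]) measurable
    also have "\<dots> = (\<integral>\<^sup>+Y. (\<integral>\<^sup>+X. f (transpose (transpose Y ** X)) \<partial>\<mu>) \<partial>\<mu>)"
      by (simp add: matrix_transpose_mul)
    also have "\<dots> = (\<integral>\<^sup>+Y. (\<integral>\<^sup>+X. f (transpose X) \<partial>\<mu>) \<partial>\<mu>)"
      by (intro nn_integral_cong left[of "\<lambda>X. f (transpose X)"]) (auto simp: sp)
    also have "\<dots> = (\<integral>\<^sup>+X. f (transpose X) \<partial>\<mu>)"
      using emeasure_space_1 by simp
    finally show ?thesis .
  qed
  show ?thesis
  proof (rule measure_eqI)
    fix A assume "A \<in> sets (distr \<mu> \<mu> (\<lambda>A. A ** S))"
    then have [measurable]: "A \<in> sets \<mu>" by simp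
    note [measurable] = m_r[OF S]
    define f :: "real^'d^'d \<Rightarrow> ennreal" where "f = indicator A"
    have [measurable]: "f \<in> borel_measurable \<mu>"
      by (simp add: f_def)
    have "emeasure (distr \<mu> \<mu> (\<lambda>A. A ** S)) A = (\<integral>\<^sup>+X. f (X ** S) \<partial>\<mu>)"
      unfolding f_def by (subst nn_integral_indicator[symmetric], simp, subst nn_integral_distr) (simp_all add: S)
    also have "\<dots> = (\<integral>\<^sup>+X. f (transpose (transpose S ** X)) \<partial>\<mu>)"
      using S by (subst inv) (simp_all add: matrix_transpose_mul)
    also have "\<dots> = (\<integral>\<^sup>+X. f (transpose X) \<partial>\<mu>)"
      by (rule left[of "\<lambda>X. f (transpose X)"]) (auto simp: S)
    also have "\<dots> = emeasure \<mu> A"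
      by (simp add: inv[symmetric] f_def)
    finally show "emeasure (distr \<mu> \<mu> (\<lambda>A. A ** S)) A = emeasure \<mu> A" .
  qed simp
qed

definition turn :: "'i::finite \<Rightarrow> real^'d^'d \<Rightarrow> real^'d^'d^'i \<Rightarrow> real^'d^'d^'i" where
  "turn i S q = (\<chi> j. if j = i then q $ j ** S else q $ j)"

lemma continuous_on_turn:
  fixes i :: "'i::finite" and S :: "real^'d^'d"
  shows "continuous_on UNIV (turn i S)"
proof -
  have "continuous_on UNIV (\<lambda>q::real^'d^'d^'i. if j = i then q $ j ** S else q $ j)" for j :: 'i
    by (cases "j = i") (auto intro!: continuous_on_matrix_mult continuous_intros)
  then show ?thesis
    unfolding turn_def[abs_def] by (intro continuous_on_vec_lambda)
qed

lemma turn_measurable [measurable]: "turn i S \<in> measurable borel borel"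
  by (rule borel_measurable_continuous_onI[OF continuous_on_turn])

text \<open>The only property of the joint law of the rotations that the rest of the proof uses.  It is stated for Borel
  measures on all families of matrices, a Euclidean space, so that the topological arguments apply.\<close>

locale rotation_invariant = prob_space QQ
  for QQ :: "(real^'d^'d^'i::finite) measure" +
  assumes sets_QQ [simp, measurable_cong]: "sets QQ = sets borel"
    and AE_orthogonal: "AE q in QQ. \<forall>i. orthogonal_matrix (q $ i)"
    and turn_invariant: "\<And>i S. orthogonal_matrix S \<Longrightarrow> distr QQ borel (turn i S) = QQ"

text \<open>The joint law is a product of Haar measures, and multiplying one coordinate on the right preserves its factor.\<close>

lemma rotation_invariant_joint_law:
  fixes M :: "'w measure" and Q :: "'i::finite \<Rightarrow> 'w \<Rightarrow> real^'d^'d"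
  assumes M: "prob_space M"
    and indep: "prob_space.indep_vars M (\<lambda>_. orthogonal_group) Q UNIV"
    and haar: "\<And>i. normalized_haar (distr M orthogonal_group (Q i))"
  shows "rotation_invariant (distr M borel (\<lambda>\<omega>. \<chi> i. Q i \<omega>))"
    and "(\<lambda>\<omega>. \<chi> i. Q i \<omega>) \<in> measurable M borel"
    and "\<omega> \<in> space M \<Longrightarrow> orthogonal_matrix (Q i \<omega>)"
proof -
  interpret prob_space M by fact
  have Q[measurable]: "Q i \<in> measurable M orthogonal_group" for i
    using indep by (simp add: indep_vars_def)
  show orth: "orthogonal_matrix (Q i \<omega>)" if "\<omega> \<in> space M" for i \<omega>
    using measurable_space[OF Q that] by (simp add: orthogonal_group_def space_restrict_space)
  have id: "(\<lambda>x. x) \<in> measurable orthogonal_group borel"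
    by (simp add: orthogonal_group_def measurable_restrict_space1)
  define P where "P = (\<Pi>\<^sub>M i\<in>(UNIV::'i set). distr M orthogonal_group (Q i))"
  have setsP[measurable_cong]: "sets P = sets (\<Pi>\<^sub>M i\<in>(UNIV::'i set). orthogonal_group)"
    unfolding P_def by (intro sets_PiM_cong) auto
  have vec[measurable]: "(\<lambda>c. \<chi> i. c i) \<in> measurable P borel"
  proof -
    have "(\<lambda>c. c i) \<in> measurable (\<Pi>\<^sub>M i\<in>(UNIV::'i set). orthogonal_group) (borel :: (real^'d^'d) measure)" for i
      by (rule measurable_compose[OF _ id], rule measurable_component_singleton) simp
    then have "(\<lambda>c. c) \<in> measurable P (\<Pi>\<^sub>M i\<in>(UNIV::'i set). (borel :: (real^'d^'d) measure))"
      unfolding measurable_cong_sets[OF setsP refl]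
      by (intro measurable_PiM_single') auto
    from measurable_compose[OF this vec_lambda_measurable] show ?thesis .
  qed
  have Qm[measurable]: "(\<lambda>\<omega>. \<lambda>i\<in>UNIV. Q i \<omega>) \<in> measurable M (\<Pi>\<^sub>M i\<in>(UNIV::'i set). orthogonal_group)"
    by (rule measurable_restrict) (rule Q)
  have joint: "distr M (\<Pi>\<^sub>M i\<in>UNIV. orthogonal_group) (\<lambda>\<omega>. \<lambda>i\<in>UNIV. Q i \<omega>) = P"
    using indep indep_vars_iff_distr_eq_PiM[where I=UNIV and M'="\<lambda>_. orthogonal_group" and X=Q] by (simp add: P_def)
  show Qvec[measurable]: "(\<lambda>\<omega>. \<chi> i. Q i \<omega>) \<in> measurable M borel"
  proof -
    have "(\<lambda>c. \<chi> i. c i) \<in> measurable (\<Pi>\<^sub>M i\<in>(UNIV::'i set). orthogonal_group) (borel :: (real^'d^'d^'i) measure)"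
      using vec by (simp add: measurable_cong_sets[OF setsP refl])
    from measurable_compose[OF Qm this] show ?thesis by simp
  qed
  have law: "distr M borel (\<lambda>\<omega>. \<chi> i. Q i \<omega>) = distr P borel (\<lambda>c. \<chi> i. c i)"
    unfolding joint[symmetric] using vec Qm
    by (subst distr_distr) (auto simp: comp_def restrict_def measurable_cong_sets[OF setsP refl])
  show "rotation_invariant (distr M borel (\<lambda>\<omega>. \<chi> i. Q i \<omega>))"
  proof (rule rotation_invariant.intro[OF _ rotation_invariant_axioms.intro])
    show "prob_space (distr M borel (\<lambda>\<omega>. \<chi> i. Q i \<omega>))"
      by (rule prob_space_distr[OF Qvec])
    show "sets (distr M borel (\<lambda>\<omega>. \<chi> i. Q i \<omega>)) = sets borel"
      by simp
    have "closed {q::real^'d^'d^'i. transpose (q $ i) ** q $ i = mat 1}" for i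
      by (intro closed_Collect_eq continuous_on_matrix_mult continuous_on_transpose continuous_intros)
    then have "(\<Inter>i. {q::real^'d^'d^'i. transpose (q $ i) ** q $ i = mat 1}) \<in> sets borel"
      by (intro borel_closed closed_INT) auto
    moreover have "(\<Inter>i. {q::real^'d^'d^'i. transpose (q $ i) ** q $ i = mat 1}) = {q. \<forall>i. orthogonal_matrix (q $ i)}"
      by (auto simp: orthogonal_matrix)
    ultimately have [measurable]: "{q::real^'d^'d^'i. \<forall>i. orthogonal_matrix (q $ i)} \<in> sets borel"
      by simp
    show "AE q in distr M borel (\<lambda>\<omega>. \<chi> i. Q i \<omega>). \<forall>i. orthogonal_matrix (q $ i)"
      by (subst AE_distr_iff) (auto simp: orth)
    fix i :: 'i and S :: "real^'d^'d" assume S: "orthogonal_matrix S"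
    define h where "h = (\<lambda>c::'i \<Rightarrow> real^'d^'d. c(i := c i ** S))"
    have spOG: "space orthogonal_group = {P::real^'d^'d. orthogonal_matrix P}"
      by (simp add: orthogonal_group_def space_restrict_space)
    have mS[measurable]: "(\<lambda>A. A ** S) \<in> measurable orthogonal_group orthogonal_group"
    proof -
      have "(\<lambda>A. A ** S) \<in> measurable orthogonal_group borel"
        by (rule measurable_compose[OF id borel_measurable_continuous_onI])
           (intro continuous_on_matrix_mult continuous_intros)
      then show ?thesis
        using S by (auto simp: orthogonal_group_def measurable_restrict_space2_iff space_restrict_space orthogonal_matrix_mul)
    qed
    have comp: "(\<lambda>c. c j) \<in> measurable P orthogonal_group" for j
      unfolding measurable_cong_sets[OF setsP refl] by (rule measurable_component_singleton) simp
    have hm[measurable]: "h \<in> measurable P P"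
      unfolding measurable_cong_sets[OF refl setsP]
    proof (rule measurable_PiM_single')
      fix j :: 'i
      show "(\<lambda>c. h c j) \<in> measurable P orthogonal_group"
        using comp[of j] measurable_compose[OF comp[of i] mS] by (cases "j = i") (auto simp: h_def)
      show "h \<in> space P \<rightarrow> UNIV \<rightarrow>\<^sub>E space orthogonal_group"
        using S by (auto simp: h_def P_def space_PiM PiE_iff spOG orthogonal_matrix_mul)
    qed
    interpret PP: product_prob_space "\<lambda>j. distr M orthogonal_group (Q j)"
      by (rule product_prob_spaceI) (rule prob_space_distr[OF Q])
    interpret FP: finite_product_prob_space "\<lambda>j. distr M orthogonal_group (Q j)" UNIV
      by standard simp
    have "distr P P h = P"
      unfolding P_def
    proof (rule PP.PiM_eqI)
      fix A assume A: "\<And>j. j \<in> UNIV \<Longrightarrow> A j \<in> sets (distr M orthogonal_group (Q j))"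
      let ?A = "A(i := (\<lambda>X. X ** S) -` A i \<inter> space orthogonal_group)"
      have A': "?A j \<in> sets (distr M orthogonal_group (Q j))" for j
        using A[of j] A[of i] measurable_sets[OF mS] by (cases "j = i") auto
      have "h -` (Pi\<^sub>E UNIV A) \<inter> space P = Pi\<^sub>E UNIV ?A"
        using sets.sets_into_space[OF A]
        by (force simp: h_def P_def space_PiM PiE_iff spOG split: if_splits)
      then have "emeasure (distr P P h) (Pi\<^sub>E UNIV A) = emeasure P (Pi\<^sub>E UNIV ?A)"
        using A by (subst emeasure_distr) (auto simp: setsP intro!: sets_PiM_I_finite)
      also have "\<dots> = (\<Prod>j\<in>UNIV. emeasure (distr M orthogonal_group (Q j)) (?A j))"
        unfolding P_def using A' by (intro FP.measure_times) 
      also have "\<dots> = (\<Prod>j\<in>UNIV. emeasure (distr M orthogonal_group (Q j)) (A j))"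
      proof (intro prod.cong refl)
        fix j
        have "emeasure (distr M orthogonal_group (Q i)) (A i)
            = emeasure (distr (distr M orthogonal_group (Q i)) (distr M orthogonal_group (Q i)) (\<lambda>A. A ** S)) (A i)"
          by (simp only: haar_right_invariant[OF haar S])
        also have "\<dots> = emeasure (distr M orthogonal_group (Q i)) ((\<lambda>X. X ** S) -` A i \<inter> space orthogonal_group)"
          using A[of i] by (subst emeasure_distr) auto
        finally show "emeasure (distr M orthogonal_group (Q j)) (?A j) = emeasure (distr M orthogonal_group (Q j)) (A j)"
          by (cases "j = i") auto
      qed
      finally show "emeasure (distr (Pi\<^sub>M UNIV (\<lambda>j. distr M orthogonal_group (Q j))) (Pi\<^sub>M UNIV (\<lambda>j. distr M orthogonal_group (Q j))) h) (Pi\<^sub>E UNIV A)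
          = (\<Prod>j\<in>UNIV. emeasure (distr M orthogonal_group (Q j)) (A j))"
        by (simp add: P_def)
    qed simp_all
    have "distr (distr P borel (\<lambda>c. \<chi> j. c j)) borel (turn i S) = distr P borel (\<lambda>c. \<chi> j. h c j)"
      by (subst distr_distr[OF turn_measurable vec]) (intro arg_cong[where f="distr P borel"], auto simp: fun_eq_iff vec_eq_iff turn_def h_def)
    also have "\<dots> = distr (distr P P h) borel (\<lambda>c. \<chi> j. c j)"
      by (subst distr_distr[OF vec hm]) (simp add: comp_def)
    finally show "distr (distr M borel (\<lambda>\<omega>. \<chi> i. Q i \<omega>)) borel (turn i S) = distr M borel (\<lambda>\<omega>. \<chi> i. Q i \<omega>)"
      unfolding law \<open>distr P P h = P\<close> .
  qed
qed

section \<open>Transversality\<close>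

text \<open>With \<open>B i\<close> the inverse transpose of \<open>T i\<close>, this map sends the normal vectors of the
  product cone to those of the intersection of the cones \<open>T i (q i) (C i)\<close>.\<close>

definition assemble :: "('i::finite \<Rightarrow> real^'d^'d) \<Rightarrow> real^'d^'d^'i \<Rightarrow> real^'d^'i \<Rightarrow> real^'d" where
  "assemble B q z = (\<Sum>i\<in>UNIV. (B i ** q $ i) *v (z $ i))"

definition coassemble :: "('i::finite \<Rightarrow> real^'d^'d) \<Rightarrow> real^'d^'d^'i \<Rightarrow> real^'d \<Rightarrow> real^'d^'i" where
  "coassemble B q x = (\<chi> i. transpose (B i ** q $ i) *v x)"

lemma linear_assemble: "linear (assemble B q)"
  by (intro linearI)
     (simp_all add: assemble_def matrix_vector_right_distrib sum.distrib matrix_vector_mult_scaleR scaleR_sum_right)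

lemma assemble_adjoint:
  fixes B :: "'i::finite \<Rightarrow> real^'d^'d"
  shows "assemble B q z \<bullet> x = z \<bullet> coassemble B q x"
proof -
  have "(A *v y) \<bullet> x = y \<bullet> (transpose A *v x)" for A :: "real^'d^'d" and y
    by (metis dot_lmul_matrix inner_commute transpose_transpose vector_transpose_matrix)
  then show ?thesis
    by (simp add: assemble_def coassemble_def inner_sum_left inner_vec_def[of z])
qed

lemma assemble_axis: "assemble B q (axis i b) = (B i ** q $ i) *v b"
proof -
  have "(B j ** q $ j) *v (axis i b $ j) = (if j = i then (B i ** q $ i) *v b else 0)" for j
    by (auto simp: axis_def)
  then show ?thesis
    by (simp add: assemble_def)
qed

lemma continuous_on_assemble:
  assumes "continuous_on UNIV f" "continuous_on UNIV g"
  shows "continuous_on UNIV (\<lambda>x. assemble B (f x) (g x))"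
  unfolding assemble_def
  by (intro continuous_on_sum continuous_on_matrix_vector_mult continuous_on_matrix_mult
      continuous_on_component continuous_on_const assms)

lemma continuous_on_coassemble:
  assumes "continuous_on UNIV f" "continuous_on UNIV g"
  shows "continuous_on UNIV (\<lambda>x. coassemble B (f x) (g x))"
  unfolding coassemble_def
  by (intro continuous_on_vec_lambda continuous_on_matrix_vector_mult continuous_on_matrix_mult
      continuous_on_transpose continuous_on_component continuous_on_const assms)

lemma continuous_on_orth_proj:
  fixes f :: "'x::euclidean_space \<Rightarrow> 'a::euclidean_space"
  assumes "subspace L" "continuous_on S f"
  shows "continuous_on S (\<lambda>x. orth_proj L (f x))"
  using linear_continuous_on_compose[OF assms(2) orth_proj_linear[OF assms(1)]] .

lemma orthogonal_matrix_invertible: "orthogonal_matrix A \<Longrightarrow> invertible A"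
  unfolding orthogonal_matrix_def invertible_def by blast

lemma std_gauss_pair: "sets (borel \<Otimes>\<^sub>M std_gauss) = sets (borel :: ('a::euclidean_space \<times> 'b::euclidean_space) measure)"
  unfolding sets_pair_measure_cong[OF refl sets_std_gauss] borel_pair ..

text \<open>Given the other vectors, a rotated unit vector \<open>b\<close> is as likely to lie in a given subspace as
  any other unit vector orthogonal to the remaining vectors of its block, since a reflection
  exchanges the two.  Hence the probability equals its average over a Gaussian vector, and a proper
  subspace is a Gaussian null set.\<close>

lemma (in rotation_invariant) AE_independent_blocks:
  fixes B :: "'i \<Rightarrow> real^'d^'d" and Z :: "('i \<times> (real^'d)) set"
  assumes B: "\<And>i. invertible (B i)"
    and "finite Z"
    and "\<And>i b c. (i, b) \<in> Z \<Longrightarrow> (i, c) \<in> Z \<Longrightarrow> b \<bullet> c = (if b = c then 1 else 0)"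
    and "card Z \<le> CARD('d)"
  shows "AE q in QQ. inj_on (\<lambda>p. assemble B q (axis (fst p) (snd p))) Z
    \<and> independent ((\<lambda>p. assemble B q (axis (fst p) (snd p))) ` Z)"
  using assms(2-4)
proof (induction Z)
  case (insert p Z)
  obtain i b where p: "p = (i, b)"
    by force
  define F where "F q s = assemble B q (axis (fst s) (snd s))" for q :: "real^'d^'d^'i" and s :: "'i \<times> (real^'d)"
  define E where "E = {w. F (fst w) (i, snd w) \<in> span ((\<lambda>s. F (fst w) s) ` Z)}"
  have cF: "continuous_on UNIV (\<lambda>q. F q s)" for s
    unfolding F_def by (intro continuous_on_assemble continuous_intros)
  have "fsigma E"
  proof -
    have "continuous_on UNIV (\<lambda>w::(real^'d^'d^'i) \<times> (real^'d). (fst w, F (fst w) (i, snd w)))"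
      unfolding F_def assemble_axis fst_conv snd_conv
      by (intro continuous_on_Pair continuous_on_matrix_vector_mult continuous_on_matrix_mult
          continuous_on_component continuous_on_const continuous_on_fst continuous_on_snd continuous_on_id)
    from fsigma_Collect_comp[OF fsigma_span[OF \<open>finite Z\<close> cF] this] show ?thesis
      by (simp add: E_def)
  qed
  then have E[measurable]: "E \<in> sets borel"
    by (rule fsigma_borel)
  \<comment> \<open>The directions in which \<open>b\<close> can be turned without moving the vectors of its block.\<close>
  define V where "V = {v. \<forall>c\<in>section_at Z i. c \<bullet> v = 0}"
  have V_flat: "V = flat (section_at Z i) (\<lambda>c. c)"
    by (simp add: V_def flat_def)
  have V: "subspace V"
    unfolding V_flat by (rule subspace_flat)
  have b: "b \<in> V" "norm b = 1"
    using insert.prems(1)[of i b] insert.prems(1)[of i b b] insert.hyps(2)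
    by (auto simp: V_def section_at_def p norm_eq_1 inner_commute)
  have sec: "{q. (q, v) \<in> E} \<in> sets borel" for v
  proof -
    have "(\<lambda>q. (q, v)) \<in> measurable borel borel"
      by (intro borel_measurable_continuous_onI continuous_intros)
    from measurable_sets_borel[OF this E] show ?thesis
      by (simp add: vimage_def)
  qed
  have unit: "emeasure QQ {q. (q, b) \<in> E} = emeasure QQ {q. (q, v) \<in> E}" if v: "v \<in> V" "norm v = 1" for v
  proof -
    define S where "S = reflection_matrix (b - v)"
    have Sb: "S *v b = v"
      using b v by (simp add: S_def reflection_swap)
    have Sc: "S *v c = c" if "(i, c) \<in> Z" for c
      unfolding S_def reflection_matrix_mult
      using that b v by (intro reflection_orthogonal) (simp add: V_def section_at_def inner_diff_right inner_commute[of _ c])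
    have turn_F: "F (turn i S q) s = F q (fst s, if fst s = i then S *v snd s else snd s)" for q s
      by (simp add: F_def assemble_axis turn_def matrix_mul_assoc matrix_vector_mul_assoc)
    have "(\<lambda>s. F (turn i S q) s) ` Z = (\<lambda>s. F q s) ` Z" for q
      using Sc by (intro image_cong refl) (auto simp: turn_F)
    then have "(turn i S q, b) \<in> E \<longleftrightarrow> (q, v) \<in> E" for q
      by (simp add: E_def turn_F Sb)
    then have "emeasure QQ {q. (q, v) \<in> E} = emeasure QQ (turn i S -` {q. (q, b) \<in> E})"
      by (simp add: vimage_def)
    also have "\<dots> = emeasure (distr QQ borel (turn i S)) {q. (q, b) \<in> E}"
      using sec[of b] sets_eq_imp_space_eq[OF sets_QQ] by (subst emeasure_distr) auto
    also have "\<dots> = emeasure QQ {q. (q, b) \<in> E}"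
      by (simp add: turn_invariant S_def reflection_matrix_orthogonal)
    finally show ?thesis ..
  qed
  have nonzero: "emeasure QQ {q. (q, b) \<in> E} = emeasure QQ {q. (q, v) \<in> E}" if v: "v \<in> V" "v \<noteq> 0" for v
  proof -
    have "F q (i, sgn v) \<in> span (F q ` Z) \<longleftrightarrow> F q (i, v) \<in> span (F q ` Z)" for q
    proof -
      have "F q (i, sgn v) = (1 / norm v) *\<^sub>R F q (i, v)"
        by (simp add: F_def assemble_axis sgn_div_norm matrix_vector_mult_scaleR divide_inverse)
      moreover from this have "F q (i, v) = norm v *\<^sub>R F q (i, sgn v)"
        using v by simp
      ultimately show ?thesis
        by (metis span_scale)
    qed
    then have "{q. (q, v) \<in> E} = {q. (q, sgn v) \<in> E}"
      by (auto simp: E_def)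
    moreover have "sgn v \<in> V" "norm (sgn v) = 1"
      using v V by (auto simp: sgn_div_norm subspace_scale)
    ultimately show ?thesis
      using unit by metis
  qed
  interpret G: prob_space "std_gauss :: (real^'d) measure" by (rule prob_std_gauss)
  interpret QG: pair_sigma_finite QQ "std_gauss :: (real^'d) measure" by unfold_locales
  have "orth_proj V b = b"
    using b V by (intro orth_proj_eqI) (auto simp: orthogonal_comp_def orthogonal_def)
  then have ae: "AE g in std_gauss. orth_proj V g \<notin> {0}"
    using b by (intro AE_std_gauss_linear_notin orth_proj_linear V subspace_single_0 exI[of _ b]) auto
  define E' where "E' = {w. (fst w, orth_proj V (snd w)) \<in> E}"
  have E': "E' \<in> sets (QQ \<Otimes>\<^sub>M std_gauss)"
  proof -
    have "(\<lambda>w. (fst w, orth_proj V (snd w))) \<in> measurable borel (borel :: ((real^'d^'d^'i) \<times> (real^'d)) measure)"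
      by (intro borel_measurable_continuous_onI continuous_on_Pair continuous_on_orth_proj V
          continuous_on_fst continuous_on_snd continuous_on_id)
    from measurable_sets_borel[OF this E] show ?thesis
      unfolding sets_pair_measure_cong[OF sets_QQ refl] std_gauss_pair by (simp add: E'_def vimage_def)
  qed
  have "emeasure QQ {q. (q, b) \<in> E} = (\<integral>\<^sup>+g. emeasure QQ {q. (q, b) \<in> E} \<partial>(std_gauss :: (real^'d) measure))"
    using G.emeasure_space_1 by simp
  also have "\<dots> = (\<integral>\<^sup>+g. (\<integral>\<^sup>+q. indicator E' (q, g) \<partial>QQ) \<partial>std_gauss)"
  proof (rule nn_integral_cong_AE, use ae in eventually_elim)
    fix g assume g: "orth_proj V g \<notin> {0}"
    have "emeasure QQ {q. (q, b) \<in> E} = emeasure QQ {q. (q, orth_proj V g) \<in> E}"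
      using g by (intro nonzero orth_proj_in V) auto
    also have "\<dots> = (\<integral>\<^sup>+q. indicator {q. (q, orth_proj V g) \<in> E} q \<partial>QQ)"
      using sec by (intro nn_integral_indicator[symmetric]) simp
    also have "\<dots> = (\<integral>\<^sup>+q. indicator E' (q, g) \<partial>QQ)"
      by (intro nn_integral_cong) (simp add: E'_def indicator_def)
    finally show "emeasure QQ {q. (q, b) \<in> E} = (\<integral>\<^sup>+q. indicator E' (q, g) \<partial>QQ)" .
  qed
  also have "\<dots> = (\<integral>\<^sup>+q. (\<integral>\<^sup>+g. indicator E' (q, g) \<partial>std_gauss) \<partial>QQ)"
    by (rule QG.Fubini') (use E' in simp)
  also have "\<dots> = (\<integral>\<^sup>+q. 0 \<partial>QQ)"
  proof (rule nn_integral_cong_AE, use AE_orthogonal in eventually_elim)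
    fix q :: "real^'d^'d^'i" assume q: "\<forall>i. orthogonal_matrix (q $ i)"
    have inv: "invertible (B i ** q $ i)"
      using q by (intro invertible_mult[OF B] orthogonal_matrix_invertible) auto
    \<comment> \<open>Otherwise the span would contain the images of \<open>V\<close> and of its orthogonal complement, but it is too small.\<close>
    have "\<exists>v. F q (i, orth_proj V v) \<notin> span (F q ` Z)"
    proof (rule ccontr)
      assume "\<not> ?thesis"
      then have in_span: "F q (i, orth_proj V v) \<in> span (F q ` Z)" for v by auto
      have "F q (i, x) \<in> span (F q ` Z)" for x
      proof -
        have "x - orth_proj V x \<in> span (section_at Z i)"
          using orth_proj_in(2)[OF V, of x] flat_orthogonal_comp[of "section_at Z i" "\<lambda>c. c"] by (simp add: V_flat)
        then have "F q (i, x - orth_proj V x) \<in> (\<lambda>c. F q (i, c)) ` span (section_at Z i)"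
          by simp
        also have "\<dots> = span ((\<lambda>c. F q (i, c)) ` section_at Z i)"
          by (rule linear_span_image[symmetric]) (simp add: F_def assemble_axis)
        also have "\<dots> \<subseteq> span (F q ` Z)"
          by (intro span_mono) (auto simp: section_at_def)
        finally have "F q (i, orth_proj V x) + F q (i, x - orth_proj V x) \<in> span (F q ` Z)"
          using in_span by (intro span_add) auto
        then show ?thesis
          by (simp add: F_def assemble_axis matrix_vector_mult_diff_distrib)
      qed
      moreover have "surj ((*v) (B i ** q $ i))"
        using inv by (simp add: invertible_eq_bij bij_is_surj)
      moreover have "F q (i, x) = (B i ** q $ i) *v x" for x
        by (simp add: F_def assemble_axis)
      ultimately have "y \<in> span (F q ` Z)" for y
        using surjD[of "(*v) (B i ** q $ i)" y] by auto
      then have "span (F q ` Z) = UNIV"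
        by blast
      then have "CARD('d) \<le> card (F q ` Z)"
        using dim_le_card'[of "F q ` Z"] insert.hyps(1) dim_span[of "F q ` Z"] by simp
      then show False
        using card_image_le[OF insert.hyps(1), of "F q"] insert.prems(2) insert.hyps by simp
    qed
    then have "AE g in std_gauss. F q (i, orth_proj V g) \<notin> span (F q ` Z)"
      using orth_proj_linear[OF V]
      by (intro AE_std_gauss_linear_notin subspace_span)
         (auto simp: F_def assemble_axis intro!: linear_compose[unfolded o_def, of "orth_proj V"])
    then have "AE g in std_gauss. indicator E' (q, g) = (0::ennreal)"
      by eventually_elim (simp add: E'_def E_def)
    then have "(\<integral>\<^sup>+g. indicator E' (q, g) \<partial>std_gauss) = (\<integral>\<^sup>+g. 0 \<partial>(std_gauss :: (real^'d) measure))"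
      by (rule nn_integral_cong_AE)
    then show "(\<integral>\<^sup>+g. indicator E' (q, g) \<partial>std_gauss) = 0"
      by simp
  qed
  finally have "emeasure QQ {q. (q, b) \<in> E} = 0"
    by simp
  then have "AE q in QQ. q \<notin> {q. (q, b) \<in> E}"
    using sec[of b] by (intro AE_not_in null_setsI) auto
  moreover have "AE q in QQ. inj_on (F q) Z \<and> independent (F q ` Z)"
    unfolding F_def using insert.prems(2) insert.hyps by (intro insert.IH insert.prems(1)) auto
  ultimately have "AE q in QQ. inj_on (F q) (insert p Z) \<and> independent (F q ` insert p Z)"
  proof eventually_elim
    fix q assume q: "q \<notin> {q. (q, b) \<in> E}" "inj_on (F q) Z \<and> independent (F q ` Z)"
    then have "F q p \<notin> span (F q ` Z)"
      by (simp add: E_def p)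
    then show "inj_on (F q) (insert p Z) \<and> independent (F q ` insert p Z)"
      using q(2) by (auto simp: independent_insert inj_on_insert intro: span_base)
  qed
  then show ?case
    unfolding F_def[abs_def] .
qed (simp add: independent_empty)

text \<open>Apply the independence of at most \<open>CARD('d)\<close> rotated vectors to an orthonormal basis of \<open>P\<close> adapted to the
  blocks, or to \<open>CARD('d)\<close> of its elements if there are more.\<close>

lemma (in rotation_invariant) AE_transversal:
  fixes B :: "'i \<Rightarrow> real^'d^'d" and a :: "'i \<Rightarrow> 'j \<Rightarrow> real^'d" and I :: "('i \<times> 'j) set"
  assumes B: "\<And>i. invertible (B i)"
  defines "P \<equiv> span (axis_family a ` I)"
  shows "AE q in QQ. dim (assemble B q ` P) = min CARD('d) (dim P)
    \<and> (dim P \<le> CARD('d) \<longrightarrow> inj_on (assemble B q) P)"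
proof -
  define V where "V i = span (a i ` section_at I i)" for i
  have "\<forall>i. \<exists>b. orthonormal_basis_of b (V i)"
    unfolding V_def using onb_exists[OF subspace_span] by blast
  then obtain b where b: "\<And>i. orthonormal_basis_of (b i) (V i)"
    by metis
  define Z where "Z = Sigma UNIV b"
  define h where "h = (\<lambda>p. axis (fst p) (snd p) :: real^'d^'i)"
  have "P = {x. \<forall>i. x $ i \<in> V i}"
    by (simp add: P_def V_def span_axis_family)
  then have onb: "orthonormal_basis_of (h ` Z) P" and inj: "inj_on h Z"
    using product_onb[OF b] by (simp_all add: h_def Z_def)
  note hZ = onb_finite[OF onb]
  have fin: "finite Z"
    using hZ(1) inj finite_imageD by blast
  have card: "card Z = dim P"
    using hZ(3) card_image[OF inj] by simp
  have orth: "c \<bullet> c' = (if c = c' then 1 else 0)" if "(i, c) \<in> Z" "(i, c') \<in> Z" for i c c'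
    using that onb_inner[OF b] by (auto simp: Z_def)
  show ?thesis
  proof (cases "dim P \<le> CARD('d)")
    case True
    then have "AE q in QQ. inj_on (\<lambda>p. assemble B q (h p)) Z \<and> independent ((\<lambda>p. assemble B q (h p)) ` Z)"
      unfolding h_def by (intro AE_independent_blocks B fin orth) (auto simp: card)
    then show ?thesis
    proof eventually_elim
      fix q assume q: "inj_on (\<lambda>p. assemble B q (h p)) Z \<and> independent ((\<lambda>p. assemble B q (h p)) ` Z)"
      then have "inj_on (assemble B q) (h ` Z)" "independent (assemble B q ` h ` Z)"
        by (auto simp: inj_on_def image_image)
      then have "inj_on (assemble B q) P"
        using linear_inj_on_span_independent_image[OF linear_assemble] hZ(4) by metis
      moreover have "dim (assemble B q ` P) = dim P"
      proof (rule dim_image_eq[OF linear_assemble])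
        show "inj_on (assemble B q) (span P)"
          using \<open>inj_on (assemble B q) P\<close> by (simp add: P_def span_span)
      qed
      ultimately show "dim (assemble B q ` P) = min CARD('d) (dim P) \<and> (dim P \<le> CARD('d) \<longrightarrow> inj_on (assemble B q) P)"
        using True by simp
    qed
  next
    case False
    then obtain Z' where Z': "Z' \<subseteq> Z" "card Z' = CARD('d)" "finite Z'"
      using obtain_subset_with_card_n[of "CARD('d)" Z] card by (metis nat_le_linear)
    have "AE q in QQ. inj_on (\<lambda>p. assemble B q (h p)) Z' \<and> independent ((\<lambda>p. assemble B q (h p)) ` Z')"
      unfolding h_def using Z' by (intro AE_independent_blocks B orth) auto
    then show ?thesis
    proof eventually_elim
      fix q assume q: "inj_on (\<lambda>p. assemble B q (h p)) Z' \<and> independent ((\<lambda>p. assemble B q (h p)) ` Z')"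
      then have "CARD('d) = dim ((\<lambda>p. assemble B q (h p)) ` Z')"
        using Z' by (simp add: dim_eq_card_independent card_image)
      also have "\<dots> \<le> dim (assemble B q ` P)"
        using Z' hZ(4) by (intro dim_subset) (auto intro!: imageI intro: span_base)
      finally have "dim (assemble B q ` P) = CARD('d)"
        using dim_subset_UNIV[of "assemble B q ` P"] by simp
      then show "dim (assemble B q ` P) = min CARD('d) (dim P) \<and> (dim P \<le> CARD('d) \<longrightarrow> inj_on (assemble B q) P)"
        using False by simp
    qed
  qed
qed

section \<open>The decomposition of a vector along an intersection\<close>

definition rotated_family :: "('i::finite \<Rightarrow> real^'d^'d) \<Rightarrow> ('i \<Rightarrow> 'j \<Rightarrow> real^'d) \<Rightarrow> real^'d^'d^'i \<Rightarrow> 'i \<times> 'j \<Rightarrow> real^'d" where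
  "rotated_family B a q s = assemble B q (axis_family a s)"

lemma continuous_on_rotated_family: "continuous_on UNIV (\<lambda>q. rotated_family B a q s)"
  unfolding rotated_family_def by (intro continuous_on_assemble continuous_intros)

lemma rotated_family_image: "rotated_family B a q ` I = assemble B q ` (axis_family a ` I)"
  by (auto simp: rotated_family_def)

lemma span_rotated_family: "span (rotated_family B a q ` I) = assemble B q ` span (axis_family a ` I)"
  by (simp add: rotated_family_image linear_span_image[OF linear_assemble])

lemma cone_hull_rotated_family:
  "convex_cone hull (rotated_family B a q ` I) = assemble B q ` (convex_cone hull (axis_family a ` I))"
  by (simp add: rotated_family_image convex_cone_hull_linear_image[OF linear_assemble])

lemma inner_rotated_family: "rotated_family B a q s \<bullet> x = axis_family a s \<bullet> coassemble B q x"
  by (simp add: rotated_family_def assemble_adjoint)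

lemma flat_rotated_family: "x \<in> flat I (rotated_family B a q) \<longleftrightarrow> coassemble B q x \<in> flat I (axis_family a)"
  by (simp add: flat_def inner_rotated_family)

lemma open_face_rotated_family:
  "x \<in> open_face S (rotated_family B a q) I \<longleftrightarrow> coassemble B q x \<in> open_face S (axis_family a) I"
  by (simp add: open_face_def inner_rotated_family)

text \<open>The coordinates \<open>z\<^sub>i\<close> of the normal component of \<open>g\<close>.  They are unique only if the map is injective on the
  product of the spans; elsewhere the value \<open>0\<close> keeps the function measurable.\<close>

definition normal_part :: "('i::finite \<Rightarrow> real^'d^'d) \<Rightarrow> ('i \<Rightarrow> 'j \<Rightarrow> real^'d) \<Rightarrow> ('i \<times> 'j) set \<Rightarrow> real^'d^'d^'i \<Rightarrow> real^'d \<Rightarrow> real^'d^'i" where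
  "normal_part B a I q g = (if inj_on (assemble B q) (span (axis_family a ` I))
     then THE z. z \<in> span (axis_family a ` I) \<and> g - assemble B q z \<in> flat I (rotated_family B a q)
     else 0)"

lemma normal_part_eqI:
  assumes inj: "inj_on (assemble B q) (span (axis_family a ` I))"
    and z: "z \<in> span (axis_family a ` I)" "g - assemble B q z \<in> flat I (rotated_family B a q)"
  shows "normal_part B a I q g = z"
  unfolding normal_part_def if_P[OF inj]
proof (rule the_equality)
  fix z' assume z': "z' \<in> span (axis_family a ` I) \<and> g - assemble B q z' \<in> flat I (rotated_family B a q)"
  have "(g - assemble B q z) - (g - assemble B q z') \<in> flat I (rotated_family B a q)"
    using z z' by (metis subspace_diff subspace_flat)
  moreover have "assemble B q z' - assemble B q z \<in> span (rotated_family B a q ` I)"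
    unfolding span_rotated_family using z z' by (metis imageI linear_assemble linear_diff span_diff)
  ultimately have "assemble B q z' - assemble B q z \<in> span (rotated_family B a q ` I) \<inter> (span (rotated_family B a q ` I))\<^sup>\<bottom>"
    by (simp add: flat_orthogonal)
  then have "assemble B q z' - assemble B q z = 0"
    unfolding orthogonal_Int_0[OF subspace_span] by blast
  then have "assemble B q z' = assemble B q z"
    by simp
  then show "z' = z"
    using inj z z' by (auto dest: inj_onD)
qed (use z in simp)

lemma normal_part_decomposition:
  assumes inj: "inj_on (assemble B q) (span (axis_family a ` I))"
  shows "normal_part B a I q g \<in> span (axis_family a ` I)"
    and "assemble B q (normal_part B a I q g) = orth_proj (span (rotated_family B a q ` I)) g"
    and "g - assemble B q (normal_part B a I q g) = orth_proj (flat I (rotated_family B a q)) g"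
proof -
  let ?W = "span (rotated_family B a q ` I)"
  have "orth_proj ?W g \<in> ?W"
    by (rule orth_proj_in[OF subspace_span])
  then obtain z where z: "z \<in> span (axis_family a ` I)" "orth_proj ?W g = assemble B q z"
    by (auto simp: span_rotated_family)
  have "g - assemble B q z \<in> flat I (rotated_family B a q)"
    using orth_proj_in(2)[OF subspace_span, of g "rotated_family B a q ` I"] z by (simp add: flat_orthogonal)
  then have eq: "normal_part B a I q g = z"
    using z by (intro normal_part_eqI inj)
  then show "normal_part B a I q g \<in> span (axis_family a ` I)"
    "assemble B q (normal_part B a I q g) = orth_proj ?W g"
    using z by auto
  then show "g - assemble B q (normal_part B a I q g) = orth_proj (flat I (rotated_family B a q)) g"
    by (simp add: flat_orthogonal orth_proj_compl)
qed

text \<open>Where the coordinates are unique, they lie in an open set \<open>U\<close> exactly if some coordinates in \<open>U\<close>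
  decompose \<open>g\<close>, which is a projection of a sigma-compact set.\<close>

lemma normal_part_measurable:
  fixes B :: "'i::finite \<Rightarrow> real^'d^'d"
  assumes I: "finite I"
  shows "(\<lambda>p. normal_part B a I (fst p) (snd p)) \<in> borel_measurable borel"
proof (rule borel_measurableI)
  fix U :: "(real^'d^'i) set" assume "open U"
  define P where "P = span (axis_family a ` I)"
  have cP: "closed P"
    by (simp add: P_def closed_subspace)
  define good where "good = {p::(real^'d^'d^'i) \<times> (real^'d). inj_on (assemble B (fst p)) P}"
  have "fsigma {p::(real^'d^'d^'i) \<times> (real^'d). \<exists>z. (z \<in> P \<and> assemble B (fst p) z = 0) \<and> z \<noteq> 0}"
  proof (intro fsigma_project fsigma_Collect_conj)
    have "closed {p::((real^'d^'d^'i) \<times> (real^'d)) \<times> (real^'d^'i). snd p \<in> P}"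
      using closed_vimage[OF cP, of snd] by (simp add: vimage_def continuous_on_snd)
    then show "fsigma {p::((real^'d^'d^'i) \<times> (real^'d)) \<times> (real^'d^'i). snd p \<in> P}"
      by (rule fsigma_closed)
    show "fsigma {p::((real^'d^'d^'i) \<times> (real^'d)) \<times> (real^'d^'i). assemble B (fst (fst p)) (snd p) = 0}"
      by (intro fsigma_closed closed_Collect_eq continuous_on_assemble continuous_intros)
    show "fsigma {p::((real^'d^'d^'i) \<times> (real^'d)) \<times> (real^'d^'i). snd p \<noteq> 0}"
      by (intro fsigma_open open_Collect_neq continuous_intros)
  qed
  moreover have "- good = {p. \<exists>z. (z \<in> P \<and> assemble B (fst p) z = 0) \<and> z \<noteq> 0}"
    unfolding good_def P_def linear_injective_on_subspace_0[OF linear_assemble subspace_span] by auto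
  ultimately have "- good \<in> sets borel"
    by (simp only: fsigma_borel)
  from borel_comp[OF this] have good: "good \<in> sets borel"
    by simp
  define D where "D = {p::(real^'d^'d^'i) \<times> (real^'d). \<exists>z. (z \<in> P \<and> z \<in> U) \<and>
    (\<forall>s\<in>I. rotated_family B a (fst p) s \<bullet> (snd p - assemble B (fst p) z) = 0)}"
  have "fsigma D"
    unfolding D_def
  proof (intro fsigma_project fsigma_Collect_conj fsigma_Collect_ball I)
    have "closed {p::((real^'d^'d^'i) \<times> (real^'d)) \<times> (real^'d^'i). snd p \<in> P}"
      using closed_vimage[OF cP, of snd] by (simp add: vimage_def continuous_on_snd)
    then show "fsigma {p::((real^'d^'d^'i) \<times> (real^'d)) \<times> (real^'d^'i). snd p \<in> P}"
      by (rule fsigma_closed)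
    have "open {p::((real^'d^'d^'i) \<times> (real^'d)) \<times> (real^'d^'i). snd p \<in> U}"
      using open_vimage[OF \<open>open U\<close>, of snd] by (simp add: vimage_def continuous_on_snd)
    then show "fsigma {p::((real^'d^'d^'i) \<times> (real^'d)) \<times> (real^'d^'i). snd p \<in> U}"
      by (rule fsigma_open)
    show "fsigma {p::((real^'d^'d^'i) \<times> (real^'d)) \<times> (real^'d^'i).
        rotated_family B a (fst (fst p)) s \<bullet> (snd (fst p) - assemble B (fst (fst p)) (snd p)) = 0}" for s
      unfolding rotated_family_def
      by (intro fsigma_closed closed_Collect_eq continuous_on_assemble continuous_intros)
  qed
  then have D: "D \<in> sets borel"
    by (rule fsigma_borel)
  have "(\<lambda>p. normal_part B a I (fst p) (snd p)) -` U \<inter> good = D \<inter> good"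
  proof (intro equalityI subsetI)
    fix p assume p: "p \<in> (\<lambda>p. normal_part B a I (fst p) (snd p)) -` U \<inter> good"
    then have inj: "inj_on (assemble B (fst p)) (span (axis_family a ` I))"
      by (simp add: good_def P_def)
    note nd = normal_part_decomposition[OF inj, of "snd p"]
    have "snd p - assemble B (fst p) (normal_part B a I (fst p) (snd p)) \<in> flat I (rotated_family B a (fst p))"
      unfolding nd(3) by (rule orth_proj_in[OF subspace_flat])
    then show "p \<in> D \<inter> good"
      using p nd(1) unfolding D_def P_def flat_def by auto
  next
    fix p assume p: "p \<in> D \<inter> good"
    then obtain z where z: "z \<in> P" "z \<in> U" "snd p - assemble B (fst p) z \<in> flat I (rotated_family B a (fst p))"
      unfolding D_def flat_def by auto
    then have "normal_part B a I (fst p) (snd p) = z"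
      using p by (intro normal_part_eqI) (auto simp: good_def P_def)
    then show "p \<in> (\<lambda>p. normal_part B a I (fst p) (snd p)) -` U \<inter> good"
      using z p by simp
  qed
  moreover have "(\<lambda>p. normal_part B a I (fst p) (snd p)) -` U \<inter> - good = (if 0 \<in> U then - good else {})"
    by (cases "0 \<in> U") (auto simp: good_def normal_part_def P_def split: if_splits)
  ultimately have "(\<lambda>p. normal_part B a I (fst p) (snd p)) -` U = D \<inter> good \<union> (if 0 \<in> U then - good else {})"
    by blast
  then show "(\<lambda>p. normal_part B a I (fst p) (snd p)) -` U \<inter> space borel \<in> sets borel"
    using D good by auto
qed

subsection \<open>Reflecting one block\<close>

definition reflect_block :: "'i::finite \<Rightarrow> 'a::euclidean_space \<Rightarrow> 'a^'i \<Rightarrow> 'a^'i" where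
  "reflect_block i c z = (\<chi> j. if j = i then reflection c (z $ j) else z $ j)"

lemma reflect_block_involution [simp]: "reflect_block i c (reflect_block i c z) = z"
  by (simp add: reflect_block_def vec_eq_iff)

text \<open>A reflection along a vector of a subspace or of its orthogonal complement preserves the subspace.\<close>

lemma reflect_block_in:
  assumes c: "c \<in> span (a i ` section_at I i) \<or> c \<in> flat (section_at I i) (a i)"
    and z: "z \<in> span (axis_family a ` I)"
  shows "reflect_block i c z \<in> span (axis_family a ` I)"
proof -
  have "reflection c (z $ i) \<in> span (a i ` section_at I i)"
  proof (cases "c \<in> span (a i ` section_at I i)")
    case True
    then show ?thesis
      using z by (intro reflection_in) (auto simp: span_axis_family)
  next
    case False
    then have "z $ i \<bullet> c = 0"
      using c z unfolding flat_orthogonal span_axis_family by (auto simp: orthogonal_comp_def orthogonal_def)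
    then show ?thesis
      using z by (simp add: reflection_orthogonal inner_commute span_axis_family)
  qed
  then show ?thesis
    using z by (auto simp: span_axis_family reflect_block_def)
qed

lemma assemble_turn:
  "assemble B (turn i (reflection_matrix c) q) z = assemble B q (reflect_block i c z)"
  unfolding assemble_def
  by (intro sum.cong) (auto simp: turn_def reflect_block_def matrix_mul_assoc simp flip: matrix_vector_mul_assoc)

lemma coassemble_turn:
  "coassemble B (turn i (reflection_matrix c) q) x = reflect_block i c (coassemble B q x)"
proof -
  have "transpose (A ** reflection_matrix c) *v x = reflection c (transpose A *v x)" for A
    by (simp only: matrix_transpose_mul reflection_matrix_transpose matrix_vector_mul_assoc[symmetric]
        reflection_matrix_mult)
  then have "coassemble B (turn i (reflection_matrix c) q) x $ j = reflect_block i c (coassemble B q x) $ j" for j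
    by (cases "j = i") (simp_all only: coassemble_def turn_def reflect_block_def vec_lambda_beta matrix_mul_assoc simp_thms if_True if_False)
  then show ?thesis
    by (simp add: vec_eq_iff)
qed

text \<open>The turned map is the old one after a reflection that preserves the product of the spans, so neither
  the image nor the flat changes.\<close>

lemma normal_part_turn:
  assumes c: "c \<in> span (a i ` section_at I i) \<or> c \<in> flat (section_at I i) (a i)"
    and inj: "inj_on (assemble B q) (span (axis_family a ` I))"
  defines "q' \<equiv> turn i (reflection_matrix c) q"
  shows "normal_part B a I q' g = reflect_block i c (normal_part B a I q g)"
    and "assemble B q' (normal_part B a I q' g) = assemble B q (normal_part B a I q g)"
proof -
  let ?P = "span (axis_family a ` I)"
  have P: "reflect_block i c z \<in> ?P" if "z \<in> ?P" for z
    using c that by (rule reflect_block_in)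
  note nd = normal_part_decomposition[OF inj, of g]
  have inj': "inj_on (assemble B q') ?P"
    unfolding q'_def assemble_turn
  proof (rule inj_onI)
    fix x y assume xy: "x \<in> ?P" "y \<in> ?P" "assemble B q (reflect_block i c x) = assemble B q (reflect_block i c y)"
    then have "reflect_block i c x = reflect_block i c y"
      using P by (intro inj_onD[OF inj]) auto
    then show "x = y"
      by (metis reflect_block_involution)
  qed
  have "assemble B q' ` ?P = assemble B q ` ?P"
    unfolding q'_def assemble_turn
  proof (intro equalityI subsetI)
    fix x assume "x \<in> assemble B q ` ?P"
    then obtain y where "y \<in> ?P" "x = assemble B q (reflect_block i c (reflect_block i c y))"
      by auto
    then show "x \<in> (\<lambda>z. assemble B q (reflect_block i c z)) ` ?P"
      using P by blast
  qed (use P in auto)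
  then have flat_eq: "flat I (rotated_family B a q') = flat I (rotated_family B a q)"
    by (simp add: flat_orthogonal span_rotated_family)
  show eq: "normal_part B a I q' g = reflect_block i c (normal_part B a I q g)"
  proof (rule normal_part_eqI[OF inj'])
    show "reflect_block i c (normal_part B a I q g) \<in> ?P"
      using P nd(1) by auto
    show "g - assemble B q' (reflect_block i c (normal_part B a I q g)) \<in> flat I (rotated_family B a q')"
      unfolding flat_eq using nd(3) orth_proj_in(1)[OF subspace_flat, of I "rotated_family B a q" g]
      by (simp add: q'_def assemble_turn)
  qed
  show "assemble B q' (normal_part B a I q' g) = assemble B q (normal_part B a I q g)"
    unfolding eq by (simp add: q'_def assemble_turn)
qed

section \<open>Invariant random directions\<close>

lemma sgn_measurable [measurable]: "sgn \<in> borel_measurable (borel :: 'a::euclidean_space measure)"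
  unfolding sgn_div_norm by measurable

lemma sgn_reflection: "sgn (reflection c v) = reflection c (sgn v)"
  using orthogonal_transformation_norm[OF orthogonal_transformation_reflection, of c v]
  by (simp add: sgn_div_norm linear_cmul[OF linear_reflection])

text \<open>The reflection that exchanges \<open>x\<close> and \<open>y\<close> exchanges the balls around them.\<close>

lemma emeasure_ball_reflection:
  fixes u :: "'s \<Rightarrow> 'a::euclidean_space"
  assumes u[measurable]: "u \<in> borel_measurable R" and A[measurable]: "A \<in> sets R"
    and \<tau>[measurable]: "\<tau> \<in> measurable R R" and inv: "distr R R \<tau> = R"
    and ae: "AE s in R. u (\<tau> s) = reflection (x - y) (u s) \<and> (\<tau> s \<in> A \<longleftrightarrow> s \<in> A)"
    and n: "norm x = norm y"
  shows "emeasure R {s\<in>space R. s \<in> A \<and> sgn (u s) \<in> ball y e} = emeasure R {s\<in>space R. s \<in> A \<and> sgn (u s) \<in> ball x e}"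
proof -
  have refl: "reflection (x - y) w \<in> ball y e \<longleftrightarrow> w \<in> ball x e" for w
  proof -
    have "y - reflection (x - y) w = reflection (x - y) (x - w)"
      by (simp add: linear_diff[OF linear_reflection] reflection_swap[OF n])
    then have "dist y (reflection (x - y) w) = dist x w"
      using orthogonal_transformation_norm[OF orthogonal_transformation_reflection] by (simp add: dist_norm)
    then show ?thesis by simp
  qed
  have "emeasure R {s\<in>space R. s \<in> A \<and> sgn (u s) \<in> ball y e}
      = emeasure (distr R R \<tau>) {s\<in>space R. s \<in> A \<and> sgn (u s) \<in> ball y e}"
    by (simp add: inv)
  also have "\<dots> = emeasure R {s\<in>space R. \<tau> s \<in> A \<and> sgn (u (\<tau> s)) \<in> ball y e}"
    using measurable_space[OF \<tau>] by (subst emeasure_distr) (auto intro!: arg_cong[where f="emeasure R"])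
  also have "\<dots> = emeasure R {s\<in>space R. s \<in> A \<and> sgn (u s) \<in> ball x e}"
  proof (rule emeasure_eq_AE)
    have [measurable]: "ball z e \<in> sets borel" for z :: 'a by auto
    show "{s\<in>space R. \<tau> s \<in> A \<and> sgn (u (\<tau> s)) \<in> ball y e} \<in> sets R"
      "{s\<in>space R. s \<in> A \<and> sgn (u s) \<in> ball x e} \<in> sets R"
      by measurable
    show "AE s in R. s \<in> {s\<in>space R. \<tau> s \<in> A \<and> sgn (u (\<tau> s)) \<in> ball y e}
        \<longleftrightarrow> s \<in> {s\<in>space R. s \<in> A \<and> sgn (u s) \<in> ball x e}"
      using ae by eventually_elim (simp add: sgn_reflection refl del: mem_ball)
  qed
  finally show ?thesis .
qed

text \<open>The direction of a random vector of \<open>V\<close> whose law is invariant under the reflections of \<open>V\<close>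
  is uniformly distributed on the unit sphere, as is the direction of a Gaussian vector of \<open>V\<close>; so both have the
  same law, and they agree on cones.\<close>

lemma prob_cone_of_invariant_direction:
  fixes u :: "'s \<Rightarrow> 'a::euclidean_space"
  assumes R: "prob_space R" and u[measurable]: "u \<in> borel_measurable R" and A[measurable]: "A \<in> sets R"
    and V: "subspace V"
    and ae: "AE s in R. u s \<in> V \<and> (u s \<noteq> 0 \<or> V = {0})"
    and F[measurable]: "F \<in> sets borel" and cone: "\<And>x c. x \<in> F \<Longrightarrow> 0 < c \<Longrightarrow> c *\<^sub>R x \<in> F"
    and inv: "\<And>c. c \<in> V \<Longrightarrow> \<exists>\<tau>\<in>measurable R R. distr R R \<tau> = R \<and>
       (AE s in R. u (\<tau> s) = reflection c (u s) \<and> (\<tau> s \<in> A \<longleftrightarrow> s \<in> A))"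
  shows "measure R {s\<in>space R. s \<in> A \<and> u s \<in> F} = measure (gaussian_on V) F * measure R A"
proof (cases "V = {0} \<or> measure R A = 0")
  case True
  interpret prob_space R by fact
  show ?thesis
  proof (cases "measure R A = 0")
    case True
    have "measure R {s\<in>space R. s \<in> A \<and> u s \<in> F} \<le> measure R A"
      by (intro finite_measure_mono) auto
    then show ?thesis
      using True measure_nonneg[of R "{s\<in>space R. s \<in> A \<and> u s \<in> F}"] by simp
  next
    case False
    with True have V0: "V = {0}" by simp
    have "orth_proj V g = 0" for g
      using orth_proj_in(1)[OF V] V0 by auto
    then have g: "measure (gaussian_on V) F = (if 0 \<in> F then 1 else 0)"
      using prob_space.prob_space[OF prob_std_gauss[where 'a='a]] by (simp add: measure_gaussian_on[OF V F])
    have "measure R {s\<in>space R. s \<in> A \<and> u s \<in> F} = measure R (if 0 \<in> F then A else {})"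
      by (rule finite_measure_eq_AE) (use ae V0 sets.sets_into_space[OF A] in auto)
    then show ?thesis
      by (simp add: g)
  qed
next
  case False
  then have V0: "V \<noteq> {0}" and A0: "measure R A \<noteq> 0" by auto
  interpret prob_space R by fact
  interpret G: prob_space "std_gauss :: 'a measure" by (rule prob_std_gauss)
  have eA: "emeasure R A \<noteq> 0" "emeasure R A \<noteq> \<infinity>"
    using A0 by (auto simp: measure_def)
  \<comment> \<open>The law of the direction of \<open>u\<close>, conditioned on \<open>A\<close>.\<close>
  define U where "U = uniform_measure R A"
  interpret U: prob_space U
    unfolding U_def by (rule prob_space_uniform_measure[OF eA])
  have setsU[measurable_cong]: "sets U = sets R"
    by (simp add: U_def)
  have spU: "space U = space R"
    by (simp add: U_def)
  define \<mu> where "\<mu> = distr U borel (\<lambda>s. sgn (u s))"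
  define \<nu> where "\<nu> = distr std_gauss borel (\<lambda>g. sgn (orth_proj V g))"
  note [measurable] = orth_proj_measurable[OF V]
  have em\<mu>: "emeasure \<mu> X = emeasure R {s\<in>space R. s \<in> A \<and> sgn (u s) \<in> X} / emeasure R A"
    if X[measurable]: "X \<in> sets borel" for X
  proof -
    have "emeasure \<mu> X = emeasure U {s\<in>space R. sgn (u s) \<in> X}"
      unfolding \<mu>_def by (subst emeasure_distr) (auto simp: spU intro!: arg_cong[where f="emeasure U"])
    also have "\<dots> = emeasure R (A \<inter> {s\<in>space R. sgn (u s) \<in> X}) / emeasure R A"
      unfolding U_def by (rule emeasure_uniform_measure) auto
    also have "A \<inter> {s\<in>space R. sgn (u s) \<in> X} = {s\<in>space R. s \<in> A \<and> sgn (u s) \<in> X}"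
      by auto
    finally show ?thesis .
  qed
  have em\<nu>: "emeasure \<nu> X = emeasure std_gauss {g\<in>space std_gauss. g \<in> UNIV \<and> sgn (orth_proj V g) \<in> X}"
    if X[measurable]: "X \<in> sets borel" for X
    unfolding \<nu>_def by (subst emeasure_distr) (auto intro!: arg_cong[where f="emeasure std_gauss"])
  \<comment> \<open>\<open>V \<noteq> {0}\<close> makes the sphere non-empty; the Gaussian direction lies on it almost surely.\<close>
  define S where "S = sphere 0 1 \<inter> V"
  have S[measurable]: "S \<in> sets borel"
    unfolding S_def using closed_subspace[OF V] by (intro borel_closed closed_Int) auto
  have sgnS: "sgn v \<in> S" if "v \<in> V" "v \<noteq> 0" for v
    using that V by (auto simp: S_def sgn_div_norm subspace_scale)
  obtain v where v: "v \<in> V" "v \<noteq> 0"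
    using V0 subspace_0[OF V] by auto
  have "orth_proj V v = v"
    using v V by (intro orth_proj_eqI) (auto simp: orthogonal_comp_def orthogonal_def)
  then have aeG: "AE g in std_gauss. orth_proj V g \<notin> {0}"
    using v by (intro AE_std_gauss_linear_notin orth_proj_linear V subspace_single_0 exI[of _ v]) auto
  have eq: "\<mu> = \<nu>"
  proof (rule uniformly_distributed_unique[OF _ _ _ _ S])
    show "sets \<mu> = sets borel" "sets \<nu> = sets borel"
      by (simp_all add: \<mu>_def \<nu>_def)
    show "prob_space \<mu>"
      unfolding \<mu>_def by (rule U.prob_space_distr) measurable
    show "prob_space \<nu>"
      unfolding \<nu>_def by (rule G.prob_space_distr) measurable
    have "emeasure R {s\<in>space R. s \<in> A \<and> sgn (u s) \<in> - S} = emeasure R {}"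
      by (rule emeasure_eq_AE) (use ae V0 sgnS in auto)
    then show "emeasure \<mu> (- S) = 0"
      by (subst em\<mu>) auto
    have "emeasure std_gauss {g\<in>space std_gauss. g \<in> UNIV \<and> sgn (orth_proj V g) \<in> - S} = emeasure (std_gauss :: 'a measure) {}"
      by (rule emeasure_eq_AE) (use aeG sgnS orth_proj_in(1)[OF V] in auto)
    then show "emeasure \<nu> (- S) = 0"
      by (subst em\<nu>) auto
    fix e :: real and x y assume xy: "x \<in> S" "y \<in> S"
    then have n: "norm y = norm x" and c: "y - x \<in> V"
      using V by (auto simp: S_def subspace_diff)
    obtain \<tau> where \<tau>: "\<tau> \<in> measurable R R" "distr R R \<tau> = R"
      "AE s in R. u (\<tau> s) = reflection (y - x) (u s) \<and> (\<tau> s \<in> A \<longleftrightarrow> s \<in> A)"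
      using inv[OF c] by auto
    show "emeasure \<mu> (ball x e) = emeasure \<mu> (ball y e)"
      using emeasure_ball_reflection[OF u A \<tau> n] by (simp only: em\<mu> borel_open open_ball)
    have "emeasure std_gauss {g\<in>space std_gauss. g \<in> UNIV \<and> sgn (orth_proj V g) \<in> ball x e}
        = emeasure std_gauss {g\<in>space std_gauss. g \<in> UNIV \<and> sgn (orth_proj V g) \<in> ball y e}"
    proof (rule emeasure_ball_reflection[where \<tau>="reflection (y - x)", OF _ _ _ _ _ n])
      show "reflection (y - x) \<in> measurable std_gauss std_gauss"
        using linear_borel_measurable[OF linear_reflection, of "y - x"] by simp
      have "distr std_gauss std_gauss (reflection (y - x)) = distr std_gauss borel (reflection (y - x))"
        by (rule distr_cong) auto
      then show "distr std_gauss std_gauss (reflection (y - x)) = std_gauss"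
        by (simp add: std_gauss_orthogonal[OF orthogonal_transformation_reflection])
    qed (auto simp: orth_proj_reflection[OF V c])
    then show "emeasure \<nu> (ball x e) = emeasure \<nu> (ball y e)"
      by (simp only: em\<nu> borel_open open_ball)
  qed
  have sgnF: "sgn v \<in> F \<longleftrightarrow> v \<in> F" if "v \<noteq> 0" for v
  proof
    assume "sgn v \<in> F"
    then have "norm v *\<^sub>R sgn v \<in> F"
      using that by (intro cone) auto
    then show "v \<in> F"
      using that by (simp add: sgn_div_norm)
  next
    assume "v \<in> F"
    then have "inverse (norm v) *\<^sub>R v \<in> F"
      using that by (intro cone) auto
    then show "sgn v \<in> F"
      by (simp add: sgn_div_norm)
  qed
  have "emeasure R {s\<in>space R. s \<in> A \<and> u s \<in> F} = emeasure R {s\<in>space R. s \<in> A \<and> sgn (u s) \<in> F}"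
    by (rule emeasure_eq_AE) (use ae V0 sgnF in auto)
  also have "\<dots> = emeasure R A * (emeasure R {s\<in>space R. s \<in> A \<and> sgn (u s) \<in> F} / emeasure R A)"
    unfolding ennreal_times_divide mult.commute[of "emeasure R A"]
    using eA by (simp add: ennreal_mult_divide_eq)
  also have "\<dots> = emeasure R A * emeasure \<nu> F"
    by (simp only: em\<mu>[OF F, symmetric] eq)
  also have "emeasure \<nu> F = emeasure std_gauss {g. orth_proj V g \<in> F}"
    unfolding em\<nu>[OF F]
  proof (rule emeasure_eq_AE)
    show "{g\<in>space std_gauss. g \<in> UNIV \<and> sgn (orth_proj V g) \<in> F} \<in> sets std_gauss"
      by measurable
    have "{g\<in>space std_gauss. orth_proj V g \<in> F} \<in> sets std_gauss"
      by measurable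
    then show "{g. orth_proj V g \<in> F} \<in> sets std_gauss"
      by simp
  qed (use aeG sgnF in auto)
  finally show ?thesis
    unfolding measure_gaussian_on[OF V F] by (simp add: measure_def enn2real_mult mult.commute)
qed

text \<open>Reflecting one of several random vectors without moving the others makes that vector
  independent of the others as far as cones are concerned.\<close>

lemma prob_cones_of_invariant_directions:
  fixes u :: "'j \<Rightarrow> 's \<Rightarrow> 'a::euclidean_space"
  assumes R: "prob_space R" and J: "finite J"
    and u[measurable]: "\<And>j. j \<in> J \<Longrightarrow> u j \<in> borel_measurable R"
    and V: "\<And>j. j \<in> J \<Longrightarrow> subspace (V j)"
    and ae: "\<And>j. j \<in> J \<Longrightarrow> AE s in R. u j s \<in> V j \<and> (u j s \<noteq> 0 \<or> V j = {0})"
    and F[measurable]: "\<And>j. j \<in> J \<Longrightarrow> F j \<in> sets borel"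
    and cone: "\<And>j x c. j \<in> J \<Longrightarrow> x \<in> F j \<Longrightarrow> 0 < c \<Longrightarrow> c *\<^sub>R x \<in> F j"
    and inv: "\<And>j c. j \<in> J \<Longrightarrow> c \<in> V j \<Longrightarrow> \<exists>\<tau>\<in>measurable R R. distr R R \<tau> = R \<and>
       (AE s in R. u j (\<tau> s) = reflection c (u j s) \<and> (\<forall>l\<in>J - {j}. u l (\<tau> s) = u l s))"
  shows "measure R {s\<in>space R. \<forall>j\<in>J. u j s \<in> F j} = (\<Prod>j\<in>J. measure (gaussian_on (V j)) (F j))"
proof -
  interpret prob_space R by fact
  have "K \<subseteq> J \<Longrightarrow> measure R {s\<in>space R. \<forall>j\<in>K. u j s \<in> F j} = (\<Prod>j\<in>K. measure (gaussian_on (V j)) (F j))"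
    if "finite K" for K
    using that
  proof (induction K)
    case empty
    then show ?case by (simp add: prob_space)
  next
    case (insert j K)
    then have j: "j \<in> J" and K: "K \<subseteq> J" "finite K" "j \<notin> K" by auto
    define A where "A = {s\<in>space R. \<forall>l\<in>K. u l s \<in> F l}"
    have meas: "{s\<in>space R. u l s \<in> F l} \<in> sets R" if "l \<in> J" for l
      using u[OF that] F[OF that] by measurable
    have A: "A \<in> sets R"
    proof -
      have "A = (\<Inter>l\<in>K. {s\<in>space R. u l s \<in> F l}) \<inter> space R"
        by (auto simp: A_def)
      moreover have "(\<Inter>l\<in>K. {s\<in>space R. u l s \<in> F l}) \<inter> space R \<in> sets R"
        using K meas by (cases "K = {}") (auto intro!: sets.Int sets.finite_INT)
      ultimately show ?thesis by simp
    qed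
    have "{s\<in>space R. \<forall>l\<in>insert j K. u l s \<in> F l} = {s\<in>space R. s \<in> A \<and> u j s \<in> F j}"
      by (auto simp: A_def)
    moreover have "measure R {s\<in>space R. s \<in> A \<and> u j s \<in> F j} = measure (gaussian_on (V j)) (F j) * measure R A"
    proof (rule prob_cone_of_invariant_direction[OF R u[OF j] A V[OF j] ae[OF j] F[OF j] cone[OF j]])
      fix c assume "c \<in> V j"
      then obtain \<tau> where \<tau>: "\<tau> \<in> measurable R R" "distr R R \<tau> = R"
        "AE s in R. u j (\<tau> s) = reflection c (u j s) \<and> (\<forall>l\<in>J - {j}. u l (\<tau> s) = u l s)"
        using inv[OF j] by blast
      have "AE s in R. u j (\<tau> s) = reflection c (u j s) \<and> (\<tau> s \<in> A \<longleftrightarrow> s \<in> A)"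
        using \<tau>(3) AE_space
      proof eventually_elim
        fix s assume s: "u j (\<tau> s) = reflection c (u j s) \<and> (\<forall>l\<in>J - {j}. u l (\<tau> s) = u l s)" "s \<in> space R"
        then have "\<And>l. l \<in> K \<Longrightarrow> u l (\<tau> s) = u l s"
          using K by blast
        then show "u j (\<tau> s) = reflection c (u j s) \<and> (\<tau> s \<in> A \<longleftrightarrow> s \<in> A)"
          using s measurable_space[OF \<tau>(1)] by (auto simp: A_def)
      qed
      then show "\<exists>\<tau>\<in>measurable R R. distr R R \<tau> = R \<and> (AE s in R. u j (\<tau> s) = reflection c (u j s) \<and> (\<tau> s \<in> A \<longleftrightarrow> s \<in> A))"
        using \<tau> by blast
    qed
    ultimately show ?case
      using insert.IH K by (simp add: A_def)
  qed
  from this[OF J] show ?thesis by simp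
qed

section \<open>Expected weights\<close>

lemma AE_pair_of_AE:
  assumes "prob_space M1" "prob_space M2"
    and "{w\<in>space (M1 \<Otimes>\<^sub>M M2). P w} \<in> sets (M1 \<Otimes>\<^sub>M M2)"
    and "AE x in M1. AE y in M2. P (x, y)"
  shows "AE w in M1 \<Otimes>\<^sub>M M2. P w"
proof -
  interpret M1: prob_space M1 by fact
  interpret M2: prob_space M2 by fact
  interpret pair_sigma_finite M1 M2 by unfold_locales
  show ?thesis
    by (rule AE_pair_measure) (use assms in auto)
qed

lemma AE_fst:
  assumes "prob_space M1" "prob_space M2" "AE x in M1. P x"
  shows "AE w in M1 \<Otimes>\<^sub>M M2. P (fst w)"
proof -
  have "distr (M1 \<Otimes>\<^sub>M M2) M1 fst = M1"
    using prob_space.distr_pair_fst[OF assms(2)] .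
  then have "AE x in distr (M1 \<Otimes>\<^sub>M M2) M1 fst. P x"
    using assms(3) by (simp only:)
  then show ?thesis
    by (rule AE_distrD[OF measurable_fst])
qed

text \<open>The integrand is the probability that \<open>x\<close>, computed from a Gaussian vector, lies in the open face
  and that the normal component of an independent second Gaussian vector lies in the image of the product of
  the \<open>N\<^sub>i\<close>.  The vectors \<open>u (i, False) = u\<^sub>i\<close> and \<open>u (i, True) = z\<^sub>i\<close> translate this into one condition for each
  \<open>i\<close> and each of \<open>L\<^sub>i\<close> and \<open>V\<^sub>i\<close>, and reflections act on these vectors one at a time.\<close>

lemma (in rotation_invariant) expected_weight:
  fixes B :: "'i \<Rightarrow> real^'d^'d" and a :: "'i \<Rightarrow> 'j \<Rightarrow> real^'d" and I S :: "('i \<times> 'j) set"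
    and N :: "'i \<Rightarrow> (real^'d) set"
  assumes B: "\<And>i. invertible (B i)" and S: "finite S" "I \<subseteq> S"
    and dimk: "dim (span (axis_family a ` I)) < CARD('d)"
    and N: "\<And>i. N i \<subseteq> span (a i ` section_at I i)" "\<And>i. N i \<in> sets borel"
    and cone: "\<And>i x c. x \<in> N i \<Longrightarrow> 0 < c \<Longrightarrow> c *\<^sub>R x \<in> N i"
  shows "(\<integral>\<^sup>+q. emeasure std_gauss {g. orth_proj (flat I (rotated_family B a q)) g \<in> open_face S (rotated_family B a q) I}
        * emeasure std_gauss {g. orth_proj (span (rotated_family B a q ` I)) g \<in> assemble B q ` {z. \<forall>i. z $ i \<in> N i}} \<partial>QQ)
    = ennreal ((\<Prod>i\<in>UNIV. face_weight (section_at S i) (a i) (section_at I i))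
        * (\<Prod>i\<in>UNIV. measure (gaussian_on (span (a i ` section_at I i))) (N i)))"
proof -
  let ?G = "std_gauss :: (real^'d) measure"
  let ?P = "span (axis_family a ` I)"
  define GG where "GG = ?G \<Otimes>\<^sub>M ?G"
  define R where "R = QQ \<Otimes>\<^sub>M GG"
  interpret G: prob_space ?G by (rule prob_std_gauss)
  interpret Gp: pair_prob_space ?G ?G by unfold_locales
  interpret GG: prob_space GG unfolding GG_def by unfold_locales
  interpret Rp: pair_prob_space QQ GG by unfold_locales
  interpret R: prob_space R unfolding R_def by unfold_locales
  have pQ: "prob_space QQ" and pGG: "prob_space GG" by unfold_locales
  have setsGG[measurable_cong]: "sets GG = sets (borel \<Otimes>\<^sub>M borel)"
    unfolding GG_def by (intro sets_pair_measure_cong) auto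
  have setsR[measurable_cong]: "sets R = sets (borel \<Otimes>\<^sub>M (borel \<Otimes>\<^sub>M borel))"
    unfolding R_def by (intro sets_pair_measure_cong setsGG) auto
  have spR: "space R = UNIV" and spGG: "space GG = UNIV" and spQ: "space QQ = UNIV"
    using sets_eq_imp_space_eq[OF setsR] sets_eq_imp_space_eq[OF setsGG] sets_eq_imp_space_eq[OF sets_QQ]
    by (auto simp: space_pair_measure)
  have finI: "finite I"
    using S finite_subset by blast
  have finS: "finite (section_at S i)" for i
    using finite_vimageI[OF S(1), of "Pair i"] by (simp add: section_at_def vimage_def inj_on_def)
  have secIS: "section_at I i \<subseteq> section_at S i" for i
    using S(2) by (auto simp: section_at_def)
  \<comment> \<open>The normal components are unique, and the component in the flat can be non-zero.\<close>
  define good where "good q \<longleftrightarrow> (\<forall>i. orthogonal_matrix (q $ i)) \<and> inj_on (assemble B q) ?P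
    \<and> flat I (rotated_family B a q) \<noteq> {0}" for q :: "real^'d^'d^'i"
  have good: "AE q in QQ. good q"
    using AE_transversal[where B=B and a=a and I=I, OF B] AE_orthogonal
  proof eventually_elim
    fix q :: "real^'d^'d^'i"
    assume q: "dim (assemble B q ` ?P) = min CARD('d) (dim ?P) \<and> (dim ?P \<le> CARD('d) \<longrightarrow> inj_on (assemble B q) ?P)"
      "\<forall>i. orthogonal_matrix (q $ i)"
    then have "0 < dim (flat I (rotated_family B a q))"
      using dimk dim_flat[of I "rotated_family B a q"] unfolding span_rotated_family by simp
    then show "good q"
      using q dimk by (auto simp: good_def)
  qed
  define X where "X q g = g - assemble B q (normal_part B a I q g)" for q and g :: "real^'d"
  define u :: "'i \<times> bool \<Rightarrow> (real^'d^'d^'i) \<times> (real^'d) \<times> (real^'d) \<Rightarrow> real^'d" where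
    "u j w = (if snd j then normal_part B a I (fst w) (snd (snd w)) $ fst j
        else coassemble B (fst w) (X (fst w) (fst (snd w))) $ fst j)" for j w
  define V where "V j = (if snd j then span (a (fst j) ` section_at I (fst j))
        else flat (section_at I (fst j)) (a (fst j)))" for j :: "'i \<times> bool"
  define F where "F j = (if snd j then N (fst j)
        else open_face (section_at S (fst j)) (a (fst j)) (section_at I (fst j)))" for j :: "'i \<times> bool"
  have np[measurable]: "(\<lambda>w. normal_part B a I (f w) (g w)) \<in> borel_measurable L"
    if f: "f \<in> borel_measurable L" and g: "g \<in> borel_measurable L" for f g and L :: "'l measure"
    using measurable_compose[OF borel_measurable_Pair[OF f g] normal_part_measurable[OF finI, of B a]] by simp
  have as[measurable]: "(\<lambda>w. assemble B (f w) (g w)) \<in> borel_measurable L"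
    if f: "f \<in> borel_measurable L" and g: "g \<in> borel_measurable L" for f g and L :: "'l measure"
  proof -
    have "(\<lambda>p. assemble B (fst p) (snd p)) \<in> borel_measurable borel"
      by (intro borel_measurable_continuous_onI continuous_on_assemble continuous_intros)
    from measurable_compose[OF borel_measurable_Pair[OF f g] this] show ?thesis by simp
  qed
  have co[measurable]: "(\<lambda>w. coassemble B (f w) (g w)) \<in> borel_measurable L"
    if f: "f \<in> borel_measurable L" and g: "g \<in> borel_measurable L" for f g and L :: "'l measure"
  proof -
    have "(\<lambda>p. coassemble B (fst p) (snd p)) \<in> borel_measurable borel"
      by (intro borel_measurable_continuous_onI continuous_on_coassemble continuous_intros)
    from measurable_compose[OF borel_measurable_Pair[OF f g] this] show ?thesis by simp
  qed
  have nth: "(\<lambda>w. f w $ i) \<in> borel_measurable L" if "f \<in> borel_measurable L" for f :: "_ \<Rightarrow> real^'d^'i" and i and L :: "'l measure"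
    by (rule measurable_compose[OF that borel_measurable_continuous_onI]) (intro continuous_intros)
  have proj: "fst \<in> borel_measurable R" "(\<lambda>w. fst (snd w)) \<in> borel_measurable R" "(\<lambda>w. snd (snd w)) \<in> borel_measurable R"
    by measurable
  have u[measurable]: "u j \<in> borel_measurable R" for j
  proof (cases "snd j")
    case True
    have "(\<lambda>w. normal_part B a I (fst w) (snd (snd w)) $ fst j) \<in> borel_measurable R"
      by (intro nth np proj)
    then show ?thesis
      using True by (simp add: u_def[abs_def])
  next
    case False
    have "(\<lambda>w. coassemble B (fst w) (fst (snd w) - assemble B (fst w) (normal_part B a I (fst w) (fst (snd w)))) $ fst j) \<in> borel_measurable R"
      by (intro nth co borel_measurable_diff as np proj)
    then show ?thesis
      using False by (simp add: u_def[abs_def] X_def)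
  qed
  have V: "subspace (V j)" for j
    by (auto simp: V_def subspace_flat)
  have F: "F j \<in> sets borel" for j
    using N finS by (auto simp: F_def open_face_borel)
  have Fcone: "c *\<^sub>R x \<in> F j" if "x \<in> F j" "0 < c" for j x c
    using that cone by (auto simp: F_def open_face_def mult_pos_neg split: if_splits)
  have X_eq: "X q g = orth_proj (flat I (rotated_family B a q)) g" if "good q" for q g
    using that normal_part_decomposition(3)[of B q a I g] by (simp add: X_def good_def)
  have X_flat: "X q g \<in> flat I (rotated_family B a q)" if "good q" for q g
    unfolding X_eq[OF that] by (rule orth_proj_in[OF subspace_flat])
  have uV: "u j (q, g) \<in> V j" if "good q" for q g j
  proof (cases "snd j")
    case True
    have "normal_part B a I q (snd g) \<in> ?P"
      using that normal_part_decomposition(1)[of B q a I "snd g"] by (simp add: good_def)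
    then show ?thesis
      using True by (simp add: u_def V_def span_axis_family)
  next
    case False
    have "coassemble B q (X q (fst g)) \<in> flat I (axis_family a)"
      using X_flat[OF that] by (simp add: flat_rotated_family)
    then show ?thesis
      using False by (simp add: u_def V_def flat_axis_family)
  qed
  \<comment> \<open>Every vector that can be non-zero is a linear image of a Gaussian vector that vanishes only on a proper subspace.\<close>
  have u_ne: "AE g in GG. u j (q, g) \<noteq> 0 \<or> V j = {0}" if q: "good q" for q j
  proof (cases "snd j")
    case False
    let ?K = "flat I (rotated_family B a q)"
    obtain v where v: "v \<in> ?K" "v \<noteq> 0"
      using q subspace_0[OF subspace_flat, of I "rotated_family B a q"] by (auto simp: good_def)
    have "orth_proj ?K v = v"
      using v by (intro orth_proj_eqI subspace_flat) (auto simp: orthogonal_comp_def orthogonal_def)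
    then have ae: "AE g in ?G. orth_proj ?K g \<notin> {0}"
      using v by (intro AE_std_gauss_linear_notin orth_proj_linear subspace_flat subspace_single_0 exI[of _ v]) auto
    have inj: "transpose (B i ** q $ i) *v x = 0 \<Longrightarrow> x = 0" for i x
    proof -
      have "invertible (transpose (B i ** q $ i))"
        using q by (intro transpose_invertible invertible_mult[OF B] orthogonal_matrix_invertible) (auto simp: good_def)
      then show "transpose (B i ** q $ i) *v x = 0 \<Longrightarrow> x = 0"
        by (metis invertible_def matrix_left_invertible_ker)
    qed
    have "AE g in GG. orth_proj ?K (fst g) \<notin> {0}"
      unfolding GG_def by (rule AE_fst[OF _ _ ae]) unfold_locales
    then show ?thesis
      by eventually_elim (use False inj in \<open>auto simp: u_def X_eq[OF q] coassemble_def\<close>)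
  next
    case True
    let ?i = "fst j" and ?W = "span (rotated_family B a q ` I)"
    show ?thesis
    proof (cases "V j = {0}")
      case False
      then obtain v where v: "v \<in> V j" "v \<noteq> 0"
        using subspace_0[OF V, of j] by auto
      have inj: "inj_on (assemble B q) ?P"
        using q by (simp add: good_def)
      \<comment> \<open>The normal components with \<open>z\<^sub>i = 0\<close> form a proper subspace.\<close>
      define H where "H = assemble B q ` {z \<in> ?P. z $ ?i = 0}"
      have "subspace {z \<in> ?P. z $ ?i = 0}"
        by (auto simp: subspace_def span_zero span_add span_scale)
      then have H: "subspace H"
        unfolding H_def by (rule linear_subspace_image[OF linear_assemble])
      have axP: "axis ?i v \<in> ?P"
        using v True by (auto simp: span_axis_family axis_def V_def span_zero)
      have notH: "assemble B q (axis ?i v) \<notin> H"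
      proof
        assume "assemble B q (axis ?i v) \<in> H"
        then obtain z where z: "z \<in> ?P" "z $ ?i = 0" "assemble B q (axis ?i v) = assemble B q z"
          by (auto simp: H_def)
        then have "axis ?i v = z"
          using inj axP by (auto dest: inj_onD)
        then show False
          using z(2) v by (auto simp: axis_def)
      qed
      have "assemble B q (axis ?i v) \<in> ?W"
        using axP by (simp add: span_rotated_family)
      then have "orth_proj ?W (assemble B q (axis ?i v)) = assemble B q (axis ?i v)"
        by (intro orth_proj_eqI) (auto simp: orthogonal_comp_def orthogonal_def)
      then have ae: "AE g in ?G. orth_proj ?W g \<notin> H"
        using notH by (intro AE_std_gauss_linear_notin orth_proj_linear subspace_span H exI[of _ "assemble B q (axis ?i v)"]) auto
      have pred: "{w\<in>space GG. u j (q, w) \<noteq> 0} \<in> sets GG"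
      proof -
        have "(\<lambda>w. u j (q, w)) \<in> borel_measurable GG"
          by (rule measurable_compose[OF _ u[of j], of "\<lambda>w. (q, w)"])
             (simp add: R_def spQ)
        then show ?thesis by measurable
      qed
      have "AE g in ?G. AE g' in ?G. u j (q, (g, g')) \<noteq> 0"
      proof (rule AE_I2, use ae in eventually_elim)
        fix g g' assume g': "orth_proj ?W g' \<notin> H"
        note nd = normal_part_decomposition[OF inj, of g']
        have "normal_part B a I q g' $ ?i \<noteq> 0"
        proof
          assume "normal_part B a I q g' $ ?i = 0"
          then have "assemble B q (normal_part B a I q g') \<in> H"
            unfolding H_def using nd(1) by auto
          then show False
            using g' nd(2) by simp
        qed
        then show "u j (q, (g, g')) \<noteq> 0"
          using True by (simp add: u_def)
      qed
      then have "AE w in GG. u j (q, w) \<noteq> 0"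
        using pred unfolding GG_def by (intro AE_pair_of_AE prob_std_gauss) auto
      then show ?thesis
        by eventually_elim simp
    qed simp
  qed
  have main: "measure R {w\<in>space R. \<forall>j\<in>UNIV. u j w \<in> F j} = (\<Prod>j\<in>UNIV. measure (gaussian_on (V j)) (F j))"
  proof (rule prob_cones_of_invariant_directions[OF R.prob_space_axioms _ u V _ F Fcone])
    fix j :: "'i \<times> bool"
    have "{w\<in>space R. u j w \<in> V j \<and> (u j w \<noteq> 0 \<or> V j = {0})} \<in> sets R"
    proof -
      have [measurable]: "V j \<in> sets borel"
        using closed_subspace[OF V] by (rule borel_closed)
      show ?thesis
        by measurable
    qed
    moreover have "AE q in QQ. AE g in GG. u j (q, g) \<in> V j \<and> (u j (q, g) \<noteq> 0 \<or> V j = {0})"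
      using good
    proof eventually_elim
      fix q assume q: "good q"
      show "AE g in GG. u j (q, g) \<in> V j \<and> (u j (q, g) \<noteq> 0 \<or> V j = {0})"
        using u_ne[OF q, of j] by eventually_elim (use uV[OF q] in auto)
    qed
    ultimately show "AE w in R. u j w \<in> V j \<and> (u j w \<noteq> 0 \<or> V j = {0})"
      unfolding R_def by (intro AE_pair_of_AE pQ pGG)
  next
    fix j :: "'i \<times> bool" and c assume c: "c \<in> V j"
    let ?i = "fst j"
    define \<tau> where "\<tau> = (\<lambda>w. (turn ?i (reflection_matrix c) (fst w), snd w) :: (real^'d^'d^'i) \<times> (real^'d) \<times> (real^'d))"
    have c': "c \<in> span (a ?i ` section_at I ?i) \<or> c \<in> flat (section_at I ?i) (a ?i)"
      using c by (auto simp: V_def split: if_splits)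
    have turnm: "turn ?i (reflection_matrix c) \<in> measurable QQ QQ"
      using turn_measurable[of ?i "reflection_matrix c"] by (simp cong: measurable_cong_sets)
    have "\<tau> \<in> measurable R R"
      unfolding R_def \<tau>_def using turnm by measurable
    moreover have "distr R R \<tau> = R"
    proof -
      have "distr QQ QQ (turn ?i (reflection_matrix c)) = distr QQ borel (turn ?i (reflection_matrix c))"
        by (rule distr_cong) auto
      then have "distr QQ QQ (turn ?i (reflection_matrix c)) = QQ"
        by (simp add: turn_invariant reflection_matrix_orthogonal)
      moreover have "distr GG GG (\<lambda>x. x) = GG"
        by (rule distr_id)
      ultimately show ?thesis
        using pair_measure_distr[OF turnm measurable_ident_sets[OF refl, of GG]] GG.sigma_finite_measure_axioms
        by (simp add: R_def \<tau>_def split_def)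
    qed
    moreover have "AE w in R. u j (\<tau> w) = reflection c (u j w) \<and> (\<forall>l\<in>UNIV - {j}. u l (\<tau> w) = u l w)"
    proof -
      have "AE w in R. good (fst w)"
        unfolding R_def by (rule AE_fst[OF pQ pGG good])
      then show ?thesis
      proof eventually_elim
        fix w :: "(real^'d^'d^'i) \<times> (real^'d) \<times> (real^'d)" assume w: "good (fst w)"
        then have inj: "inj_on (assemble B (fst w)) ?P"
          by (simp add: good_def)
        have X_turn: "X (fst (\<tau> w)) g = X (fst w) g" for g
          using normal_part_turn(2)[OF c' inj, of g] by (simp add: X_def \<tau>_def)
        have u_turn: "u l (\<tau> w) = (if fst l = ?i then reflection c (u l w) else u l w)" for l
          using normal_part_turn(1)[OF c' inj] X_turn
          by (auto simp: u_def \<tau>_def coassemble_turn reflect_block_def)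
        \<comment> \<open>\<open>u\<^sub>i\<close> and \<open>z\<^sub>i\<close> lie in orthogonal spaces, so a reflection along a vector of one space fixes the other.\<close>
        have "reflection c (u l w) = u l w" if "fst l = ?i" "snd l \<noteq> snd j" for l
        proof -
          have "u l w \<in> V l"
            using uV[OF w, of l "snd w"] by simp
          then have "c \<bullet> u l w = 0"
            using c that unfolding V_def flat_orthogonal
            by (cases "snd j") (auto simp: orthogonal_comp_def orthogonal_def inner_commute)
          then show ?thesis
            by (rule reflection_orthogonal)
        qed
        then have "u l (\<tau> w) = u l w" if "l \<noteq> j" for l
          using that u_turn[of l] by (cases "fst l = ?i") (auto simp: prod_eq_iff)
        then show "u j (\<tau> w) = reflection c (u j w) \<and> (\<forall>l\<in>UNIV - {j}. u l (\<tau> w) = u l w)"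
          using u_turn[of j] by simp
      qed
    qed
    ultimately show "\<exists>\<tau>\<in>measurable R R. distr R R \<tau> = R \<and>
       (AE w in R. u j (\<tau> w) = reflection c (u j w) \<and> (\<forall>l\<in>UNIV - {j}. u l (\<tau> w) = u l w))"
      by blast
  qed simp_all
  \<comment> \<open>For fixed rotations the event is a rectangle, which gives the integrand.\<close>
  define \<Omega> where "\<Omega> = {w. \<forall>j. u j w \<in> F j}"
  have \<Omega>: "\<Omega> \<in> sets R"
  proof -
    have "\<Omega> = (\<Inter>j. {w\<in>space R. u j w \<in> F j})"
      by (auto simp: \<Omega>_def spR)
    moreover have "{w\<in>space R. u j w \<in> F j} \<in> sets R" for j
      using u[of j] F[of j] by measurable
    ultimately show ?thesis
      by (auto intro!: sets.finite_INT)
  qed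
  have "(\<integral>\<^sup>+q. emeasure ?G {g. orth_proj (flat I (rotated_family B a q)) g \<in> open_face S (rotated_family B a q) I}
        * emeasure ?G {g. orth_proj (span (rotated_family B a q ` I)) g \<in> assemble B q ` {z. \<forall>i. z $ i \<in> N i}} \<partial>QQ)
     = (\<integral>\<^sup>+q. emeasure GG (Pair q -` \<Omega>) \<partial>QQ)"
  proof (rule nn_integral_cong_AE, use good in eventually_elim)
    fix q assume q: "good q"
    then have inj: "inj_on (assemble B q) ?P"
      by (simp add: good_def)
    let ?A = "{g. orth_proj (flat I (rotated_family B a q)) g \<in> open_face S (rotated_family B a q) I}"
    let ?C = "{g. orth_proj (span (rotated_family B a q ` I)) g \<in> assemble B q ` {z. \<forall>i. z $ i \<in> N i}}"
    have A: "g \<in> ?A \<longleftrightarrow> (\<forall>i. u (i, False) (q, g, g') \<in> F (i, False))" for g g'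
      by (simp add: u_def F_def X_eq[OF q] open_face_rotated_family open_face_axis_family)
    have NP: "{z. \<forall>i. z $ i \<in> N i} \<subseteq> ?P"
      using N(1) by (auto simp: span_axis_family)
    have C: "g' \<in> ?C \<longleftrightarrow> (\<forall>i. u (i, True) (q, g, g') \<in> F (i, True))" for g g'
    proof -
      note nd = normal_part_decomposition[OF inj, of g']
      have "g' \<in> ?C \<longleftrightarrow> normal_part B a I q g' \<in> {z. \<forall>i. z $ i \<in> N i}"
        unfolding mem_Collect_eq nd(2)[symmetric] using inj_on_image_mem_iff[OF inj nd(1) NP] by simp
      then show ?thesis
        by (simp add: u_def F_def)
    qed
    \<comment> \<open>One Gaussian vector governs the component in the flat, the other one the normal components.\<close>
    have rect: "Pair q -` \<Omega> = ?A \<times> ?C"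
    proof (intro set_eqI, clarify)
      fix g g'
      have "(\<forall>j. u j (q, g, g') \<in> F j) \<longleftrightarrow> (\<forall>i. u (i, False) (q, g, g') \<in> F (i, False)) \<and> (\<forall>i. u (i, True) (q, g, g') \<in> F (i, True))"
        by (simp only: split_paired_All all_bool_eq) blast
      then show "(g, g') \<in> Pair q -` \<Omega> \<longleftrightarrow> (g, g') \<in> ?A \<times> ?C"
        unfolding A[of g g'] C[of g' g] mem_Times_iff fst_conv snd_conv by (simp add: \<Omega>_def)
    qed
    have "Pair q -` \<Omega> \<in> sets GG"
      using \<Omega> unfolding R_def by (rule sets_Pair1)
    have um: "(\<lambda>w. u j (q, w)) \<in> borel_measurable GG" for j
      by (rule measurable_compose[OF _ u[of j], of "\<lambda>w. (q, w)"]) (simp add: R_def spQ)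
    have Am: "?A \<in> sets ?G"
    proof -
      have "?A = (\<Inter>i. (\<lambda>g. u (i, False) (q, g, 0)) -` F (i, False) \<inter> space ?G)"
        using A[of _ 0] by auto
      moreover have m: "(\<lambda>g. u (i, False) (q, g, 0)) \<in> borel_measurable ?G" for i
        by (rule measurable_compose[OF _ um, of "\<lambda>g. (g, 0)"]) (simp add: GG_def)
      ultimately show ?thesis
        using measurable_sets[OF m F] by (simp only:) (intro sets.finite_INT; simp)
    qed
    have Cm: "?C \<in> sets ?G"
    proof -
      have "?C = (\<Inter>i. (\<lambda>g. u (i, True) (q, 0, g)) -` F (i, True) \<inter> space ?G)"
        using C[of _ 0] by auto
      moreover have m: "(\<lambda>g. u (i, True) (q, 0, g)) \<in> borel_measurable ?G" for i
        by (rule measurable_compose[OF _ um, of "\<lambda>g. (0, g)"]) (simp add: GG_def)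
      ultimately show ?thesis
        using measurable_sets[OF m F] by (simp only:) (intro sets.finite_INT; simp)
    qed
    show "emeasure ?G ?A * emeasure ?G ?C = emeasure GG (Pair q -` \<Omega>)"
      unfolding rect GG_def by (rule G.emeasure_pair_measure_Times[OF Am Cm, symmetric])
  qed
  also have "\<dots> = emeasure R \<Omega>"
    unfolding R_def by (rule GG.emeasure_pair_measure_alt[symmetric]) (use \<Omega> in \<open>simp only: R_def\<close>)
  also have "\<dots> = ennreal (\<Prod>j\<in>UNIV. measure (gaussian_on (V j)) (F j))"
    using main by (simp add: \<Omega>_def spR R.emeasure_eq_measure)
  also have "(\<Prod>j\<in>UNIV. measure (gaussian_on (V j)) (F j))
      = (\<Prod>i\<in>UNIV. \<Prod>b\<in>UNIV. measure (gaussian_on (V (i, b))) (F (i, b)))"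
    by (simp add: prod.cartesian_product flip: UNIV_Times_UNIV)
  also have "\<dots> = (\<Prod>i\<in>UNIV. face_weight (section_at S i) (a i) (section_at I i)) * (\<Prod>i\<in>UNIV. measure (gaussian_on (span (a i ` section_at I i))) (N i))"
    by (simp add: UNIV_bool V_def F_def face_weight_def prod.distrib mult.commute)
  finally show ?thesis .
qed

section \<open>The kinematic formulas\<close>

lemma face_weight_bounds: "0 \<le> face_weight S a I" "face_weight S a I \<le> 1"
  by (auto simp: face_weight_def gaussian_on_eq_proj subspace_flat intro!: prob_space.prob_le_1 prob_space.prob_space_distr prob_std_gauss orth_proj_measurable)

lemma normal_weight_bounds: "0 \<le> normal_weight a I" "normal_weight a I \<le> 1"
  by (auto simp: normal_weight_def gaussian_on_eq_proj intro!: prob_space.prob_le_1 prob_space.prob_space_distr prob_std_gauss orth_proj_measurable)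

lemma section_at_finite: "finite S \<Longrightarrow> finite (section_at S i)"
  using finite_vimageI[of S "Pair i"] by (simp add: section_at_def vimage_def inj_on_def)

text \<open>For the weights of faces alone the cones \<open>N\<^sub>i\<close> are the whole spans, which have probability \<open>1\<close>.\<close>

lemma (in rotation_invariant) expected_face_weights:
  fixes B :: "'i \<Rightarrow> real^'d^'d" and a :: "'i \<Rightarrow> 'j \<Rightarrow> real^'d" and I S :: "('i \<times> 'j) set"
  assumes B: "\<And>i. invertible (B i)" and S: "finite S" "I \<subseteq> S"
    and dimk: "dim (span (axis_family a ` I)) < CARD('d)"
  shows "(\<integral>q. face_weight S (rotated_family B a q) I \<partial>QQ) = face_weight S (axis_family a) I" (is ?f)
    and "(\<integral>q. face_weight S (rotated_family B a q) I * normal_weight (rotated_family B a q) I \<partial>QQ)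
      = face_weight S (axis_family a) I * normal_weight (axis_family a) I" (is ?fn)
proof -
  interpret G: prob_space "std_gauss :: (real^'d) measure" by (rule prob_std_gauss)
  have finI: "finite I"
    using S finite_subset by blast
  have cont: "continuous_on UNIV (\<lambda>q. rotated_family B a q s)" for s
    by (rule continuous_on_rotated_family)
  have fw[measurable]: "(\<lambda>q. face_weight S (rotated_family B a q) I) \<in> borel_measurable QQ"
    using face_weight_measurable[OF S, of "\<lambda>s q. rotated_family B a q s"] cont
    by (simp cong: measurable_cong_sets)
  have nw[measurable]: "(\<lambda>q. normal_weight (rotated_family B a q) I) \<in> borel_measurable QQ"
    using normal_weight_measurable[OF finI, of "\<lambda>s q. rotated_family B a q s"] cont
    by (simp cong: measurable_cong_sets)
  have fw_eq: "ennreal (face_weight S (rotated_family B a q) I)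
      = emeasure std_gauss {g. orth_proj (flat I (rotated_family B a q)) g \<in> open_face S (rotated_family B a q) I}" for q
    by (simp add: face_weight_def measure_gaussian_on subspace_flat open_face_borel S G.emeasure_eq_measure)
  have nw_eq: "ennreal (normal_weight (rotated_family B a q) I)
      = emeasure std_gauss {g. orth_proj (span (rotated_family B a q ` I)) g
          \<in> assemble B q ` {z. \<forall>i. z $ i \<in> convex_cone hull (a i ` section_at I i)}}" for q
    by (simp add: normal_weight_def measure_gaussian_on closed_convex_cone_hull borel_closed finI G.emeasure_eq_measure
        flip: cone_hull_rotated_family cone_hull_axis_family)
  have span_eq: "1 = emeasure (std_gauss :: (real^'d) measure) {g. orth_proj (span (rotated_family B a q ` I)) g
          \<in> assemble B q ` {z. \<forall>i. z $ i \<in> span (a i ` section_at I i)}}" for q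
    using G.emeasure_space_1 orth_proj_in(1)[OF subspace_span, of "rotated_family B a q ` I"]
    by (simp flip: span_rotated_family span_axis_family)
  have fs: "\<And>i. finite (section_at S i)" "\<And>i. finite (section_at I i)"
    using S(1) finI by (auto intro: section_at_finite)
  have one: "measure (gaussian_on (span (a i ` section_at I i))) (span (a i ` section_at I i)) = 1" for i
    using G.prob_space orth_proj_in(1)[OF subspace_span[of "a i ` section_at I i"]]
    by (simp add: measure_gaussian_on borel_closed closed_subspace)
  have "(\<integral>\<^sup>+q. ennreal (face_weight S (rotated_family B a q) I) * 1 \<partial>QQ)
      = (\<integral>\<^sup>+q. emeasure std_gauss {g. orth_proj (flat I (rotated_family B a q)) g \<in> open_face S (rotated_family B a q) I}
        * emeasure std_gauss {g. orth_proj (span (rotated_family B a q ` I)) g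
            \<in> assemble B q ` {z. \<forall>i. z $ i \<in> span (a i ` section_at I i)}} \<partial>QQ)"
    by (intro nn_integral_cong) (simp only: fw_eq span_eq[symmetric])
  also have "\<dots> = ennreal ((\<Prod>i\<in>UNIV. face_weight (section_at S i) (a i) (section_at I i))
      * (\<Prod>i\<in>UNIV. measure (gaussian_on (span (a i ` section_at I i))) (span (a i ` section_at I i))))"
    by (rule expected_weight[OF B S dimk]) (auto simp: span_scale borel_closed closed_subspace)
  finally have "(\<integral>\<^sup>+q. ennreal (face_weight S (rotated_family B a q) I) \<partial>QQ) = ennreal (face_weight S (axis_family a) I)"
    by (simp add: face_weight_axis_family[OF fs(1) S(2)] one)
  then show ?f
    by (subst integral_eq_nn_integral) (auto simp: face_weight_bounds)
  have "(\<integral>\<^sup>+q. ennreal (face_weight S (rotated_family B a q) I) * ennreal (normal_weight (rotated_family B a q) I) \<partial>QQ)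
      = ennreal ((\<Prod>i\<in>UNIV. face_weight (section_at S i) (a i) (section_at I i)) * (\<Prod>i\<in>UNIV. normal_weight (a i) (section_at I i)))"
    unfolding fw_eq nw_eq
    unfolding normal_weight_def
  proof (rule expected_weight[OF B S dimk])
    show "convex_cone hull (a i ` section_at I i) \<subseteq> span (a i ` section_at I i)" for i
      by (intro hull_minimal span_superset convex_cone_span)
    show "convex_cone hull (a i ` section_at I i) \<in> sets borel" for i
      using fs by (intro borel_closed closed_convex_cone_hull) auto
    show "c *\<^sub>R x \<in> convex_cone hull (a i ` section_at I i)" if "x \<in> convex_cone hull (a i ` section_at I i)" "0 < c" for i x c
      using that by (intro convex_cone_hull_mul) auto
  qed
  then have "(\<integral>\<^sup>+q. ennreal (face_weight S (rotated_family B a q) I * normal_weight (rotated_family B a q) I) \<partial>QQ)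
      = ennreal (face_weight S (axis_family a) I * normal_weight (axis_family a) I)"
    by (simp add: face_weight_axis_family[OF fs(1) S(2)] normal_weight_axis_family[OF fs(2)] ennreal_mult face_weight_bounds normal_weight_bounds)
  then show ?fn
    by (subst integral_eq_nn_integral) (auto simp: face_weight_bounds normal_weight_bounds)
qed

text \<open>Both conditions on the dimension of a flat say that the span of the normal vectors has dimension
  \<open>d - k\<close>.  Almost surely the span for the intersection has the dimension of the one for the product, unless the
  latter exceeds \<open>d\<close>; then the flat of the intersection is \<open>{0}\<close>, which \<open>k > 0\<close> excludes.\<close>

lemma (in rotation_invariant) expected_sum_of_weights:
  fixes B :: "'i \<Rightarrow> real^'d^'d" and a :: "'i \<Rightarrow> 'j \<Rightarrow> real^'d" and S :: "('i \<times> 'j) set"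
    and w :: "(real^'d^'d^'i) \<Rightarrow> ('i \<times> 'j) set \<Rightarrow> real"
  assumes B: "\<And>i. invertible (B i)" and S: "finite S"
    and card: "CARD('i) = n + 1" and k: "0 < k" "k \<le> CARD('d)"
    and w: "\<And>I. I \<subseteq> S \<Longrightarrow> (\<lambda>q. w q I) \<in> borel_measurable borel" "\<And>q I. 0 \<le> w q I \<and> w q I \<le> 1"
    and mean: "\<And>I. I \<subseteq> S \<Longrightarrow> dim (span (axis_family a ` I)) < CARD('d) \<Longrightarrow> (\<integral>q. w q I \<partial>QQ) = w' I"
  shows "(\<lambda>q. \<Sum>I | I \<in> Pow S \<and> dim (flat I (rotated_family B a q)) = k. w q I) \<in> borel_measurable borel" (is ?m)
    and "integrable QQ (\<lambda>q. \<Sum>I | I \<in> Pow S \<and> dim (flat I (rotated_family B a q)) = k. w q I)" (is ?i)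
    and "(\<integral>q. (\<Sum>I | I \<in> Pow S \<and> dim (flat I (rotated_family B a q)) = k. w q I) \<partial>QQ)
      = (\<Sum>I | I \<in> Pow S \<and> dim (flat I (axis_family a)) = n * CARD('d) + k. w' I)" (is ?e)
proof -
  let ?t = "\<lambda>q I. if dim (flat I (rotated_family B a q)) = k then w q I else 0"
  have fin: "finite (Pow S)"
    using S by simp
  have sum_eq: "(\<Sum>I | I \<in> Pow S \<and> dim (flat I (rotated_family B a q)) = k. w q I) = (\<Sum>I\<in>Pow S. ?t q I)" for q
    by (rule sum.inter_filter[OF fin])
  have tm: "(\<lambda>q. ?t q I) \<in> borel_measurable borel" if I: "I \<in> Pow S" for I
  proof -
    have "finite I"
      using I S finite_subset by blast
    then have "{q. dim (flat I (rotated_family B a q)) = k} \<in> sets borel"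
      using borel_dim_flat[of I "\<lambda>s q. rotated_family B a q s", OF _ continuous_on_rotated_family] by simp
    then show ?thesis
      using w(1)[of I] I by (intro measurable_If) auto
  qed
  then have tm': "(\<lambda>q. ?t q I) \<in> borel_measurable QQ" if "I \<in> Pow S" for I
    using that by (simp cong: measurable_cong_sets)
  have ti: "integrable QQ (\<lambda>q. ?t q I)" if "I \<in> Pow S" for I
    using w(2) tm'[OF that] by (intro integrable_const_bound[where B=1]) auto
  show ?m
    unfolding sum_eq using tm by (intro borel_measurable_sum)
  show ?i
    unfolding sum_eq using ti by (intro Bochner_Integration.integrable_sum)
  have te: "(\<integral>q. ?t q I \<partial>QQ) = (if dim (flat I (axis_family a)) = n * CARD('d) + k then w' I else 0)" if I: "I \<in> Pow S" for I
  proof -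
    let ?v = "dim (span (axis_family a ` I))"
    have "dim (flat I (axis_family a)) + ?v = (n + 1) * CARD('d)"
      using dim_flat[of I "axis_family a"] card by simp
    then have iff: "dim (flat I (axis_family a)) = n * CARD('d) + k \<longleftrightarrow> ?v + k = CARD('d)"
      using k by auto
    have ae: "AE q in QQ. dim (flat I (rotated_family B a q)) = k \<longleftrightarrow> ?v + k = CARD('d)"
      using AE_transversal[where B=B and a=a and I=I, OF B]
    proof eventually_elim
      fix q assume "dim (assemble B q ` span (axis_family a ` I)) = min CARD('d) ?v
          \<and> (?v \<le> CARD('d) \<longrightarrow> inj_on (assemble B q) (span (axis_family a ` I)))"
      then have "dim (flat I (rotated_family B a q)) + min CARD('d) ?v = CARD('d)"
        using dim_flat[of I "rotated_family B a q"] unfolding span_rotated_family by simp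
      then show "dim (flat I (rotated_family B a q)) = k \<longleftrightarrow> ?v + k = CARD('d)"
        using k by arith
    qed
    show ?thesis
    proof (cases "?v + k = CARD('d)")
      case True
      have "(\<integral>q. ?t q I \<partial>QQ) = (\<integral>q. w q I \<partial>QQ)"
        using w(1)[of I] I ae True tm'[OF I] by (intro integral_cong_AE) (auto cong: measurable_cong_sets)
      then show ?thesis
        using mean[of I] I True k by (simp add: iff)
    next
      case False
      have "(\<integral>q. ?t q I \<partial>QQ) = (\<integral>q. 0 \<partial>QQ)"
        using ae False tm'[OF I] by (intro integral_cong_AE) auto
      then show ?thesis
        using False by (simp add: iff)
    qed
  qed
  have "(\<integral>q. (\<Sum>I | I \<in> Pow S \<and> dim (flat I (rotated_family B a q)) = k. w q I) \<partial>QQ) = (\<Sum>I\<in>Pow S. \<integral>q. ?t q I \<partial>QQ)"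
    unfolding sum_eq using ti by (intro Bochner_Integration.integral_sum)
  also have "\<dots> = (\<Sum>I\<in>Pow S. if dim (flat I (axis_family a)) = n * CARD('d) + k then w' I else 0)"
    using te by (intro sum.cong) auto
  also have "\<dots> = (\<Sum>I | I \<in> Pow S \<and> dim (flat I (axis_family a)) = n * CARD('d) + k. w' I)"
    by (rule sum.inter_filter[OF fin, symmetric])
  finally show ?e .
qed

text \<open>Pulling a point back by \<open>T\<^sub>i Q\<^sub>i\<close> is the adjoint of pushing normal vectors forward by \<open>T\<^sub>i\<^sup>-\<^sup>T Q\<^sub>i\<close>.\<close>

lemma image_intersection_ineq_cone:
  fixes T U :: "'i::finite \<Rightarrow> real^'d^'d" and q :: "real^'d^'d^'i"
  assumes T: "\<And>i. T i ** U i = mat 1" "\<And>i. U i ** T i = mat 1" and q: "\<And>i. orthogonal_matrix (q $ i)"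
  shows "(\<Inter>i. (\<lambda>x. T i *v (q $ i *v x)) ` ineq_cone (section_at S i) (a i))
    = ineq_cone S (rotated_family (\<lambda>i. transpose (U i)) a q)"
proof -
  let ?B = "\<lambda>i. transpose (U i)"
  have inv: "T i *v (U i *v x) = x" "U i *v (T i *v x) = x" for i x
    by (simp_all add: matrix_vector_mul_assoc T)
  have orth: "q $ i *v (transpose (q $ i) *v x) = x" "transpose (q $ i) *v (q $ i *v x) = x" for i x
    using q[of i] unfolding orthogonal_matrix_def by (simp_all add: matrix_vector_mul_assoc del: transpose_matrix_vector)
  have co: "coassemble ?B q x $ i = transpose (q $ i) *v (U i *v x)" for x i
    by (simp add: coassemble_def matrix_transpose_mul matrix_vector_mul_assoc del: transpose_matrix_vector)
  have "x \<in> (\<lambda>x. T i *v (q $ i *v x)) ` C \<longleftrightarrow> coassemble ?B q x $ i \<in> C" for x i C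
  proof
    assume "x \<in> (\<lambda>x. T i *v (q $ i *v x)) ` C"
    then obtain y where "y \<in> C" "x = T i *v (q $ i *v y)" by auto
    then show "coassemble ?B q x $ i \<in> C"
      by (simp add: co inv orth del: transpose_matrix_vector)
  next
    assume "coassemble ?B q x $ i \<in> C"
    moreover have "x = T i *v (q $ i *v (coassemble ?B q x $ i))"
      by (simp add: co inv orth del: transpose_matrix_vector)
    ultimately show "x \<in> (\<lambda>x. T i *v (q $ i *v x)) ` C"
      by (rule rev_image_eqI)
  qed
  then have "x \<in> (\<Inter>i. (\<lambda>x. T i *v (q $ i *v x)) ` ineq_cone (section_at S i) (a i))
      \<longleftrightarrow> coassemble ?B q x \<in> ineq_cone S (axis_family a)" for x
    by (simp add: ineq_cone_axis_family)
  moreover have "x \<in> ineq_cone S (rotated_family ?B a q) \<longleftrightarrow> coassemble ?B q x \<in> ineq_cone S (axis_family a)" for x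
    by (simp add: ineq_cone_def inner_rotated_family)
  ultimately show ?thesis
    by blast
qed

theorem theorem1p2:
  fixes n k :: nat
    and C :: "'i::finite \<Rightarrow> (real^'d) set"
    and T :: "'i \<Rightarrow> real^'d^'d"
    and M :: "'w measure"
    and Q :: "'i \<Rightarrow> 'w \<Rightarrow> real^'d^'d"
  assumes "CARD('i) = n + 1"
    and "\<And>i. polyhedral_cone (C i)"
    and "\<And>i. invertible (T i)"
    and "0 < k" and "k \<le> CARD('d)"
    and "prob_space M"
    and "prob_space.indep_vars M (\<lambda>_. orthogonal_group) Q UNIV"
    and "\<And>i. normalized_haar (distr M orthogonal_group (Q i))"
  shows "integrable M (\<lambda>\<omega>. u_functional k (\<Inter>i. (\<lambda>x. T i *v (Q i \<omega> *v x)) ` C i))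
       \<and> prob_space.expectation M (\<lambda>\<omega>. u_functional k (\<Inter>i. (\<lambda>x. T i *v (Q i \<omega> *v x)) ` C i))
           = u_functional (n * CARD('d) + k) (product_cone C)
       \<and> integrable M (\<lambda>\<omega>. v_functional k (\<Inter>i. (\<lambda>x. T i *v (Q i \<omega> *v x)) ` C i))
       \<and> prob_space.expectation M (\<lambda>\<omega>. v_functional k (\<Inter>i. (\<lambda>x. T i *v (Q i \<omega> *v x)) ` C i))
           = v_functional (n * CARD('d) + k) (product_cone C)"
proof -
  have "\<forall>i. \<exists>(m::nat) (a :: nat \<Rightarrow> real^'d). C i = ineq_cone {..<m} a"
    using assms(2) unfolding polyhedral_cone_def ineq_cone_def Ball_def lessThan_iff by blast
  then obtain m :: "'i \<Rightarrow> nat" and a :: "'i \<Rightarrow> nat \<Rightarrow> real^'d" where C: "\<And>i. C i = ineq_cone {..<m i} (a i)"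
    by metis
  define S where "S = Sigma UNIV (\<lambda>i. {..<m i})"
  have S: "finite S"
    by (simp add: S_def)
  have C_S: "C i = ineq_cone (section_at S i) (a i)" for i
    by (simp add: C S_def section_at_def lessThan_def)
  have "\<forall>i. \<exists>U. T i ** U = mat 1 \<and> U ** T i = mat 1"
    using assms(3) unfolding invertible_def by blast
  then obtain U where U: "\<And>i. T i ** U i = mat 1" "\<And>i. U i ** T i = mat 1"
    by metis
  define B where "B = (\<lambda>i. transpose (U i))"
  have B: "invertible (B i)" for i
    unfolding B_def using U[of i] by (intro transpose_invertible) (auto simp: invertible_def)
  define V where "V \<omega> = (\<chi> i. Q i \<omega>)" for \<omega>
  note law = rotation_invariant_joint_law[OF assms(6-8), folded V_def]
  define QQ where "QQ = distr M borel V"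
  have V[measurable]: "V \<in> measurable M borel"
    using law(2) by (simp add: V_def[abs_def])
  interpret rotation_invariant QQ
    using law(1) by (simp add: QQ_def V_def[abs_def])
  have inter: "(\<Inter>i. (\<lambda>x. T i *v (Q i \<omega> *v x)) ` C i) = ineq_cone S (rotated_family B a (V \<omega>))" if "\<omega> \<in> space M" for \<omega>
    using image_intersection_ineq_cone[where T=T and U=U and q="V \<omega>" and S=S and a=a, OF U] law(3)[OF that]
    by (simp add: V_def C_S B_def)
  have prod: "product_cone C = ineq_cone S (axis_family a)"
    by (simp add: product_cone_def C_S ineq_cone_axis_family)
  have cont: "continuous_on UNIV (\<lambda>q. rotated_family B a q s)" for s
    by (rule continuous_on_rotated_family)
  have fw: "(\<lambda>q. face_weight S (rotated_family B a q) I) \<in> borel_measurable borel" if "I \<subseteq> S" for I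
    using face_weight_measurable[OF S that, of "\<lambda>s q. rotated_family B a q s"] cont by simp
  have nw: "(\<lambda>q. normal_weight (rotated_family B a q) I) \<in> borel_measurable borel" if "I \<subseteq> S" for I
    using normal_weight_measurable[of I "\<lambda>s q. rotated_family B a q s"] cont finite_subset[OF that S] by simp
  note sums = expected_sum_of_weights[where B=B and a=a and S=S and n=n and k=k, OF B S assms(1,4,5)]
  have transfer: "integrable M f \<and> prob_space.expectation M f = (\<integral>q. h q \<partial>QQ)"
    if "h \<in> borel_measurable borel" "integrable QQ h" "\<And>\<omega>. \<omega> \<in> space M \<Longrightarrow> f \<omega> = h (V \<omega>)"
    for f :: "'w \<Rightarrow> real" and h
  proof -
    have "integrable M (\<lambda>\<omega>. h (V \<omega>))"
      using that(2) unfolding QQ_def by (rule integrable_distr[OF V])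
    moreover have "(\<integral>q. h q \<partial>QQ) = (\<integral>\<omega>. h (V \<omega>) \<partial>M)"
      unfolding QQ_def using that(1) by (intro integral_distr) auto
    ultimately show ?thesis
      using that(3) by (simp cong: Bochner_Integration.integrable_cong Bochner_Integration.integral_cong)
  qed
  have u: "integrable M (\<lambda>\<omega>. u_functional k (\<Inter>i. (\<lambda>x. T i *v (Q i \<omega> *v x)) ` C i))
      \<and> prob_space.expectation M (\<lambda>\<omega>. u_functional k (\<Inter>i. (\<lambda>x. T i *v (Q i \<omega> *v x)) ` C i))
        = (\<integral>q. (\<Sum>I | I \<in> Pow S \<and> dim (flat I (rotated_family B a q)) = k. face_weight S (rotated_family B a q) I) \<partial>QQ)"
    by (rule transfer; (intro sums(1,2) fw expected_face_weights(1)[OF B S])?)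
       (auto simp: inter u_functional_ineq_cone[OF S] face_weight_bounds)
  have v: "integrable M (\<lambda>\<omega>. v_functional k (\<Inter>i. (\<lambda>x. T i *v (Q i \<omega> *v x)) ` C i))
      \<and> prob_space.expectation M (\<lambda>\<omega>. v_functional k (\<Inter>i. (\<lambda>x. T i *v (Q i \<omega> *v x)) ` C i))
        = (\<integral>q. (\<Sum>I | I \<in> Pow S \<and> dim (flat I (rotated_family B a q)) = k.
            face_weight S (rotated_family B a q) I * normal_weight (rotated_family B a q) I) \<partial>QQ)"
    by (rule transfer; (intro sums(1,2) borel_measurable_times fw nw expected_face_weights(2)[OF B S])?)
       (auto simp: inter v_functional_ineq_cone[OF S] face_weight_bounds normal_weight_bounds mult_le_one)
  have "(\<integral>q. (\<Sum>I | I \<in> Pow S \<and> dim (flat I (rotated_family B a q)) = k. face_weight S (rotated_family B a q) I) \<partial>QQ)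
      = u_functional (n * CARD('d) + k) (product_cone C)"
    unfolding prod u_functional_ineq_cone[OF S]
    by (intro sums(3) fw expected_face_weights(1)[OF B S]) (auto simp: face_weight_bounds)
  moreover have "(\<integral>q. (\<Sum>I | I \<in> Pow S \<and> dim (flat I (rotated_family B a q)) = k.
            face_weight S (rotated_family B a q) I * normal_weight (rotated_family B a q) I) \<partial>QQ)
      = v_functional (n * CARD('d) + k) (product_cone C)"
    unfolding prod v_functional_ineq_cone[OF S]
    by (intro sums(3) borel_measurable_times fw nw expected_face_weights(2)[OF B S])
       (auto simp: face_weight_bounds normal_weight_bounds mult_le_one)
  ultimately show ?thesis
    using u v by simp
qed

end
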